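(* Let $U\in\mathbb U$ with $d(U)=L$. Then: (1) $[U]_{\beta\eta}=\{M\in\mathcal M^L : M \text{ is closed, and } M\rhd^*_{\beta\eta}N \text{ for some } N \text{ with } N:\langle()\vdash U\rangle\}$. (2) $[U]_{\beta}=[U]_{h}=\{M\in\mathcal M^L : M:\langle()\vdash U\rangle\}$. (3) $[U]_{\beta\eta}$ is stable under reduction: if $M\in[U]_{\beta\eta}$ and $M\rhd^*_{\beta\eta}N$ then $N\in[U]_{\beta\eta}$.
   Context: Indexes: an index is a finite sequence of natural numbers; $\mathcal L_{\mathbb N}$ is the set of indexes, $\oslash$ the empty sequence, $i::L$ the sequence obtained by prepending $i\in\mathbb N$ to $L$, $L::K$ concatenation; $L_1\preceq L_2$ (also written $L_2\succeq L_1$) iff $L_2=L_1::L_3$ for some index $L_3$. Terms: let $\mathcal V$ be a countably infinite set of variables. The set $\mathcal M$ of terms, the set $\mathrm{fv}(M)$ of free indexed variables, the degree $d(M)\in\mathcal L_{\mathbb N}$ and joinability $M\diamond N$ are defined simultaneously: for $x\in\mathcal V$ and index $L$, $x^L\in\mathcal M$, $\mathrm{fv}(x^L)=\{x^L\}$, $d(x^L)=L$; if $M,N\in\mathcal M$, $d(M)\preceq d(N)$ and $M\diamond N$, then $MN\in\mathcal M$, $\mathrm{fv}(MN)=\mathrm{fv}(M)\cup\mathrm{fv}(N)$, $d(MN)=d(M)$; if $M\in\mathcal M$ and $L\succeq d(M)$ then $\lambda x^L.M\in\mathcal M$, $\mathrm{fv}(\lambda x^L.M)=\mathrm{fv}(M)\setminus\{x^L\}$,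 $d(\lambda x^L.M)=d(M)$. $M\diamond N$ means: whenever $x^L\in\mathrm{fv}(M)$ and $x^K\in\mathrm{fv}(N)$ then $L=K$. Terms are taken modulo $\alpha$-conversion ($\lambda x^L.M=\lambda y^L.M[x^L:=y^L]$ with $y$ fresh). Capture-avoiding (simultaneous) substitution $M[(x_i^{L_i}:=N_i)_n]$ is only defined when $M,N_1,\dots,N_n$ are pairwise joinable and $d(N_i)=L_i$. $M$ is closed iff $\mathrm{fv}(M)=\emptyset$. $\rhd_\beta$ is the least relation on $\mathcal M$ compatible with abstraction and application (when results are terms) containing $(\lambda x^L.M)N\rhd_\beta M[x^L:=N]$ for $d(N)=L$; $\rhd_\eta$ likewise from $\lambda x^L.(Mx^L)\rhd_\eta M$ when $x^L\notin\mathrm{fv}(M)$; $\rhd_{\beta\eta}=\rhd_\beta\cup\rhd_\eta$; $(\lambda x^L.M)NN_1\dots N_n\rhd_h M[x^L:=N]N_1\dots N_n$ ($n\ge 0$); $\rhd_r^*$ is the reflexive–transitive closure. Lifting: $(x^L)^{+i}=x^{i::L}$, $(M_1M_2)^{+i}=M_1^{+i}M_2^{+i}$, $(\lambda x^L.M)^{+i}=\lambda x^{i::L}.M^{+i}$. Types: $\mathcal A$ is a countably infinite set of atomic types, $\overline e_0,\overline e_1,\dots$ expansion variables. Sets $\mathbb T\subseteq\mathbb U$ and degree $d:\mathbb U\to\mathcal L_{\mathbb N}$: $a\in\mathbb T$, $d(a)=\oslash$ for $a\in\mathcal A$; if $U\in\mathbb U$, $T\in\mathbb T$ then $U\to T\in\mathbb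 T$, $d(U\to T)=\oslash$; $\omega^L\in\mathbb U$ with $d(\omega^L)=L$; if $U_1,U_2\in\mathbb U$ with $d(U_1)=d(U_2)$ then $U_1\sqcap U_2\in\mathbb U$ of that degree; if $U\in\mathbb U$ then $\overline e_iU\in\mathbb U$ with $d(\overline e_iU)=i::d(U)$. Types are quotiented by: $\sqcap$ commutative, associative, idempotent; $\overline e_i(U_1\sqcap U_2)=\overline e_iU_1\sqcap\overline e_iU_2$; $\omega^L\sqcap U=U$ when $d(U)=L$; $\overline e_i\omega^K=\omega^{i::K}$. Environments: a type environment is a finite set $\{x_1^{L_1}:U_1,\dots,x_n^{L_n}:U_n\}$ with $U_i\in\mathbb U$ giving each $x^L$ at most one type; $()$ is the empty one; $\Gamma,\Delta$ is union of environments with disjoint domains; $env^\omega_M$ assigns $\omega^L$ to each $x^L\in\mathrm{fv}(M)$; $\Gamma_1\sqcap\Gamma_2$ assigns $U\sqcap U'$ to common $x^L$ (types of equal degree) and keeps the other declarations; $\overline e_j\{x_i^{L_i}:U_i\}=\{x_i^{j::L_i}:\overline e_jU_i\}$; $\Gamma_1\diamond\Gamma_2$ iff $x^L\in\mathrm{dom}\,\Gamma_1$, $x^K\in\mathrm{dom}\,\Gamma_2$ imply $L=K$. Subtyping $\sqsubseteq$ (on types, on environments, on typings $\langle\Gamma\vdash U\rangle$) is the least relation closed under: reflexivity; transitivity; $U_1\sqcap U_2\sqsubseteq U_1$ if $d(U_1)=d(U_2)$; $U_1\sqcap U_2\sqsubseteq V_1\sqcap V_2$ if $U_1\sqsubseteq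 V_1,U_2\sqsubseteq V_2$; $U_1\to T_1\sqsubseteq U_2\to T_2$ if $U_2\sqsubseteq U_1$ and $T_1\sqsubseteq T_2$; $\overline e_iU_1\sqsubseteq\overline e_iU_2$ if $U_1\sqsubseteq U_2$; $\Gamma,y^L:U_1\sqsubseteq\Gamma,y^L:U_2$ if $U_1\sqsubseteq U_2$; $\langle\Gamma_1\vdash U_1\rangle\sqsubseteq\langle\Gamma_2\vdash U_2\rangle$ if $U_1\sqsubseteq U_2$ and $\Gamma_2\sqsubseteq\Gamma_1$. Typing: $M:\langle\Gamma\vdash U\rangle$ is derivable by the rules ($T\in\mathbb T$, $U\in\mathbb U$): (ax) $x^\oslash:\langle(x^\oslash:T)\vdash T\rangle$; ($\omega$) $M:\langle env^\omega_M\vdash\omega^{d(M)}\rangle$; ($\to_I$) from $M:\langle\Gamma,(x^L:U)\vdash T\rangle$ infer $\lambda x^L.M:\langle\Gamma\vdash U\to T\rangle$; ($\to_I'$) from $M:\langle\Gamma\vdash T\rangle$ and $x^L\notin\mathrm{dom}\,\Gamma$ infer $\lambda x^L.M:\langle\Gamma\vdash\omega^L\to T\rangle$; ($\to_E$) from $M_1:\langle\Gamma_1\vdash U\to T\rangle$, $M_2:\langle\Gamma_2\vdash U\rangle$, $\Gamma_1\diamond\Gamma_2$ infer $M_1M_2:\langle\Gamma_1\sqcap\Gamma_2\vdash T\rangle$; ($\sqcap_I$) from $M:\langle\Gamma\vdash U_1\rangle$, $M:\langle\Gamma\vdash U_2\rangle$ infer $M:\langle\Gamma\vdash U_1\sqcap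 U_2\rangle$; ($e$) from $M:\langle\Gamma\vdash U\rangle$ infer $M^{+j}:\langle\overline e_j\Gamma\vdash\overline e_jU\rangle$; ($\sqsubseteq$) from $M:\langle\Gamma\vdash U\rangle$ and $\langle\Gamma\vdash U\rangle\sqsubseteq\langle\Gamma'\vdash U'\rangle$ infer $M:\langle\Gamma'\vdash U'\rangle$. Realisability: $\mathcal V=\mathcal V_1\cup\mathcal V_2$ with $\mathcal V_1,\mathcal V_2$ disjoint and countably infinite. For $\mathcal X,\mathcal Y\subseteq\mathcal M$: $\mathcal X^{+i}=\{M^{+i}:M\in\mathcal X\}$; $\mathcal X\leadsto\mathcal Y=\{M\in\mathcal M: MN\in\mathcal Y$ for all $N\in\mathcal X$ with $M\diamond N\}$; for $r\in\{\beta,\beta\eta,h\}$, $\mathcal X$ is $r$-saturated if $M\rhd_r^*N$ and $N\in\mathcal X$ imply $M\in\mathcal X$. $\mathcal M^L=\{M\in\mathcal M:d(M)=L\}$; for $x\in\mathcal V_1$, $\mathcal N^L_x=\{x^LN_1\dots N_k\in\mathcal M:k\ge0\}$. An $r$-interpretation is a map $\mathcal I:\mathcal A\to\mathcal P(\mathcal M^\oslash)$ such that each $\mathcal I(a)$ is $r$-saturated and $\mathcal N^\oslash_x\subseteq\mathcal I(a)$ for all $x\in\mathcal V_1$; it is extended to $\mathbb U$ by $\mathcal I(\omega^L)=\mathcal M^L$, $\mathcal I(\overline e_iU)=\mathcal I(U)^{+i}$, $\mathcal I(U_1\sqcap U_2)=\mathcal I(U_1)\cap\mathcal I(U_2)$,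 $\mathcal I(U\to T)=\mathcal I(U)\leadsto\mathcal I(T)$. $[U]_r=\{M\in\mathcal M: M$ closed and $M\in\mathcal I(U)$ for every $r$-interpretation $\mathcal I\}$. *)

theory Defs
  imports Main "HOL-Library.Sublist"
begin

section \<open>Indexed terms modulo alpha-conversion\<close>

text \<open>
  The order on indexes (extension on the right) is \<^const>\<open>prefix\<close>. Natural numbers serve as the
  countably infinite sets of variables and of atomic types.

  Terms modulo alpha-conversion are represented in locally nameless style: free indexed variables
  are named, bound ones are de Bruijn indices, so alpha-equivalent terms are equal. No later
  definition by rules mentions de Bruijn indices: they use the named abstraction \<open>lam x L M\<close>, which
  stands for the alpha-class of \<open>\<lambda>x\<^sup>L. M\<close>, and the set \<open>terms\<close> inductively generated with it.
  The lemmas \<open>lam_alpha\<close>, \<open>lam_eq_iff\<close>, \<open>fv_lam\<close>, \<open>degree_lam\<close>, \<open>subst_lam\<close> and \<open>lift_lam\<close> confirm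
  that \<open>lam\<close> behaves as abstraction on alpha-classes.
\<close>

type_synonym var = nat
type_synonym index = "nat list"
type_synonym ivar = "var \<times> index"

datatype trm = FVar var index | BVar nat | App trm trm | Abs index trm

primrec fv :: "trm \<Rightarrow> ivar set" where
  "fv (FVar x L) = {(x, L)}"
| "fv (BVar n) = {}"
| "fv (App M N) = fv M \<union> fv N"
| "fv (Abs L M) = fv M"

primrec bind_var :: "ivar \<Rightarrow> nat \<Rightarrow> trm \<Rightarrow> trm" where
  "bind_var v k (FVar x L) = (if (x, L) = v then BVar k else FVar x L)"
| "bind_var v k (BVar n) = BVar n"
| "bind_var v k (App M N) = App (bind_var v k M) (bind_var v k N)"
| "bind_var v k (Abs L M) = Abs L (bind_var v (Suc k) M)"

definition lam :: "var \<Rightarrow> index \<Rightarrow> trm \<Rightarrow> trm" where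
  "lam x L M = Abs L (bind_var (x, L) 0 M)"

text \<open>The list argument of \<open>degree_in\<close> records the indexes of the enclosing binders, innermost
  first.\<close>

primrec degree_in :: "index list \<Rightarrow> trm \<Rightarrow> index" where
  "degree_in Ls (FVar x L) = L"
| "degree_in Ls (BVar n) = Ls ! n"
| "degree_in Ls (App M N) = degree_in Ls M"
| "degree_in Ls (Abs L M) = degree_in (L # Ls) M"

definition degree :: "trm \<Rightarrow> index" where
  "degree M = degree_in [] M"

definition joinable_sets :: "ivar set \<Rightarrow> ivar set \<Rightarrow> bool" where
  "joinable_sets A B \<longleftrightarrow> (\<forall>x L K. (x, L) \<in> A \<longrightarrow> (x, K) \<in> B \<longrightarrow> L = K)"

definition joinable :: "trm \<Rightarrow> trm \<Rightarrow> bool" where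
  "joinable M N \<longleftrightarrow> joinable_sets (fv M) (fv N)"

inductive_set "terms" :: "trm set" where
  FVar: "FVar x L \<in> terms"
| App: "M \<in> terms \<Longrightarrow> N \<in> terms \<Longrightarrow> prefix (degree M) (degree N) \<Longrightarrow> joinable M N
    \<Longrightarrow> App M N \<in> terms"
| lam: "M \<in> terms \<Longrightarrow> prefix (degree M) L \<Longrightarrow> lam x L M \<in> terms"

definition terms_of :: "index \<Rightarrow> trm set" where
  "terms_of L = {M \<in> terms. degree M = L}"

definition closed :: "trm \<Rightarrow> bool" where
  "closed M \<longleftrightarrow> fv M = {}"

text \<open>\<open>subst M x L N\<close> is \<open>M[x\<^sup>L := N]\<close>. It is capture-avoiding for \<open>N \<in> terms\<close>, as such \<open>N\<close> have
  no dangling de Bruijn indices. The side conditions under which the substitution is defined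
  (joinability, \<open>degree N = L\<close>) are premises wherever it is used.\<close>

primrec subst :: "trm \<Rightarrow> var \<Rightarrow> index \<Rightarrow> trm \<Rightarrow> trm" where
  "subst (FVar y K) x L N = (if (y, K) = (x, L) then N else FVar y K)"
| "subst (BVar n) x L N = BVar n"
| "subst (App M1 M2) x L N = App (subst M1 x L N) (subst M2 x L N)"
| "subst (Abs K M) x L N = Abs K (subst M x L N)"

primrec lift :: "nat \<Rightarrow> trm \<Rightarrow> trm" where
  "lift i (FVar x L) = FVar x (i # L)"
| "lift i (BVar n) = BVar n"
| "lift i (App M N) = App (lift i M) (lift i N)"
| "lift i (Abs L M) = Abs (i # L) (lift i M)"

subsection \<open>Adequacy of the representation\<close>

primrec lc_at :: "nat \<Rightarrow> trm \<Rightarrow> bool" where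
  "lc_at k (FVar x L) \<longleftrightarrow> True"
| "lc_at k (BVar n) \<longleftrightarrow> n < k"
| "lc_at k (App M N) \<longleftrightarrow> lc_at k M \<and> lc_at k N"
| "lc_at k (Abs L M) \<longleftrightarrow> lc_at (Suc k) M"

lemma lc_at_bind_var: "lc_at k M \<Longrightarrow> lc_at (Suc k) (bind_var v k M)"
  by (induction M arbitrary: k) auto

lemma terms_lc: "M \<in> terms \<Longrightarrow> lc_at 0 M"
  by (induction rule: terms.induct) (auto simp: lam_def intro: lc_at_bind_var)

lemma fv_bind_var: "fv (bind_var v k M) = fv M - {v}"
  by (induction M arbitrary: k) auto

lemma fv_lam: "fv (lam x L M) = fv M - {(x, L)}"
  by (simp add: lam_def fv_bind_var)

lemma degree_in_bind_var:
  "lc_at (length Ls) M \<Longrightarrow> degree_in (Ls @ [L]) (bind_var (x, L) (length Ls) M) = degree_in Ls M"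
proof (induction M arbitrary: Ls)
  case (Abs K M)
  then show ?case using Abs.IH[of "K # Ls"] by simp
qed (auto simp: nth_append)

lemma degree_lam: "M \<in> terms \<Longrightarrow> degree (lam x L M) = degree M"
  using degree_in_bind_var[of "[]" M L x] terms_lc[of M] by (simp add: degree_def lam_def)

lemma bind_var_rename:
  "(y, L) \<notin> fv M \<Longrightarrow> bind_var (y, L) k (subst M x L (FVar y L)) = bind_var (x, L) k M"
  by (induction M arbitrary: k) auto

lemma lam_alpha: "(y, L) \<notin> fv M \<Longrightarrow> lam x L M = lam y L (subst M x L (FVar y L))"
  by (simp add: lam_def bind_var_rename)

lemma bind_var_inj:
  "lc_at k M \<Longrightarrow> lc_at k N \<Longrightarrow> bind_var v k M = bind_var v k N \<Longrightarrow> M = N"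
proof (induction M arbitrary: N k)
  case (FVar x L)
  then show ?case by (cases N) (auto split: if_splits)
next
  case (BVar n)
  then show ?case by (cases N) (auto split: if_splits)
next
  case (App M1 M2)
  then show ?case by (cases N) (auto split: if_splits)
next
  case (Abs L M)
  then show ?case by (cases N) (auto split: if_splits)
qed

lemma lam_eq_iff:
  assumes "M \<in> terms" "N \<in> terms"
  shows "lam x L M = lam x K N \<longleftrightarrow> L = K \<and> M = N"
  using bind_var_inj[of 0 M N] terms_lc assms by (auto simp: lam_def)

lemma bind_var_fresh: "v \<notin> fv N \<Longrightarrow> bind_var v k N = N"
  by (induction N arbitrary: k) auto

lemma bind_var_subst:
  "(y, K) \<noteq> (x, L) \<Longrightarrow> (y, K) \<notin> fv N \<Longrightarrow>
    subst (bind_var (y, K) k M) x L N = bind_var (y, K) k (subst M x L N)"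
  by (induction M arbitrary: k) (auto simp: bind_var_fresh)

lemma subst_lam:
  "(y, K) \<noteq> (x, L) \<Longrightarrow> (y, K) \<notin> fv N \<Longrightarrow> subst (lam y K M) x L N = lam y K (subst M x L N)"
  by (simp add: lam_def bind_var_subst)

lemma bind_var_lift: "lift i (bind_var (x, L) k M) = bind_var (x, i # L) k (lift i M)"
  by (induction M arbitrary: k) auto

lemma lift_lam: "lift i (lam x L M) = lam x (i # L) (lift i M)"
  by (simp add: lam_def bind_var_lift)

section \<open>Reduction\<close>

inductive beta :: "trm \<Rightarrow> trm \<Rightarrow> bool" where
  redex: "M \<in> terms \<Longrightarrow> App (lam x L M) N \<in> terms \<Longrightarrow> joinable M N \<Longrightarrow> degree N = L
    \<Longrightarrow> beta (App (lam x L M) N) (subst M x L N)"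
| lam: "beta M M' \<Longrightarrow> lam x L M \<in> terms \<Longrightarrow> lam x L M' \<in> terms
    \<Longrightarrow> beta (lam x L M) (lam x L M')"
| appL: "beta M M' \<Longrightarrow> App M N \<in> terms \<Longrightarrow> App M' N \<in> terms \<Longrightarrow> beta (App M N) (App M' N)"
| appR: "beta N N' \<Longrightarrow> App M N \<in> terms \<Longrightarrow> App M N' \<in> terms \<Longrightarrow> beta (App M N) (App M N')"

inductive eta :: "trm \<Rightarrow> trm \<Rightarrow> bool" where
  redex: "App M (FVar x L) \<in> terms \<Longrightarrow> (x, L) \<notin> fv M
    \<Longrightarrow> eta (lam x L (App M (FVar x L))) M"
| lam: "eta M M' \<Longrightarrow> lam x L M \<in> terms \<Longrightarrow> lam x L M' \<in> terms
    \<Longrightarrow> eta (lam x L M) (lam x L M')"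
| appL: "eta M M' \<Longrightarrow> App M N \<in> terms \<Longrightarrow> App M' N \<in> terms \<Longrightarrow> eta (App M N) (App M' N)"
| appR: "eta N N' \<Longrightarrow> App M N \<in> terms \<Longrightarrow> App M N' \<in> terms \<Longrightarrow> eta (App M N) (App M N')"

definition betaeta :: "trm \<Rightarrow> trm \<Rightarrow> bool" where
  "betaeta M N \<longleftrightarrow> beta M N \<or> eta M N"

definition apps :: "trm \<Rightarrow> trm list \<Rightarrow> trm" where
  "apps M Ns = foldl App M Ns"

inductive head :: "trm \<Rightarrow> trm \<Rightarrow> bool" where
  redex: "M \<in> terms \<Longrightarrow> apps (App (lam x L M) N) Ns \<in> terms \<Longrightarrow> joinable M N \<Longrightarrow> degree N = L
    \<Longrightarrow> head (apps (App (lam x L M) N) Ns) (apps (subst M x L N) Ns)"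

section \<open>Types\<close>

datatype ty = Atom nat | Arr ty ty | Omega index | Inter ty ty | Exp nat ty

primrec tdegree :: "ty \<Rightarrow> index" where
  "tdegree (Atom a) = []"
| "tdegree (Arr U T) = []"
| "tdegree (Omega L) = L"
| "tdegree (Inter U V) = tdegree U"
| "tdegree (Exp i U) = i # tdegree U"

inductive_set T_types :: "ty set" and U_types :: "ty set" where
  Atom: "Atom a \<in> T_types"
| Arr: "U \<in> U_types \<Longrightarrow> T \<in> T_types \<Longrightarrow> Arr U T \<in> T_types"
| T_in_U: "T \<in> T_types \<Longrightarrow> T \<in> U_types"
| Omega: "Omega L \<in> U_types"
| Inter: "U \<in> U_types \<Longrightarrow> V \<in> U_types \<Longrightarrow> tdegree U = tdegree V \<Longrightarrow> Inter U V \<in> U_types"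
| Exp: "U \<in> U_types \<Longrightarrow> Exp i U \<in> U_types"

text \<open>\<open>ty_eq\<close> is the least congruence on \<^const>\<open>U_types\<close> generated by the equations by which types
  are quotiented. The quotient is not formed as a type of its own; instead reflexivity of
  subtyping below holds up to \<open>ty_eq\<close>, so that by the subsumption rule typing is invariant under
  replacing types (also those in environments) by equal ones.\<close>

inductive ty_eq :: "ty \<Rightarrow> ty \<Rightarrow> bool" where
  refl: "U \<in> U_types \<Longrightarrow> ty_eq U U"
| sym: "ty_eq U V \<Longrightarrow> ty_eq V U"
| trans: "ty_eq U V \<Longrightarrow> ty_eq V W \<Longrightarrow> ty_eq U W"
| Arr: "ty_eq U U' \<Longrightarrow> ty_eq T T' \<Longrightarrow> T \<in> T_types \<Longrightarrow> T' \<in> T_types \<Longrightarrow> ty_eq (Arr U T) (Arr U' T')"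
| Inter: "ty_eq U U' \<Longrightarrow> ty_eq V V' \<Longrightarrow> tdegree U = tdegree V
    \<Longrightarrow> ty_eq (Inter U V) (Inter U' V')"
| Exp: "ty_eq U U' \<Longrightarrow> ty_eq (Exp i U) (Exp i U')"
| comm: "Inter U V \<in> U_types \<Longrightarrow> ty_eq (Inter U V) (Inter V U)"
| assoc: "Inter U (Inter V W) \<in> U_types \<Longrightarrow> ty_eq (Inter U (Inter V W)) (Inter (Inter U V) W)"
| idem: "U \<in> U_types \<Longrightarrow> ty_eq (Inter U U) U"
| Exp_Inter: "Inter U V \<in> U_types \<Longrightarrow> ty_eq (Exp i (Inter U V)) (Inter (Exp i U) (Exp i V))"
| Omega_Inter: "U \<in> U_types \<Longrightarrow> tdegree U = L \<Longrightarrow> ty_eq (Inter (Omega L) U) U"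
| Exp_Omega: "ty_eq (Exp i (Omega K)) (Omega (i # K))"

lemma Inter_in_U_types:
  "Inter U V \<in> U_types \<longleftrightarrow> U \<in> U_types \<and> V \<in> U_types \<and> tdegree U = tdegree V"
  by (auto intro: T_types_U_types.Inter elim: U_types.cases T_types.cases)

lemma ty_eq_wf: "ty_eq U V \<Longrightarrow> U \<in> U_types \<and> V \<in> U_types \<and> tdegree U = tdegree V"
  by (induction rule: ty_eq.induct) (auto simp: Inter_in_U_types intro: T_types_U_types.intros)

section \<open>Type environments\<close>

type_synonym env = "ivar \<Rightarrow> ty option"

definition is_env :: "env \<Rightarrow> bool" where
  "is_env \<Gamma> \<longleftrightarrow> finite (dom \<Gamma>) \<and> ran \<Gamma> \<subseteq> U_types"

definition env_omega :: "trm \<Rightarrow> env" where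
  "env_omega M = (\<lambda>(x, L). if (x, L) \<in> fv M then Some (Omega L) else None)"

definition env_inter :: "env \<Rightarrow> env \<Rightarrow> env" where
  "env_inter \<Gamma> \<Delta> = (\<lambda>v. case \<Gamma> v of
      None \<Rightarrow> \<Delta> v
    | Some U \<Rightarrow> (case \<Delta> v of None \<Rightarrow> Some U | Some V \<Rightarrow> Some (Inter U V)))"

definition env_exp :: "nat \<Rightarrow> env \<Rightarrow> env" where
  "env_exp j \<Gamma> = (\<lambda>(x, K). case K of
      [] \<Rightarrow> None
    | i # L \<Rightarrow> if i = j then map_option (Exp j) (\<Gamma> (x, L)) else None)"

definition env_joinable :: "env \<Rightarrow> env \<Rightarrow> bool" where
  "env_joinable \<Gamma> \<Delta> \<longleftrightarrow> joinable_sets (dom \<Gamma>) (dom \<Delta>)"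

section \<open>Subtyping\<close>

inductive sub :: "ty \<Rightarrow> ty \<Rightarrow> bool" where
  refl: "ty_eq U V \<Longrightarrow> sub U V"
| trans: "sub U V \<Longrightarrow> sub V W \<Longrightarrow> sub U W"
| Inter_left: "U1 \<in> U_types \<Longrightarrow> U2 \<in> U_types \<Longrightarrow> tdegree U1 = tdegree U2 \<Longrightarrow> sub (Inter U1 U2) U1"
| Inter: "sub U1 V1 \<Longrightarrow> sub U2 V2 \<Longrightarrow> Inter U1 U2 \<in> U_types \<Longrightarrow> Inter V1 V2 \<in> U_types
    \<Longrightarrow> sub (Inter U1 U2) (Inter V1 V2)"
| Arr: "sub U2 U1 \<Longrightarrow> sub T1 T2 \<Longrightarrow> T1 \<in> T_types \<Longrightarrow> T2 \<in> T_types
    \<Longrightarrow> sub (Arr U1 T1) (Arr U2 T2)"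
| Exp: "sub U V \<Longrightarrow> sub (Exp i U) (Exp i V)"

lemma sub_wf: "sub U V \<Longrightarrow> U \<in> U_types \<and> V \<in> U_types \<and> tdegree U = tdegree V"
  by (induction rule: sub.induct)
    (auto dest: ty_eq_wf simp: Inter_in_U_types intro: T_types_U_types.intros)

inductive env_sub :: "env \<Rightarrow> env \<Rightarrow> bool" where
  refl: "is_env \<Gamma> \<Longrightarrow> env_sub \<Gamma> \<Gamma>"
| trans: "env_sub \<Gamma> \<Gamma>' \<Longrightarrow> env_sub \<Gamma>' \<Gamma>'' \<Longrightarrow> env_sub \<Gamma> \<Gamma>''"
| decl: "is_env \<Gamma> \<Longrightarrow> (y, L) \<notin> dom \<Gamma> \<Longrightarrow> sub U1 U2
    \<Longrightarrow> env_sub (\<Gamma>((y, L) \<mapsto> U1)) (\<Gamma>((y, L) \<mapsto> U2))"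

inductive typing_sub :: "env \<Rightarrow> ty \<Rightarrow> env \<Rightarrow> ty \<Rightarrow> bool" where
  refl: "is_env \<Gamma> \<Longrightarrow> U \<in> U_types \<Longrightarrow> typing_sub \<Gamma> U \<Gamma> U"
| trans: "typing_sub \<Gamma> U \<Gamma>' U' \<Longrightarrow> typing_sub \<Gamma>' U' \<Gamma>'' U'' \<Longrightarrow> typing_sub \<Gamma> U \<Gamma>'' U''"
| mono: "sub U1 U2 \<Longrightarrow> env_sub \<Gamma>2 \<Gamma>1 \<Longrightarrow> typing_sub \<Gamma>1 U1 \<Gamma>2 U2"

section \<open>Typing\<close>

text \<open>The premises \<open>lam x L M \<in> terms\<close>, \<open>App M1 M2 \<in> terms\<close>, \<open>is_env (env_inter \<Gamma>1 \<Gamma>2)\<close> and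
  \<open>Inter U1 U2 \<in> U_types\<close> only say that the partial operations in the conclusions are defined.\<close>

inductive typing :: "trm \<Rightarrow> env \<Rightarrow> ty \<Rightarrow> bool" where
  ax: "T \<in> T_types \<Longrightarrow> typing (FVar x []) [(x, []) \<mapsto> T] T"
| omega: "M \<in> terms \<Longrightarrow> typing M (env_omega M) (Omega (degree M))"
| arrI: "typing M (\<Gamma>((x, L) \<mapsto> U)) T \<Longrightarrow> (x, L) \<notin> dom \<Gamma> \<Longrightarrow> T \<in> T_types \<Longrightarrow> lam x L M \<in> terms
    \<Longrightarrow> typing (lam x L M) \<Gamma> (Arr U T)"
| arrI': "typing M \<Gamma> T \<Longrightarrow> (x, L) \<notin> dom \<Gamma> \<Longrightarrow> T \<in> T_types \<Longrightarrow> lam x L M \<in> terms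
    \<Longrightarrow> typing (lam x L M) \<Gamma> (Arr (Omega L) T)"
| arrE: "typing M1 \<Gamma>1 (Arr U T) \<Longrightarrow> typing M2 \<Gamma>2 U \<Longrightarrow> env_joinable \<Gamma>1 \<Gamma>2
    \<Longrightarrow> App M1 M2 \<in> terms \<Longrightarrow> is_env (env_inter \<Gamma>1 \<Gamma>2)
    \<Longrightarrow> typing (App M1 M2) (env_inter \<Gamma>1 \<Gamma>2) T"
| interI: "typing M \<Gamma> U1 \<Longrightarrow> typing M \<Gamma> U2 \<Longrightarrow> Inter U1 U2 \<in> U_types
    \<Longrightarrow> typing M \<Gamma> (Inter U1 U2)"
| exp: "typing M \<Gamma> U \<Longrightarrow> typing (lift j M) (env_exp j \<Gamma>) (Exp j U)"
| sub: "typing M \<Gamma> U \<Longrightarrow> typing_sub \<Gamma> U \<Gamma>' U' \<Longrightarrow> typing M \<Gamma>' U'"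

section \<open>Realisability semantics\<close>

definition fun_space :: "trm set \<Rightarrow> trm set \<Rightarrow> trm set" where
  "fun_space X Y = {M \<in> terms. \<forall>N\<in>X. joinable M N \<longrightarrow> App M N \<in> Y}"

definition saturated :: "(trm \<Rightarrow> trm \<Rightarrow> bool) \<Rightarrow> trm set \<Rightarrow> bool" where
  "saturated r X \<longleftrightarrow> (\<forall>M\<in>terms. \<forall>N\<in>X. r\<^sup>*\<^sup>* M N \<longrightarrow> M \<in> X)"

definition neutral :: "var \<Rightarrow> index \<Rightarrow> trm set" where
  "neutral x L = {M \<in> terms. \<exists>Ns. M = apps (FVar x L) Ns}"

text \<open>The set \<open>V1\<close> is the first of the two parts into which the set of variables is split.\<close>

definition interpretation_of ::
    "(trm \<Rightarrow> trm \<Rightarrow> bool) \<Rightarrow> var set \<Rightarrow> (nat \<Rightarrow> trm set) \<Rightarrow> bool" where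
  "interpretation_of r V1 I \<longleftrightarrow>
     (\<forall>a. I a \<subseteq> terms_of [] \<and> saturated r (I a) \<and> (\<forall>x\<in>V1. neutral x [] \<subseteq> I a))"

primrec interp :: "(nat \<Rightarrow> trm set) \<Rightarrow> ty \<Rightarrow> trm set" where
  "interp I (Atom a) = I a"
| "interp I (Arr U T) = fun_space (interp I U) (interp I T)"
| "interp I (Omega L) = terms_of L"
| "interp I (Inter U V) = interp I U \<inter> interp I V"
| "interp I (Exp i U) = lift i ` interp I U"

definition realisers :: "(trm \<Rightarrow> trm \<Rightarrow> bool) \<Rightarrow> var set \<Rightarrow> ty \<Rightarrow> trm set" where
  "realisers r V1 U =
     {M \<in> terms. closed M \<and> (\<forall>I. interpretation_of r V1 I \<longrightarrow> M \<in> interp I U)}"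

end

(*
  A term M of degree K has the type T prefixed by the expansion variables in K exactly when T lies
  in the value of M in a filter model whose elements are upward closed sets of types in T_types:
  arrow types are never distributed over intersections, so a type is determined by its degree and
  the finite set of its T_types components. The value is invariant under beta conversion and
  grows along eta reduction, so no generation lemma for the typing rules is needed.

  Soundness is an induction on typings with simultaneous substitution, using closure under head
  expansion. For completeness, every type is assigned to infinitely many names in V2, and an atom
  is interpreted by the terms having it in their value (for beta), or reducing to such a term (for
  beta-eta). Then every type U is interpreted by the terms (reducing to terms) that have U: for an
  arrow U -> T one applies M to a fresh variable x of type U. In the beta-eta case M x reduces to
  some N having T, and lambda x. M x reduces both to M and to lambda x. N; these have a common
  reduct, which has U -> T. Common reducts also settle intersections and part (3). Confluence of
  beta-eta reduction is obtained from the diamond property of one parallel reduction combining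
  both rules, on raw terms, where beta contracts only redexes whose degrees match.
*)
theory Submission
  imports Defs "HOL-Library.Countable" "HOL-Library.Infinite_Set"
begin

text \<open>Well-formedness refers to degrees, and below a binder these depend on its index. Raw
  terms are therefore read under a valuation \<open>g\<close> of dangling indices by degrees, and
  joinability becomes one condition on the free names of the whole term, because bound variables can
  always be named afresh. The degree premise of beta makes the critical overlap harmless: in
  \<open>\<lambda>x. (\<lambda>y. D) x\<close> the inner redex may be contracted only if both
  binders carry the same index, and then the result is the eta contractum.

  The degree equations in \<open>sem\<close> come from the expansion prefix: if \<open>M\<close> has
  degree K and the type \<open>Arr U T\<close> prefixed by K, its argument needs \<open>U\<close>
  prefixed by K, whose degree is K followed by that of \<open>U\<close>. The prefix itself is not
  recorded, since every index in a term extends the degree of the term.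

  Beta-eta realisers are described through reducts because the value of an abstraction contains
  arrows only, so eta expansion loses the atoms in the value of a term. Soundness asks only head
  expansion of saturation, whence the common answer for beta and head.\<close>

section \<open>Parallel substitution\<close>

text \<open>Reduction under a binder is treated on raw terms with dangling de Bruijn indices, so a
  substitution acts on named variables and on dangling indices at once; named binding,
  instantiation and the substitution of \<open>Defs\<close> are all instances of it.\<close>

type_synonym atom = "ivar + nat"

fun atm :: "atom \<Rightarrow> trm" where
  "atm (Inl (x, L)) = FVar x L"
| "atm (Inr n) = BVar n"

fun shift_atom :: "atom \<Rightarrow> atom" where
  "shift_atom (Inl c) = Inl c"
| "shift_atom (Inr n) = Inr (Suc n)"

text \<open>The preimage under \<open>shift_atom\<close> drops index 0, which the abstraction binds,
  and lowers all other indices by one.\<close>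

primrec fa :: "trm \<Rightarrow> atom set" where
  "fa (FVar x L) = {Inl (x, L)}"
| "fa (BVar n) = {Inr n}"
| "fa (App M N) = fa M \<union> fa N"
| "fa (Abs L M) = shift_atom -` fa M"

primrec ren :: "(nat \<Rightarrow> nat) \<Rightarrow> trm \<Rightarrow> trm" where
  "ren f (FVar x L) = FVar x L"
| "ren f (BVar n) = BVar (f n)"
| "ren f (App M N) = App (ren f M) (ren f N)"
| "ren f (Abs L M) = Abs L (ren (case_nat 0 (Suc \<circ> f)) M)"

fun up_sub :: "(atom \<Rightarrow> trm) \<Rightarrow> atom \<Rightarrow> trm" where
  "up_sub s (Inl c) = ren Suc (s (Inl c))"
| "up_sub s (Inr 0) = BVar 0"
| "up_sub s (Inr (Suc n)) = ren Suc (s (Inr n))"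

primrec psub :: "(atom \<Rightarrow> trm) \<Rightarrow> trm \<Rightarrow> trm" where
  "psub s (FVar x L) = s (Inl (x, L))"
| "psub s (BVar n) = s (Inr n)"
| "psub s (App M N) = App (psub s M) (psub s N)"
| "psub s (Abs L M) = Abs L (psub (up_sub s) M)"

text \<open>The substitution of beta contraction: \<open>psub (inst N) B\<close> is the contractum
  of \<open>App (Abs L B) N\<close>.\<close>

fun inst :: "trm \<Rightarrow> atom \<Rightarrow> trm" where
  "inst N (Inl c) = atm (Inl c)"
| "inst N (Inr 0) = N"
| "inst N (Inr (Suc n)) = BVar n"

text \<open>Unlike \<^const>\<open>bind_var\<close>, this shifts dangling indices, so that it preserves their
  degrees; on locally closed terms the two agree.\<close>

fun bind_sub :: "ivar \<Rightarrow> atom \<Rightarrow> trm" where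
  "bind_sub v (Inl c) = (if c = v then BVar 0 else atm (Inl c))"
| "bind_sub v (Inr n) = BVar (Suc n)"

section \<open>Algebra of renaming and parallel substitution\<close>

lemma up_sub_shift_atom: "up_sub s (shift_atom v) = ren Suc (s v)"
  by (cases v) auto

lemma atom_cases:
  obtains "v = Inr 0" | w where "v = shift_atom w"
proof (cases v)
  case (Inl c)
  then show ?thesis using that(2)[of "Inl c"] by simp
next
  case (Inr n)
  then show ?thesis using that(1) that(2)[of "Inr (n - 1)"] by (cases n) auto
qed

lemma fv_fa: "fv M = Inl -` fa M"
  by (induction M) auto

lemma lc_at_fa: "lc_at k M \<longleftrightarrow> (\<forall>n. Inr n \<in> fa M \<longrightarrow> n < k)"
proof (induction M arbitrary: k)
  case (Abs L M)
  have "(\<forall>n. Inr n \<in> fa M \<longrightarrow> n < Suc k) \<longleftrightarrow> (\<forall>n. Inr (Suc n) \<in> fa M \<longrightarrow> n < k)"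
    by (metis Suc_less_eq less_Suc_eq_0_disj not0_implies_Suc)
  with Abs show ?case by auto
qed auto

lemma finite_fv [simp]: "finite (fv M)"
  by (induction M) auto

lemma psub_cong: "(\<And>v. v \<in> fa M \<Longrightarrow> s v = t v) \<Longrightarrow> psub s M = psub t M"
proof (induction M arbitrary: s t)
  case (Abs L M)
  have "up_sub s v = up_sub t v" if "v \<in> fa M" for v
    by (rule atom_cases[of v]) (use that Abs.prems in \<open>auto simp: up_sub_shift_atom\<close>)
  then have "psub (up_sub s) M = psub (up_sub t) M" by (rule Abs.IH)
  then show ?case by simp
next
  case (App M N)
  have "psub s M = psub t M" "psub s N = psub t N"
    using App.prems by (auto intro: App.IH)
  then show ?case by simp
qed simp_all

lemma up_sub_atm: "up_sub atm = atm"
proof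
  fix v show "up_sub atm v = atm v"
    \<comment> \<open>Here and below \<open>up_sub.cases\<close> serves as the three-way split of an
      atom into a name, index 0 and a successor index; \<open>inst.cases\<close> and
      \<open>push.cases\<close> are used in the same way.\<close>
    by (cases "(atm, v)" rule: up_sub.cases) (auto split: prod.splits)
qed

lemma psub_atm [simp]: "psub atm M = M"
  by (induction M) (auto simp: up_sub_atm)

lemma psub_id: "(\<And>v. v \<in> fa M \<Longrightarrow> s v = atm v) \<Longrightarrow> psub s M = M"
  using psub_cong[of M s atm] by simp

lemma ren_psub_atm: "ren f M = psub (case_sum (atm \<circ> Inl) (BVar \<circ> f)) M"
proof (induction M arbitrary: f)
  case (Abs L M)
  have "up_sub (case_sum (atm \<circ> Inl) (BVar \<circ> f)) v
      = case_sum (atm \<circ> Inl) (BVar \<circ> case_nat 0 (Suc \<circ> f)) v" for v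
    by (cases "(atm, v)" rule: up_sub.cases) auto
  with Abs show ?case by (auto intro: psub_cong)
qed auto

lemma ren_ren: "ren f (ren g M) = ren (f \<circ> g) M"
proof (induction M arbitrary: f g)
  case (Abs L M)
  have "case_nat 0 (Suc \<circ> f) \<circ> case_nat 0 (Suc \<circ> g) = case_nat 0 (Suc \<circ> (f \<circ> g))"
    by (auto simp: fun_eq_iff split: nat.splits)
  with Abs.IH show ?case by (simp only: ren.simps)
qed auto

lemma psub_ren: "psub s (ren f M) = psub (s \<circ> map_sum id f) M"
proof (induction M arbitrary: s f)
  case (Abs L M)
  have "up_sub s \<circ> map_sum id (case_nat 0 (Suc \<circ> f)) = up_sub (s \<circ> map_sum id f)"
  proof
    fix v show "(up_sub s \<circ> map_sum id (case_nat 0 (Suc \<circ> f))) v = up_sub (s \<circ> map_sum id f) v"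
      by (cases "(s, v)" rule: up_sub.cases) auto
  qed
  with Abs.IH show ?case by (simp only: psub.simps ren.simps)
qed auto

lemma ren_psub: "ren f (psub s M) = psub (ren f \<circ> s) M"
proof (induction M arbitrary: s f)
  case (Abs L M)
  have *: "case_nat 0 (Suc \<circ> f) \<circ> Suc = Suc \<circ> f"
    by auto
  have "ren (case_nat 0 (Suc \<circ> f)) \<circ> up_sub s = up_sub (ren f \<circ> s)"
  proof
    fix v show "(ren (case_nat 0 (Suc \<circ> f)) \<circ> up_sub s) v = up_sub (ren f \<circ> s) v"
      by (cases "(s, v)" rule: up_sub.cases) (auto simp: ren_ren *)
  qed
  with Abs.IH show ?case by (simp only: psub.simps ren.simps)
qed auto

lemma psub_psub: "psub s (psub t M) = psub (psub s \<circ> t) M"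
proof (induction M arbitrary: s t)
  case (Abs L M)
  have *: "up_sub s \<circ> map_sum id Suc = ren Suc \<circ> s"
  proof
    fix v show "(up_sub s \<circ> map_sum id Suc) v = (ren Suc \<circ> s) v"
      by (cases v) auto
  qed
  have "psub (up_sub s) \<circ> up_sub t = up_sub (psub s \<circ> t)"
  proof
    fix v show "(psub (up_sub s) \<circ> up_sub t) v = up_sub (psub s \<circ> t) v"
      by (cases "(s, v)" rule: up_sub.cases) (auto simp: psub_ren ren_psub *)
  qed
  with Abs.IH show ?case by (simp only: psub.simps)
qed auto

lemma fa_ren: "fa (ren f M) = map_sum id f ` fa M"
proof (induction M arbitrary: f)
  case (Abs L M)
  have *: "map_sum id (case_nat 0 (Suc \<circ> f)) (shift_atom w) = shift_atom (map_sum id f w)" for w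
    by (cases w) auto
  have u: "shift_atom v = shift_atom w \<longleftrightarrow> v = w" "shift_atom v \<noteq> Inr 0" "Inr 0 \<noteq> shift_atom v" for v w
    by (cases v; cases w; auto)+
  show ?case
  proof (intro set_eqI)
    fix v
    have "shift_atom v \<in> map_sum id (case_nat 0 (Suc \<circ> f)) ` fa M
        \<longleftrightarrow> v \<in> map_sum id f ` (shift_atom -` fa M)" (is "?l \<longleftrightarrow> ?r")
    proof
      assume ?l
      then obtain w where w: "w \<in> fa M" "shift_atom v = map_sum id (case_nat 0 (Suc \<circ> f)) w"
        by blast
      then show ?r
        by (cases w rule: atom_cases) (auto simp: * u)
    next
      assume ?r
      then show ?l by (auto simp: *[symmetric])
    qed
    then show "v \<in> fa (ren f (Abs L M)) \<longleftrightarrow> v \<in> map_sum id f ` fa (Abs L M)"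
      by (simp only: fa.simps ren.simps Abs.IH vimage_eq)
  qed
qed auto

lemma vimage_shift_atom: "shift_atom -` fa (ren Suc M) = fa M"
proof (intro set_eqI)
  fix v
  have "shift_atom v \<in> map_sum id Suc ` fa M \<longleftrightarrow> v \<in> fa M"
  proof -
    have "shift_atom w = map_sum id Suc w" for w by (cases w) auto
    moreover have "inj shift_atom"
    proof (rule injI)
      fix v w show "shift_atom v = shift_atom w \<Longrightarrow> v = w" by (cases v; cases w) auto
    qed
    ultimately show ?thesis by (metis (no_types, lifting) image_cong inj_image_mem_iff)
  qed
  then show "v \<in> shift_atom -` fa (ren Suc M) \<longleftrightarrow> v \<in> fa M"
    by (simp add: fa_ren)
qed

lemma Inr0_shift: "Inr 0 \<notin> fa (ren Suc M)"
proof -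
  have "map_sum id Suc w \<noteq> Inr 0" for w :: atom by (cases w) auto
  then show ?thesis unfolding fa_ren by (metis imageE)
qed

lemma fa_psub: "fa (psub s M) = (\<Union>v\<in>fa M. fa (s v))"
proof (induction M arbitrary: s)
  case (Abs L M)
  show ?case
  proof (intro set_eqI)
    fix v
    have u: "shift_atom v \<noteq> Inr 0" by (cases v) auto
    have "shift_atom v \<in> fa (up_sub s w) \<longleftrightarrow> (\<exists>w'. w = shift_atom w' \<and> v \<in> fa (s w'))" for w
    proof (cases w rule: atom_cases)
      case 1
      have "\<nexists>w'. Inr 0 = shift_atom w'" by (metis shift_atom.elims sum.distinct(1) sum.inject(2) nat.distinct(1))
      with 1 u show ?thesis by simp
    next
      case (2 w')
      have "shift_atom w1 = shift_atom w2 \<longleftrightarrow> w1 = w2" for w1 w2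
        by (cases w1; cases w2) auto
      with 2 show ?thesis using vimage_shift_atom[of "s w'"] by (auto simp: up_sub_shift_atom)
    qed
    then show "v \<in> fa (psub s (Abs L M)) \<longleftrightarrow> v \<in> (\<Union>v\<in>fa (Abs L M). fa (s v))"
      using Abs by auto
  qed
qed auto

lemma inst_shift [simp]: "psub (inst N) (ren Suc M) = M"
proof -
  have "(inst N \<circ> map_sum id Suc) v = atm v" for v by (cases v) auto
  then show ?thesis by (simp add: psub_ren psub_id)
qed

lemma shift_inst:
  assumes "Inr 0 \<notin> fa M" shows "ren Suc (psub (inst N) M) = M"
proof -
  have "(ren Suc \<circ> inst N) v = atm v" if "v \<in> fa M" for v
    using that assms by (cases "(N, v)" rule: inst.cases) auto
  then show ?thesis by (simp add: ren_psub psub_id)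
qed

lemma psub_inst: "psub s (psub (inst N) M) = psub (inst (psub s N)) (psub (up_sub s) M)"
proof -
  have "(psub s \<circ> inst N) v = (psub (inst (psub s N)) \<circ> up_sub s) v" for v
    by (cases "(N, v)" rule: inst.cases) auto
  then show ?thesis unfolding psub_psub by (auto intro: psub_cong)
qed

section \<open>Named binding, substitution and opening as parallel substitutions\<close>

lemma bind_var_psub_gen:
  "lc_at k M \<Longrightarrow> bind_var v k M =
    psub (case_sum (\<lambda>c. if c = v then BVar k else atm (Inl c)) BVar) M"
proof (induction M arbitrary: k)
  case (Abs L M)
  have "up_sub (case_sum (\<lambda>c. if c = v then BVar k else atm (Inl c)) BVar) w =
      case_sum (\<lambda>c. if c = v then BVar (Suc k) else atm (Inl c)) BVar w" for w
    by (cases "(atm, w)" rule: up_sub.cases) (auto split: prod.splits)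
  then show ?case using Abs by (auto intro: psub_cong)
qed auto

lemma bind_var_psub: "lc_at 0 M \<Longrightarrow> bind_var v 0 M = psub (bind_sub v) M"
  unfolding bind_var_psub_gen by (rule psub_cong) (auto simp: lc_at_fa split: sum.splits)

lemma shift_lc: "lc_at 0 M \<Longrightarrow> ren Suc M = M"
  unfolding ren_psub_atm by (rule psub_id) (auto simp: lc_at_fa split: sum.splits)

lemma subst_psub: "lc_at 0 N \<Longrightarrow> subst M x L N = psub (atm(Inl (x, L) := N)) M"
proof (induction M)
  case (Abs K M)
  have "up_sub (atm(Inl (x, L) := N)) = atm(Inl (x, L) := N)"
  proof
    fix v show "up_sub (atm(Inl (x, L) := N)) v = (atm(Inl (x, L) := N)) v"
      using Abs.prems by (cases "(atm, v)" rule: up_sub.cases) (auto simp: shift_lc)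
  qed
  with Abs.IH[OF Abs.prems] show ?case by (simp only: subst.simps psub.simps)
qed auto

lemma lam_psub: "lc_at 0 M \<Longrightarrow> lam x L M = Abs L (psub (bind_sub (x, L)) M)"
  by (simp add: lam_def bind_var_psub)

lemma inst_bind:
  assumes "lc_at 0 M"
  shows "psub (inst N) (psub (bind_sub (x, L)) M) = psub (atm(Inl (x, L) := N)) M"
  unfolding psub_psub
proof (rule psub_cong)
  fix v assume "v \<in> fa M"
  then obtain y K where "v = Inl (y, K)"
    using assms by (cases v) (auto simp: lc_at_fa)
  then show "(psub (inst N) \<circ> bind_sub (x, L)) v = (atm(Inl (x, L) := N)) v"
    by simp
qed

lemma bind_inst:
  assumes "Inl (x, L) \<notin> fa M"
  shows "psub (bind_sub (x, L)) (psub (inst (FVar x L)) M) = M"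
proof -
  have "(psub (bind_sub (x, L)) \<circ> inst (FVar x L)) v = atm v" if "v \<in> fa M" for v
    using that assms by (cases "(atm, v)" rule: up_sub.cases) auto
  then show ?thesis by (simp add: psub_psub psub_id)
qed

lemma lc_inst:
  assumes "lc_at 1 M" "lc_at 0 N" shows "lc_at 0 (psub (inst N) M)"
proof -
  have "Inr n \<notin> fa (inst N v)" if "v \<in> fa M" for n v
    using that assms by (cases "(N, v)" rule: inst.cases) (auto simp: lc_at_fa)
  then show ?thesis by (simp add: lc_at_fa fa_psub)
qed

text \<open>Lets a raw abstraction be read as a named one, so that the rules stated with
  \<open>lam\<close> apply to it.\<close>

lemma Abs_eq_lam:
  assumes "lc_at 0 (Abs L M)" "Inl (x, L) \<notin> fa M"
  shows "Abs L M = lam x L (psub (inst (FVar x L)) M)"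
proof -
  have "lc_at 0 (psub (inst (FVar x L)) M)"
    using assms(1) by (intro lc_inst) auto
  with assms(2) show ?thesis by (simp add: lam_psub bind_inst)
qed

lemma size_ren [simp]: "size (ren f M) = size M"
  by (induction M arbitrary: f) auto

lemma size_psub_var: "(\<And>v. v \<in> fa M \<Longrightarrow> size (s v) = 0) \<Longrightarrow> size (psub s M) = size M"
proof (induction M arbitrary: s)
  case (Abs L M)
  have "size (up_sub s v) = 0" if "v \<in> fa M" for v
    by (rule atom_cases[of v]) (use that Abs.prems in \<open>auto simp: up_sub_shift_atom\<close>)
  with Abs.IH show ?case by auto
qed auto

section \<open>Degrees and well-formedness of terms with dangling indices\<close>

text \<open>This is \<open>degree_in\<close> with a total valuation in place of the list of binder
  indexes, so that renaming acts on it by composition.\<close>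

primrec deg :: "(nat \<Rightarrow> index) \<Rightarrow> trm \<Rightarrow> index" where
  "deg g (FVar x L) = L"
| "deg g (BVar n) = g n"
| "deg g (App M N) = deg g M"
| "deg g (Abs L M) = deg (case_nat L g) M"

text \<open>Collects the degree conditions in the rules of \<open>terms\<close>; joinability is left
  to \<open>wf_trm\<close>.\<close>

primrec ok :: "(nat \<Rightarrow> index) \<Rightarrow> trm \<Rightarrow> bool" where
  "ok g (FVar x L) \<longleftrightarrow> True"
| "ok g (BVar n) \<longleftrightarrow> True"
| "ok g (App M N) \<longleftrightarrow> ok g M \<and> ok g N \<and> prefix (deg g M) (deg g N)"
| "ok g (Abs L M) \<longleftrightarrow> ok (case_nat L g) M \<and> prefix (deg (case_nat L g) M) L"

lemma degree_in_deg: "degree_in Ls M = deg ((!) Ls) M"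
proof (induction M arbitrary: Ls)
  case (Abs L M)
  have "(!) (L # Ls) = case_nat L ((!) Ls)"
    by (auto simp: nth_Cons fun_eq_iff)
  with Abs show ?case by simp
qed auto

lemma deg_ren: "deg g (ren f M) = deg (g \<circ> f) M"
proof (induction M arbitrary: f g)
  case (Abs L M)
  have "case_nat L g \<circ> case_nat 0 (Suc \<circ> f) = case_nat L (g \<circ> f)"
    by (auto simp: fun_eq_iff split: nat.splits)
  with Abs.IH show ?case by (simp only: ren.simps deg.simps)
qed auto

lemma deg_shift [simp]: "deg (case_nat L g) (ren Suc M) = deg g M"
proof -
  have "case_nat L g \<circ> Suc = g" by auto
  then show ?thesis by (simp add: deg_ren)
qed

lemma ok_ren: "ok g (ren f M) = ok (g \<circ> f) M"
proof (induction M arbitrary: f g)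
  case (Abs L M)
  have "case_nat L g \<circ> case_nat 0 (Suc \<circ> f) = case_nat L (g \<circ> f)"
    by (auto simp: fun_eq_iff split: nat.splits)
  with Abs.IH show ?case by (simp only: ren.simps ok.simps deg_ren)
qed (auto simp: deg_ren)

lemma ok_shift [simp]: "ok (case_nat L g) (ren Suc M) = ok g M"
proof -
  have "case_nat L g \<circ> Suc = g" by auto
  then show ?thesis by (simp add: ok_ren)
qed

lemma deg_up_sub:
  assumes "\<And>v. v \<in> fa (Abs L M) \<Longrightarrow> deg g' (s v) = deg g (atm v)" "v \<in> fa M"
  shows "deg (case_nat L g') (up_sub s v) = deg (case_nat L g) (atm v)"
proof (cases v rule: atom_cases)
  case (2 w)
  have "deg (case_nat L g) (atm (shift_atom w)) = deg g (atm w)" by (cases w) auto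
  with 2 show ?thesis using assms by (simp add: up_sub_shift_atom)
qed auto

lemma deg_psub: "(\<And>v. v \<in> fa M \<Longrightarrow> deg g' (s v) = deg g (atm v)) \<Longrightarrow> deg g' (psub s M) = deg g M"
proof (induction M arbitrary: s g g')
  case (Abs L M)
  have "deg (case_nat L g') (psub (up_sub s) M) = deg (case_nat L g) M"
    using deg_up_sub[of L M g' s g] Abs.prems by (intro Abs.IH) auto
  then show ?case by simp
qed auto

lemma ok_psub:
  "(\<And>v. v \<in> fa M \<Longrightarrow> deg g' (s v) = deg g (atm v)) \<Longrightarrow> (\<And>v. v \<in> fa M \<Longrightarrow> ok g' (s v))
    \<Longrightarrow> ok g M \<Longrightarrow> ok g' (psub s M)"
proof (induction M arbitrary: s g g')
  case (App M N)
  then show ?case by (auto simp: deg_psub[of _ g' s g])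
next
  case (Abs L M)
  have d: "deg (case_nat L g') (up_sub s v) = deg (case_nat L g) (atm v)" if "v \<in> fa M" for v
    using deg_up_sub[of L M g' s g] Abs.prems that by auto
  have o: "ok (case_nat L g') (up_sub s v)" if "v \<in> fa M" for v
    by (rule atom_cases[of v]) (use that Abs.prems in \<open>auto simp: up_sub_shift_atom\<close>)
  show ?case using Abs.IH[OF d o] Abs.prems(3) deg_psub[of M _ "up_sub s", OF d] by auto
qed auto

lemma deg_cong: "(\<And>n. Inr n \<in> fa M \<Longrightarrow> g n = g' n) \<Longrightarrow> deg g M = deg g' M"
  using deg_psub[of M g atm g'] by (metis atm.simps deg.simps psub_atm surj_pair sum.exhaust)

text \<open>The valuation to which \<open>degree_in []\<close> amounts. Its values are unspecified,
  which is harmless because a locally closed term has no dangling index to look up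
  (\<open>deg_lc\<close>).\<close>

abbreviation g0 :: "nat \<Rightarrow> index" where "g0 \<equiv> (!) []"

lemma degree_deg: "degree M = deg g0 M"
  by (simp add: degree_def degree_in_deg)

lemma deg_lc: "lc_at 0 M \<Longrightarrow> deg g M = degree M"
  unfolding degree_deg by (rule deg_cong) (simp add: lc_at_fa)

lemma deg_inst:
  assumes "deg g N = L" shows "deg g (psub (inst N) M) = deg (case_nat L g) M"
  using assms by (intro deg_psub) (case_tac v; case_tac "projr v"; auto)

lemma ok_inst:
  assumes "deg g N = L" "ok g N" "ok (case_nat L g) M" shows "ok g (psub (inst N) M)"
proof (rule ok_psub)
  fix v
  show "deg g (inst N v) = deg (case_nat L g) (atm v)"
    by (cases "(N, v)" rule: inst.cases) (auto simp: assms)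
  show "ok g (inst N v)"
    by (cases "(N, v)" rule: inst.cases) (auto simp: assms)
qed fact

lemma deg_bind: "deg (case_nat L g) (bind_sub (x, L) v) = deg g (atm v)"
  by (cases v) auto

lemma ok_bind: "ok g (bind_sub (x, L) v)"
  by (cases v) auto

section \<open>Well-formed raw terms are the elements of \<open>terms\<close>\<close>

definition self_joinable :: "ivar set \<Rightarrow> bool" where
  "self_joinable A \<longleftrightarrow> joinable_sets A A"

lemma self_joinable_Un:
  "self_joinable (A \<union> B) \<longleftrightarrow> self_joinable A \<and> self_joinable B \<and> joinable_sets A B"
  unfolding self_joinable_def joinable_sets_def by blast

lemma self_joinable_mono: "A \<subseteq> B \<Longrightarrow> self_joinable B \<Longrightarrow> self_joinable A"
  unfolding self_joinable_def joinable_sets_def by blast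

lemma joinable_sets_mono: "joinable_sets A B \<Longrightarrow> A' \<subseteq> A \<Longrightarrow> B' \<subseteq> B \<Longrightarrow> joinable_sets A' B'"
  unfolding joinable_sets_def by blast

lemma joinable_mono: "joinable M N \<Longrightarrow> fv M' \<subseteq> fv M \<Longrightarrow> fv N' \<subseteq> fv N \<Longrightarrow> joinable M' N'"
  unfolding joinable_def by (rule joinable_sets_mono)

lemma joinable_sym: "joinable M N \<Longrightarrow> joinable N M"
  unfolding joinable_def joinable_sets_def by metis

text \<open>One global condition replaces joinability at every application: bound variables can be
  given names apart from all others, so only free names can clash.\<close>

definition wf_trm :: "trm \<Rightarrow> bool" where
  "wf_trm M \<longleftrightarrow> lc_at 0 M \<and> ok g0 M \<and> self_joinable (fv M)"

lemma fresh_name: assumes "finite A" "infinite V" obtains x where "x \<in> V" "\<And>L. (x, L) \<notin> A"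
proof -
  have "infinite (V - fst ` A)" using assms by (simp add: Diff_infinite_finite)
  then obtain x where "x \<in> V" "x \<notin> fst ` A" by (metis Diff_iff finite.emptyI ex_in_conv)
  then show ?thesis using that by force
qed

text \<open>Excluding the name \<open>x\<close> at every index, not just at \<open>L\<close>, keeps
  the free names of the opened body self-joinable.\<close>

lemma wf_Abs_body:
  assumes "wf_trm (Abs L M)" "\<And>K. (x, K) \<notin> fv M"
  shows "wf_trm (psub (inst (FVar x L)) M)"
proof -
  have "fv (psub (inst (FVar x L)) M) \<subseteq> insert (x, L) (fv M)"
  proof
    fix c assume "c \<in> fv (psub (inst (FVar x L)) M)"
    then obtain v where "v \<in> fa M" "Inl c \<in> fa (inst (FVar x L) v)"
      by (auto simp: fv_fa fa_psub)
    then show "c \<in> insert (x, L) (fv M)"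
      by (cases "(atm, v)" rule: up_sub.cases) (auto simp: fv_fa split: prod.splits)
  qed
  moreover have "self_joinable (insert (x, L) (fv M))"
    using assms unfolding wf_trm_def self_joinable_def joinable_sets_def by auto
  ultimately have "self_joinable (fv (psub (inst (FVar x L)) M))"
    by (rule self_joinable_mono)
  then show ?thesis using assms(1) unfolding wf_trm_def
    by (auto intro: lc_inst ok_inst)
qed

lemma wf_AbsE:
  assumes "wf_trm (Abs L B)" "finite F"
  obtains x P where "Abs L B = lam x L P" "P = psub (inst (FVar x L)) B" "wf_trm P" "size P = size B"
    "prefix (degree P) L" "x \<notin> F" "\<And>K. (x, K) \<notin> fv B"
proof -
  obtain x where x: "x \<notin> F" "\<And>K. (x, K) \<notin> fv B"
    using fresh_name[of "fv B" "- F"] assms(2) by auto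
  let ?P = "psub (inst (FVar x L)) B"
  have "size ?P = size B"
  proof (rule size_psub_var)
    fix v show "size (inst (FVar x L) v) = 0"
      by (cases "(atm, v)" rule: up_sub.cases) auto
  qed
  moreover have "prefix (degree ?P) L"
    using assms by (auto simp: wf_trm_def degree_deg deg_inst)
  moreover have "Abs L B = lam x L ?P"
    using assms x by (intro Abs_eq_lam) (auto simp: wf_trm_def fv_fa)
  ultimately show ?thesis using that wf_Abs_body[OF assms(1) x(2)] x by blast
qed

text \<open>By induction on size: the opened body of an abstraction is not a subterm of it, but has
  the size of the body.\<close>

lemma wf_terms: "wf_trm M \<Longrightarrow> M \<in> terms"
proof (induction M rule: measure_induct_rule[of size])
  case (less M)
  show ?case
  proof (cases M)
    case (FVar x L)
    then show ?thesis by (simp add: terms.FVar)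
  next
    case (BVar n)
    then show ?thesis using less.prems by (simp add: wf_trm_def)
  next
    case (App P Q)
    then have "wf_trm P" "wf_trm Q" "joinable P Q"
      using less.prems by (auto simp: wf_trm_def self_joinable_Un joinable_def)
    moreover have "prefix (degree P) (degree Q)"
      using App less.prems by (auto simp: wf_trm_def degree_deg)
    ultimately show ?thesis using App less.IH by (auto intro: terms.App)
  next
    case (Abs L B)
    then obtain x P where P: "Abs L B = lam x L P" "wf_trm P" "size P = size B" "prefix (degree P) L"
      using wf_AbsE[of L B "{}"] less.prems by (metis finite.emptyI)
    have "size P < size M" using P(3) by (simp add: Abs)
    then have "P \<in> terms" using P(2) by (rule less.IH)
    with P Abs show ?thesis by (metis terms.lam)
  qed
qed

lemma terms_wf: "M \<in> terms \<Longrightarrow> wf_trm M"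
proof (induction rule: terms.induct)
  case (lam M L x)
  then have "ok (case_nat L g0) (psub (bind_sub (x, L)) M)"
    by (intro ok_psub[where g = g0]) (auto simp: deg_bind ok_bind wf_trm_def)
  moreover have "deg (case_nat L g0) (psub (bind_sub (x, L)) M) = degree M"
    unfolding degree_deg by (rule deg_psub) (simp add: deg_bind)
  ultimately show ?case
    using lam terms_lc[OF terms.lam[OF lam.hyps]] self_joinable_mono[of "fv M - {(x, L)}" "fv M"]
    by (simp add: wf_trm_def fv_lam) (simp add: lam_psub)
qed (auto simp: wf_trm_def self_joinable_Un joinable_def degree_deg self_joinable_def
      joinable_sets_def)

lemma terms_iff: "M \<in> terms \<longleftrightarrow> wf_trm M"
  using wf_terms terms_wf by blast

lemma App_terms_iff:
  "App M N \<in> terms \<longleftrightarrow> M \<in> terms \<and> N \<in> terms \<and> prefix (degree M) (degree N) \<and> joinable M N"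
  unfolding terms_iff by (auto simp: wf_trm_def self_joinable_Un joinable_def degree_deg)

text \<open>As \<open>lam\<close> is not a free constructor, rule inversion would return some other
  name and body; the degree condition is read off the raw abstraction instead.\<close>

lemma lam_terms_iff: "M \<in> terms \<Longrightarrow> lam x L M \<in> terms \<longleftrightarrow> prefix (degree M) L"
proof
  assume "M \<in> terms" "lam x L M \<in> terms"
  then show "prefix (degree M) L"
    using deg_psub[of M "case_nat L g0" "bind_sub (x, L)" g0]
    by (simp add: terms_iff wf_trm_def lam_psub degree_deg deg_bind)
qed (rule terms.lam)

lemma terms_AbsE:
  assumes "Abs L B \<in> terms" "finite F"
  obtains x P where "Abs L B = lam x L P" "P = psub (inst (FVar x L)) B" "P \<in> terms"
    "size P = size B" "prefix (degree P) L" "x \<notin> F" "\<And>K. (x, K) \<notin> fv B"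
  using assms wf_AbsE unfolding terms_iff by metis

section \<open>Confluence of beta-eta reduction\<close>

text \<open>The shifted \<open>M\<close> in the eta rule expresses that the bound variable does not
  occur in it. Of the conditions on terms only the degree premise of the beta rule is kept, so
  reduction of raw bodies needs no naming.\<close>

inductive par :: "(nat \<Rightarrow> index) \<Rightarrow> trm \<Rightarrow> trm \<Rightarrow> bool" where
  FVar: "par g (FVar x L) (FVar x L)"
| BVar: "par g (BVar n) (BVar n)"
| App: "par g M M' \<Longrightarrow> par g N N' \<Longrightarrow> par g (App M N) (App M' N')"
| Abs: "par (case_nat L g) M M' \<Longrightarrow> par g (Abs L M) (Abs L M')"
| beta: "par (case_nat L g) M M' \<Longrightarrow> par g N N' \<Longrightarrow> deg g N = L
    \<Longrightarrow> par g (App (Abs L M) N) (psub (inst N') M')"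
| eta: "par g M M' \<Longrightarrow> par g (Abs L (App (ren Suc M) (BVar 0))) M'"

inductive_cases par_BVarE [consumes 1]: "par g (BVar n) N"
inductive_cases par_FVarE [consumes 1]: "par g (FVar x L) N"
inductive_cases par_AppE [consumes 1]: "par g (App P Q) N"
inductive_cases par_AbsE [consumes 1]: "par g (Abs L M) N"

lemma par_refl: "par g M M"
  by (induction M arbitrary: g) (auto intro: par.intros)

lemma par_deg: "par g M M' \<Longrightarrow> deg g M' = deg g M"
  by (induction rule: par.induct) (auto simp: deg_inst)

lemma fa_inst: "fa (psub (inst N) M) \<subseteq> shift_atom -` fa M \<union> fa N"
proof
  fix v assume "v \<in> fa (psub (inst N) M)"
  then obtain w where "w \<in> fa M" "v \<in> fa (inst N w)" by (auto simp: fa_psub)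
  then show "v \<in> shift_atom -` fa M \<union> fa N"
    by (cases "(N, w)" rule: inst.cases) auto
qed

lemma par_fa: "par g M M' \<Longrightarrow> fa M' \<subseteq> fa M"
proof (induction rule: par.induct)
  case (beta L g M M' N N')
  then show ?case using fa_inst[of N' M'] by auto
next
  case (eta g M M' L)
  then show ?case using vimage_shift_atom[of M] by auto
qed auto

lemma ren_inst: "ren f (psub (inst N) M) = psub (inst (ren f N)) (ren (case_nat 0 (Suc \<circ> f)) M)"
  unfolding ren_psub psub_ren
proof (rule psub_cong)
  fix v show "(ren f \<circ> inst N) v = (inst (ren f N) \<circ> map_sum id (case_nat 0 (Suc \<circ> f))) v"
    by (cases "(N, v)" rule: inst.cases) auto
qed

lemma ren_shift: "ren (case_nat 0 (Suc \<circ> f)) (ren Suc M) = ren Suc (ren f M)"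
proof -
  have "case_nat 0 (Suc \<circ> f) \<circ> Suc = Suc \<circ> f" by auto
  then show ?thesis by (simp only: ren_ren)
qed

lemma par_ren: "par g M M' \<Longrightarrow> (\<And>n. g' (f n) = g n) \<Longrightarrow> par g' (ren f M) (ren f M')"
proof (induction arbitrary: f g' rule: par.induct)
  case (Abs L g M M')
  have "par (case_nat L g') (ren (case_nat 0 (Suc \<circ> f)) M) (ren (case_nat 0 (Suc \<circ> f)) M')"
    by (rule Abs.IH) (auto simp: Abs.prems split: nat.splits)
  then show ?case by (auto intro: par.Abs)
next
  case (beta L g M M' N N')
  have "par (case_nat L g') (ren (case_nat 0 (Suc \<circ> f)) M) (ren (case_nat 0 (Suc \<circ> f)) M')"
    by (rule beta.IH) (auto simp: beta.prems split: nat.splits)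
  moreover have "g' \<circ> f = g" using beta.prems by auto
  then have "deg g' (ren f N) = L" using beta.hyps by (simp add: deg_ren)
  ultimately show ?case
    using beta.IH(2)[of g' f] beta.prems by (auto simp: ren_inst intro: par.beta)
next
  case (eta g M M' L)
  then show ?case by (auto simp: ren_shift intro: par.eta)
qed (auto intro: par.intros)

lemma par_shift: "par g M M' \<Longrightarrow> par (case_nat L g) (ren Suc M) (ren Suc M')"
  by (rule par_ren) auto

lemma up_sub_shift: "psub (up_sub s) (ren Suc M) = ren Suc (psub s M)"
  unfolding psub_ren ren_psub
proof (rule psub_cong)
  fix v show "(up_sub s \<circ> map_sum id Suc) v = (ren Suc \<circ> s) v"
    by (cases v) auto
qed

lemma deg_up_sub_all:
  assumes "\<And>v. deg g' (s v) = deg g (atm v)"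
  shows "deg (case_nat L g') (up_sub s v) = deg (case_nat L g) (atm v)"
proof (cases v rule: atom_cases)
  case (2 w)
  have "deg (case_nat L g) (atm (shift_atom w)) = deg g (atm w)" by (cases w) auto
  with 2 show ?thesis using assms by (simp add: up_sub_shift_atom)
qed auto

lemma par_psub:
  "par g M M' \<Longrightarrow> (\<And>v. deg g' (s v) = deg g (atm v)) \<Longrightarrow> (\<And>v. par g' (s v) (s' v))
    \<Longrightarrow> par g' (psub s M) (psub s' M')"
proof (induction arbitrary: s s' g' rule: par.induct)
  case (FVar g x L)
  then show ?case by simp
next
  case (BVar g n)
  then show ?case by simp
next
  case (App g M M' N N')
  have "par g' (psub s M) (psub s' M')" "par g' (psub s N) (psub s' N')"
    using App.prems by (auto intro: App.IH)
  then show ?case by (simp add: par.App)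
next
  case (Abs L g M M')
  have "par (case_nat L g') (up_sub s v) (up_sub s' v)" for v
    by (cases v rule: atom_cases) (auto simp: up_sub_shift_atom intro: par.BVar par_shift Abs.prems)
  then have "par (case_nat L g') (psub (up_sub s) M) (psub (up_sub s') M')"
    by (intro Abs.IH deg_up_sub_all Abs.prems)
  then show ?case by (simp add: par.Abs)
next
  case (beta L g M M' N N')
  have "par (case_nat L g') (up_sub s v) (up_sub s' v)" for v
    by (cases v rule: atom_cases) (auto simp: up_sub_shift_atom intro: par.BVar par_shift beta.prems)
  then have "par (case_nat L g') (psub (up_sub s) M) (psub (up_sub s') M')"
    by (intro beta.IH deg_up_sub_all beta.prems)
  moreover have "par g' (psub s N) (psub s' N')"
    by (intro beta.IH beta.prems)
  moreover have "deg g' (psub s N) = L"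
    using deg_psub[of N g' s g] beta.prems beta.hyps by simp
  ultimately show ?case by (simp add: psub_inst par.beta)
next
  case (eta g M M' L)
  have "par g' (psub s M) (psub s' M')"
    by (intro eta.IH eta.prems)
  then show ?case by (simp add: up_sub_shift par.eta)
qed

lemma par_inst:
  assumes "par (case_nat L g) M M'" "par g N N'" "deg g N = L"
  shows "par g (psub (inst N) M) (psub (inst N') M')"
proof (rule par_psub[OF assms(1)])
  fix v
  show "deg g (inst N v) = deg (case_nat L g) (atm v)"
    by (cases "(N, v)" rule: inst.cases) (auto simp: assms)
  show "par g (inst N v) (inst N' v)"
    by (cases "(N, v)" rule: inst.cases) (auto intro: par_refl assms(2))
qed

lemma par_shiftE:
  assumes "par (case_nat L g) (ren Suc M) Q"
  obtains M' where "Q = ren Suc M'" "par g M M'"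
proof
  \<comment> \<open>Index 0 does not occur in \<open>Q\<close>, so any term may be put there; a
    variable of index \<open>L\<close> meets the degree premise of \<open>par_inst\<close>.\<close>
  let ?M' = "psub (inst (FVar 0 L)) Q"
  have "Inr 0 \<notin> fa Q"
    using par_fa[OF assms] Inr0_shift[of M] by blast
  then show "Q = ren Suc ?M'"
    by (simp add: shift_inst)
  show "par g M ?M'"
    using par_inst[OF assms par_refl, of "FVar 0 L"] by simp
qed

text \<open>A beta step at the root has the argument \<open>BVar 0\<close>, of degree
  \<open>L\<close>; hence \<open>R\<close> is an abstraction with the same index \<open>L\<close>.
  Instantiating its shifted body with \<open>BVar 0\<close> undoes the shift, so the contractum is a
  reduct of the original body \<open>D\<close>.\<close>

lemma par_eta_bodyE:
  assumes "par (case_nat L g) (App (ren Suc R) (BVar 0)) B"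
  obtains (App) R' where "B = App (ren Suc R') (BVar 0)" "par g R R'"
  | (beta) D where "R = Abs L D" "par (case_nat L g) D B"
  using assms
proof (cases rule: par_AppE)
  case (1 M' N')
  then show ?thesis using App by (metis par_BVarE par_shiftE)
next
  case (2 C C' N')
  then have N': "N' = BVar 0" by (auto elim: par_BVarE)
  from 2 obtain D where R: "R = Abs L D" and C: "C = ren (case_nat 0 (Suc \<circ> Suc)) D"
by (cases R) auto
  have "psub (inst (BVar 0)) C = D"
    unfolding C psub_ren
  proof (rule psub_id)
    fix v show "(inst (BVar 0) \<circ> map_sum id (case_nat 0 (Suc \<circ> Suc))) v = atm v"
      by (cases "(atm, v)" rule: up_sub.cases) auto
  qed
  moreover have "par (case_nat L g) (psub (inst (BVar 0)) C) (psub (inst (BVar 0)) C')"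
    using 2 by (intro par_inst) (auto intro: par.BVar)
  ultimately show ?thesis using beta R 2 N' by simp
qed

lemma shift_inject [simp]: "ren Suc M = ren Suc N \<longleftrightarrow> M = N"
  by (metis inst_shift)

text \<open>Where beta and eta overlap, both reducts are reducts of one term that is smaller than
  \<open>M\<close> but need not be a subterm of it. This is why the induction is on size.\<close>

lemma par_diamond: "par g M N1 \<Longrightarrow> par g M N2 \<Longrightarrow> \<exists>P. par g N1 P \<and> par g N2 P"
proof (induction M arbitrary: g N1 N2 rule: measure_induct_rule[of size])
  case (less M)
  have app_beta: "\<exists>Z. par g (App P1 Q1) Z \<and> par g (psub (inst Q2) B2) Z"
    if M: "M = App (Abs L B) Q" and L: "deg g Q = L" and P1: "par g (Abs L B) P1"
      and Q1: "par g Q Q1" and B2: "par (case_nat L g) B B2" and Q2: "par g Q Q2"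
    for L B Q P1 Q1 B2 Q2
  proof -
    obtain Q3 where Q3: "par g Q1 Q3" "par g Q2 Q3"
      using less.IH[OF _ Q1 Q2] M by auto
    from P1 show ?thesis
    proof (cases rule: par_AbsE)
      case (1 B1)
      obtain B3 where "par (case_nat L g) B1 B3" "par (case_nat L g) B2 B3"
        using less.IH[OF _ 1(2) B2] M by auto
      with Q3 1 show ?thesis
        using par_deg[OF Q1] par_deg[OF Q2] L
        by (intro exI[of _ "psub (inst Q3) B3"]) (auto intro: par.beta par_inst)
    next
      case (2 R)
      from B2[unfolded 2] show ?thesis
      proof (cases rule: par_eta_bodyE)
        case (App R2)
        obtain R3 where "par g P1 R3" "par g R2 R3"
          using less.IH[OF _ 2(2) App(2)] M 2 by auto
        with App Q3 show ?thesis by (auto intro: par.App)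
      next
        case (beta D)
        \<comment> \<open>Contracting the eta redex in function position or the beta redex at the
          root leads to reducts of the same term \<open>App R Q\<close>, which is smaller than
          \<open>M\<close>.\<close>
        have "par g (App R Q) (App P1 Q1)" "par g (App R Q) (psub (inst Q2) B2)"
          using 2 Q1 Q2 beta L by (auto intro: par.App par.beta)
        then show ?thesis using less.IH[of "App R Q"] M 2 by auto
      qed
    qed
  qed
  have abs_eta: "\<exists>Z. par g (Abs L B) Z \<and> par g R2 Z"
    if M: "M = Abs L (App (ren Suc R) (BVar 0))" and R2: "par g R R2"
      and B: "par (case_nat L g) (App (ren Suc R) (BVar 0)) B" for L R R2 B
    using B
  proof (cases rule: par_eta_bodyE)
    case (App R1)
    obtain R3 where "par g R1 R3" "par g R2 R3"
      using less.IH[OF _ App(2) R2] M by auto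
    with App show ?thesis by (auto intro: par.eta)
  next
    case (beta D)
    \<comment> \<open>Contracting the beta redex inside the eta redex also amounts to reducing
      \<open>R\<close>, so the two results are reducts of \<open>R\<close>.\<close>
    then have "par g R (Abs L B)" by (auto intro: par.Abs)
    then show ?thesis using less.IH[OF _ _ R2] M by auto
  qed
  show ?case
  proof (cases M)
    case (FVar x L)
    then show ?thesis using less.prems by (auto elim!: par_FVarE intro: par_refl)
  next
    case (BVar n)
    then show ?thesis using less.prems by (auto elim!: par_BVarE intro: par_refl)
  next
    case (App P Q)
    from less.prems(1)[unfolded App] show ?thesis
    proof (cases rule: par_AppE)
      case (1 P1 Q1)
      note c1 = this
      from less.prems(2)[unfolded App] show ?thesis
      proof (cases rule: par_AppE)
        case (1 P2 Q2)
        obtain P3 Q3 where "par g P1 P3" "par g P2 P3" "par g Q1 Q3" "par g Q2 Q3"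
          using less.IH[OF _ c1(2) 1(2)] less.IH[OF _ c1(3) 1(3)] App by auto
        with c1 1 show ?thesis by (auto intro: par.App)
      next
        case (2 B B2 Q2)
        then show ?thesis using app_beta[of "deg g Q" B Q P1 Q1 B2 Q2] c1 App by auto
      qed
    next
      case (2 B B1 Q1)
      note c1 = this
      let ?L = "deg g Q"
      from less.prems(2)[unfolded App] show ?thesis
      proof (cases rule: par_AppE)
        case (1 P2 Q2)
        then show ?thesis using app_beta[of ?L B Q P2 Q2 B1 Q1] c1 App by auto
      next
        case (2 B' B2 Q2)
        then have *: "par (case_nat ?L g) B B2" using c1 by auto
        obtain B3 Q3 where "par (case_nat ?L g) B1 B3" "par (case_nat ?L g) B2 B3"
            "par g Q1 Q3" "par g Q2 Q3"
          using less.IH[OF _ c1(3) *] less.IH[OF _ c1(4) 2(4)] App c1 by auto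
        with c1 2 show ?thesis
          using par_deg[OF c1(4)] par_deg[OF 2(4)]
          by (intro exI[of _ "psub (inst Q3) B3"]) (auto intro: par_inst)
      qed
    qed
  next
    case (Abs L B)
    from less.prems(1)[unfolded Abs] show ?thesis
    proof (cases rule: par_AbsE)
      case (1 B1)
      note c1 = this
      from less.prems(2)[unfolded Abs] show ?thesis
      proof (cases rule: par_AbsE)
        case (1 B2)
        obtain B3 where "par (case_nat L g) B1 B3" "par (case_nat L g) B2 B3"
          using less.IH[OF _ c1(2) 1(2)] Abs by auto
        with c1 1 show ?thesis by (auto intro: par.Abs)
      next
        case (2 R)
        then show ?thesis using abs_eta[of L R N2 B1] c1 Abs by auto
      qed
    next
      case (2 R)
      note c1 = this
      from less.prems(2)[unfolded Abs] show ?thesis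
      proof (cases rule: par_AbsE)
        case (1 B2)
        then show ?thesis using abs_eta[of L R N1 B2] c1 Abs by auto
      next
        case (2 R')
        then have "par g R N2" using c1 by simp
        then show ?thesis using less.IH[OF _ c1(2)] c1 Abs by auto
      qed
    qed
  qed
qed

lemma par_confluent:
  assumes "(par g)\<^sup>*\<^sup>* M N1" "(par g)\<^sup>*\<^sup>* M N2"
  shows "\<exists>P. (par g)\<^sup>*\<^sup>* N1 P \<and> (par g)\<^sup>*\<^sup>* N2 P"
proof -
  have strip: "\<exists>P. (par g)\<^sup>*\<^sup>* N1 P \<and> par g N2 P" if "(par g)\<^sup>*\<^sup>* M N2" "par g M N1" for M N1 N2
    using that
  proof (induction arbitrary: N1 rule: converse_rtranclp_induct)
    case (step M M')
    then show ?case by (metis converse_rtranclp_into_rtranclp par_diamond)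
  qed blast
  show ?thesis using assms
  proof (induction arbitrary: N2 rule: converse_rtranclp_induct)
    case (step M M')
    obtain P where P: "(par g)\<^sup>*\<^sup>* M' P" "par g N2 P"
      using strip[OF step.prems step.hyps(1)] by blast
    then obtain Q where "(par g)\<^sup>*\<^sup>* N1 Q" "(par g)\<^sup>*\<^sup>* P Q"
      using step.IH by blast
    with P(2) show ?case by (meson converse_rtranclp_into_rtranclp)
  qed blast
qed

section \<open>Simulation between named and parallel reduction\<close>

lemma wf_inst:
  assumes "wf_trm (App (Abs L B) N)" "degree N = L"
  shows "wf_trm (psub (inst N) B)" "fv (psub (inst N) B) \<subseteq> fv (App (Abs L B) N)"
    "degree (psub (inst N) B) = degree (Abs L B)"
proof -
  show fv: "fv (psub (inst N) B) \<subseteq> fv (App (Abs L B) N)"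
    using fa_inst[of N B] by (auto simp: fv_fa)
  show "degree (psub (inst N) B) = degree (Abs L B)"
    using assms(2) by (simp add: degree_deg deg_inst)
  show "wf_trm (psub (inst N) B)"
    using assms self_joinable_mono[OF fv] unfolding wf_trm_def
    by (auto intro: lc_inst ok_inst simp: degree_deg)
qed

lemma subst_inst:
  assumes "M \<in> terms" "N \<in> terms"
  shows "subst M x L N = psub (inst N) (psub (bind_sub (x, L)) M)"
  using assms by (simp add: subst_psub inst_bind terms_lc)

lemma beta_terms:
  "beta M N \<Longrightarrow> M \<in> terms \<and> N \<in> terms \<and> fv N \<subseteq> fv M \<and> degree N = degree M"
proof (induction rule: beta.induct)
  case (redex M x L N)
  then have "N \<in> terms" by (simp add: App_terms_iff)
  with redex show ?case
    using wf_inst[of L "psub (bind_sub (x, L)) M" N]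
    by (auto simp: terms_iff[symmetric] subst_inst lam_psub terms_lc degree_deg)
next
  case (lam M M' x L)
  then show ?case by (auto simp: fv_lam degree_lam)
qed (auto simp: degree_deg)

lemma shift_bind: "M \<in> terms \<Longrightarrow> (x, L) \<notin> fv M \<Longrightarrow> psub (bind_sub (x, L)) M = ren Suc M"
  unfolding ren_psub_atm by (rule psub_cong) (auto simp: fv_fa split: sum.splits)

lemma eta_terms:
  "eta M N \<Longrightarrow> M \<in> terms \<and> N \<in> terms \<and> fv N \<subseteq> fv M \<and> degree N = degree M"
proof (induction rule: eta.induct)
  case (redex M x L)
  then have "M \<in> terms" "prefix (degree M) L"
    by (auto simp: App_terms_iff degree_deg)
  with redex show ?case
    by (auto simp: fv_lam degree_lam lam_terms_iff) (auto simp: degree_deg)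
next
  case (lam M M' x L)
  then show ?case by (auto simp: fv_lam degree_lam)
qed (auto simp: degree_deg)

lemma betaeta_terms:
  "betaeta M N \<Longrightarrow> M \<in> terms \<and> N \<in> terms \<and> fv N \<subseteq> fv M \<and> degree N = degree M"
  using beta_terms eta_terms unfolding betaeta_def by blast

lemma betaeta_rtranclp_terms:
  "betaeta\<^sup>*\<^sup>* M N \<Longrightarrow> M \<in> terms \<Longrightarrow> N \<in> terms \<and> fv N \<subseteq> fv M \<and> degree N = degree M"
  by (induction rule: rtranclp_induct) (auto dest!: betaeta_terms)

lemma betaeta_App:
  assumes "betaeta\<^sup>*\<^sup>* M M'" "betaeta\<^sup>*\<^sup>* N N'" "App M N \<in> terms"
  shows "betaeta\<^sup>*\<^sup>* (App M N) (App M' N')"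
proof -
  have "betaeta\<^sup>*\<^sup>* (App M N) (App M' N) \<and> App M' N \<in> terms" using assms(1)
  proof (induction rule: rtranclp_induct)
    case (step M1 M2)
    \<comment> \<open>Reduction preserves degrees and adds no free names, so the application remains
      a term.\<close>
    then have "App M2 N \<in> terms"
      using betaeta_terms[OF step(2)] by (auto simp: App_terms_iff intro: joinable_mono)
    with step have "betaeta (App M1 N) (App M2 N)"
      by (auto simp: betaeta_def intro: beta.appL eta.appL)
    with step \<open>App M2 N \<in> terms\<close> show ?case by auto
  qed (simp add: assms(3))
  moreover have "betaeta\<^sup>*\<^sup>* (App M' N) (App M' N')" if "App M' N \<in> terms"
  proof -
    have "betaeta\<^sup>*\<^sup>* (App M' N) (App M' N') \<and> App M' N' \<in> terms" using assms(2)
    proof (induction rule: rtranclp_induct)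
      case (step N1 N2)
      then have "App M' N2 \<in> terms"
        using betaeta_terms[OF step(2)] by (auto simp: App_terms_iff intro: joinable_mono)
      with step have "betaeta (App M' N1) (App M' N2)"
        by (auto simp: betaeta_def intro: beta.appR eta.appR)
      with step \<open>App M' N2 \<in> terms\<close> show ?case by auto
    qed (simp add: that)
    then show ?thesis ..
  qed
  ultimately show ?thesis by auto
qed

lemma betaeta_lam:
  assumes "betaeta\<^sup>*\<^sup>* M M'" "M \<in> terms" "lam x L M \<in> terms"
  shows "betaeta\<^sup>*\<^sup>* (lam x L M) (lam x L M')"
proof -
  have "betaeta\<^sup>*\<^sup>* (lam x L M) (lam x L M') \<and> M' \<in> terms \<and> lam x L M' \<in> terms" using assms(1)
  proof (induction rule: rtranclp_induct)
    case (step M1 M2)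
    then have 2: "M2 \<in> terms" "lam x L M2 \<in> terms"
      using betaeta_terms[OF step(2)] lam_terms_iff by auto
    with step have "betaeta (lam x L M1) (lam x L M2)"
      by (auto simp: betaeta_def intro: beta.lam eta.lam)
    with step 2 show ?case by auto
  qed (simp add: assms)
  then show ?thesis ..
qed

lemma par_lam:
  assumes "par g M M'" "M \<in> terms" "M' \<in> terms"
  shows "par g (lam x L M) (lam x L M')"
proof -
  have "par (case_nat L g) (psub (bind_sub (x, L)) M) (psub (bind_sub (x, L)) M')"
    using assms(1) by (rule par_psub) (simp_all add: deg_bind par_refl)
  then show ?thesis using assms by (simp add: lam_psub terms_lc par.Abs)
qed

text \<open>The valuation is arbitrary because elements of \<open>terms\<close> have no dangling
  indices. \<open>betaeta_unlift\<close> exploits this by choosing a valuation whose indexes are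
  nonempty.\<close>

lemma beta_par: "beta M N \<Longrightarrow> par g M N"
proof (induction rule: beta.induct)
  case (redex M x L N)
  then have N: "N \<in> terms" by (simp add: App_terms_iff)
  with redex have "deg g N = L" by (simp add: deg_lc terms_lc)
  then show ?case
    unfolding subst_inst[OF redex(1) N] using redex(1)
    by (auto simp: lam_psub terms_lc intro: par.beta par_refl)
next
  case (lam M M' x L)
  then show ?case using beta_terms par_lam by blast
qed (auto intro: par.App par_refl)

lemma eta_par: "eta M N \<Longrightarrow> par g M N"
proof (induction rule: eta.induct)
  case (redex M x L)
  then have "M \<in> terms" by (simp add: App_terms_iff)
  then show ?case using redex terms_lc
    by (auto simp: lam_psub shift_bind intro!: par.eta par_refl)
next
  case (lam M M' x L)
  then show ?case using eta_terms par_lam by blast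
qed (auto intro: par.App par_refl)

text \<open>A name fresh at every index for both \<open>B\<close> and \<open>N\<close> secures the
  joinability premise of the redex rules.\<close>

lemma named_redexE:
  assumes "App (Abs L B) N \<in> terms"
  obtains x M where "Abs L B = lam x L M" "M \<in> terms" "joinable M N"
    "psub (inst N) B = subst M x L N"
proof -
  have N: "N \<in> terms" and A: "Abs L B \<in> terms" using assms by (auto simp: App_terms_iff)
  obtain x where x: "\<And>K. (x, K) \<notin> fv B \<union> fv N"
    using fresh_name[of "fv B \<union> fv N" UNIV] by auto
  let ?M = "psub (inst (FVar x L)) B"
  have M: "?M \<in> terms" using wf_Abs_body A x by (auto simp: terms_iff)
  have B: "Abs L B = lam x L ?M"
    using terms_lc[OF A] x by (intro Abs_eq_lam) (auto simp: fv_fa)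
  have "fv ?M \<subseteq> insert (x, L) (fv B)"
    using fa_inst[of "FVar x L" B] by (auto simp: fv_fa)
  moreover have "joinable (Abs L B) N" using assms by (simp add: App_terms_iff)
  ultimately have "joinable ?M N"
    using x unfolding joinable_def joinable_sets_def by fastforce
  moreover have "psub (bind_sub (x, L)) ?M = B"
    using x by (intro bind_inst) (simp add: fv_fa)
  ultimately show ?thesis using that[OF B M] by (simp add: subst_inst[OF M N])
qed

lemma beta_redexI:
  assumes "App (Abs L B) N \<in> terms" "degree N = L"
  shows "beta (App (Abs L B) N) (psub (inst N) B)"
  using assms by (metis named_redexE beta.redex)

text \<open>A step below a binder is carried out on the opened body, which induction on size
  reaches. For a beta step, function and argument are reduced first and the root redex is contracted
  last.\<close>

lemma par_betaeta: "M \<in> terms \<Longrightarrow> par g0 M N \<Longrightarrow> betaeta\<^sup>*\<^sup>* M N"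
proof (induction M arbitrary: N rule: measure_induct_rule[of size])
  case (less M)
  have AbsI: "betaeta\<^sup>*\<^sup>* (Abs L B) (Abs L B')"
    if A: "Abs L B \<in> terms" and B': "par (case_nat L g0) B B'" and size: "size B < size M"
    for L B B'
  proof -
    obtain x P where P: "Abs L B = lam x L P" "P = psub (inst (FVar x L)) B" "P \<in> terms"
      "size P = size B" "\<And>K. (x, K) \<notin> fv B"
      using terms_AbsE[OF A finite.emptyI] by metis
    let ?P' = "psub (inst (FVar x L)) B'"
    have "par g0 P ?P'"
      unfolding P(2) using B' by (intro par_inst) (auto intro: par_refl)
    then have *: "betaeta\<^sup>*\<^sup>* P ?P'"
      using P size by (intro less.IH) auto
    then have "betaeta\<^sup>*\<^sup>* (lam x L P) (lam x L ?P')"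
      using P A by (intro betaeta_lam) auto
    moreover have "psub (bind_sub (x, L)) ?P' = B'"
      using P(5)[of L] par_fa[OF B'] by (intro bind_inst) (auto simp: fv_fa)
    then have "lam x L ?P' = Abs L B'"
      using betaeta_rtranclp_terms[OF * P(3)] by (simp add: lam_psub terms_lc)
    ultimately show ?thesis using P(1) by simp
  qed
  from less.prems(2) show ?case
  proof (cases rule: par.cases)
    case (App P P' Q Q')
    then have "betaeta\<^sup>*\<^sup>* P P'" "betaeta\<^sup>*\<^sup>* Q Q'"
      using less by (auto simp: App_terms_iff)
    with App less.prems show ?thesis by (auto intro: betaeta_App)
  next
    case (Abs L B B')
    then show ?thesis using less.prems AbsI by auto
  next
    case (beta L B B' Q Q')
    then have t: "Abs L B \<in> terms" "Q \<in> terms"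
      using less.prems by (auto simp: App_terms_iff)
    then have "betaeta\<^sup>*\<^sup>* (Abs L B) (Abs L B')"
      using AbsI beta by auto
    moreover have "betaeta\<^sup>*\<^sup>* Q Q'"
      using less.IH[of Q Q'] beta t by auto
    ultimately have r: "betaeta\<^sup>*\<^sup>* M (App (Abs L B') Q')"
      using betaeta_App less.prems beta by auto
    have "degree Q' = L"
      using betaeta_rtranclp_terms[OF \<open>betaeta\<^sup>*\<^sup>* Q Q'\<close> t(2)] beta by (simp add: degree_deg)
    then have "betaeta (App (Abs L B') Q') N"
      using beta betaeta_rtranclp_terms[OF r less.prems(1)] beta_redexI
      by (auto simp: betaeta_def)
    with r show ?thesis by auto
  next
    case (eta R L)
    have "Abs L (App (ren Suc R) (BVar 0)) \<in> terms"
      using eta less.prems by simp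
    then obtain x P where P: "M = lam x L P" "P = psub (inst (FVar x L)) (App (ren Suc R) (BVar 0))"
      "P \<in> terms" "(x, L) \<notin> fv (App (ren Suc R) (BVar 0))"
      using eta by (metis terms_AbsE[of _ _ "{}"] finite.emptyI)
    then have P': "P = App R (FVar x L)" by simp
    have "(x, L) \<notin> fv R"
      using P(4) by (metis UnCI fa_ren fv.simps(3) fv_fa image_eqI map_sum.simps(1) id_apply vimage_eq)
    then have "betaeta M R"
      using P(1,3) P' by (auto simp: betaeta_def intro: eta.redex)
    moreover have "betaeta\<^sup>*\<^sup>* R N"
      using P(3) P' eta less.IH[of R N] by (auto simp: App_terms_iff)
    ultimately show ?thesis by auto
  qed (use less.prems in auto)
qed

lemma betaeta_confluent:
  assumes "betaeta\<^sup>*\<^sup>* M N1" "betaeta\<^sup>*\<^sup>* M N2" "M \<in> terms"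
  obtains P where "betaeta\<^sup>*\<^sup>* N1 P" "betaeta\<^sup>*\<^sup>* N2 P"
proof -
  have to_par: "(par g0)\<^sup>*\<^sup>* M N" if "betaeta\<^sup>*\<^sup>* M N" for M N
    using that by (rule mono_rtranclp[rule_format, rotated]) (auto simp: betaeta_def beta_par eta_par)
  have of_par: "betaeta\<^sup>*\<^sup>* M N" if "(par g0)\<^sup>*\<^sup>* M N" "M \<in> terms" for M N
    using that(1)
  proof (induction rule: rtranclp_induct)
    case (step N N')
    then have "betaeta\<^sup>*\<^sup>* N N'"
      using betaeta_rtranclp_terms that(2) par_betaeta by blast
    with step show ?case by simp
  qed simp
  obtain P where P: "(par g0)\<^sup>*\<^sup>* N1 P" "(par g0)\<^sup>*\<^sup>* N2 P"
    using par_confluent[OF assms(1,2)[THEN to_par]] by blast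
  show ?thesis
  proof (rule that)
    show "betaeta\<^sup>*\<^sup>* N1 P" "betaeta\<^sup>*\<^sup>* N2 P"
      using of_par P betaeta_rtranclp_terms assms by blast+
  qed
qed

section \<open>Subtyping\<close>

primrec tys :: "ty \<Rightarrow> ty set" where
  "tys (Atom a) = {Atom a}"
| "tys (Arr U T) = {Arr U T}"
| "tys (Omega L) = {}"
| "tys (Inter U V) = tys U \<union> tys V"
| "tys (Exp i U) = tys U"

lemma Atom_T_types [simp]: "Atom a \<in> T_types"
  by (rule T_types_U_types.Atom)

lemma Arr_T_types [simp]: "Arr U T \<in> T_types \<longleftrightarrow> U \<in> U_types \<and> T \<in> T_types"
  by (auto intro: T_types_U_types.Arr elim: T_types.cases)

lemma not_T_types [simp]: "Omega L \<notin> T_types" "Inter U V \<notin> T_types" "Exp i U \<notin> T_types"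
  by (auto elim: T_types.cases)

lemma U_types_simps [simp]:
  "Atom a \<in> U_types" "Omega L \<in> U_types"
  "Arr U T \<in> U_types \<longleftrightarrow> U \<in> U_types \<and> T \<in> T_types"
  "Inter U V \<in> U_types \<longleftrightarrow> U \<in> U_types \<and> V \<in> U_types \<and> tdegree U = tdegree V"
  "Exp i U \<in> U_types \<longleftrightarrow> U \<in> U_types"
  by (auto simp: Inter_in_U_types intro: T_types_U_types.intros elim: U_types.cases)

lemma T_types_U: "T \<in> T_types \<Longrightarrow> T \<in> U_types"
  by (rule T_types_U_types.T_in_U)

lemma T_types_simps: "T \<in> T_types \<Longrightarrow> tdegree T = [] \<and> tys T = {T}"
  by (cases T) auto

lemma finite_tys [simp]: "finite (tys U)"
  by (induction U) auto

lemma tys_T_types: "U \<in> U_types \<Longrightarrow> tys U \<subseteq> T_types"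
  by (induction U) auto

text \<open>The inverted form of subtyping on \<open>T_types\<close>. A derivation of
  \<open>sub\<close> may pass through intersections on the way, so inversion is not immediate and is
  obtained from the components in \<open>sub_tys\<close>.\<close>

definition subT :: "ty \<Rightarrow> ty \<Rightarrow> bool" where
  "subT S T \<longleftrightarrow> (\<exists>a. S = Atom a \<and> T = Atom a) \<or>
    (\<exists>U1 T1 U2 T2. S = Arr U1 T1 \<and> T = Arr U2 T2 \<and> sub U2 U1 \<and> sub T1 T2
      \<and> T1 \<in> T_types \<and> T2 \<in> T_types)"

lemma sub_refl [simp]: "U \<in> U_types \<Longrightarrow> sub U U"
  by (intro sub.refl ty_eq.refl)

lemma subT_sub: "subT S T \<Longrightarrow> sub S T"
  by (auto simp: subT_def intro: sub.Arr)

lemma subT_refl: "T \<in> T_types \<Longrightarrow> subT T T"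
  by (cases T) (auto simp: subT_def dest: T_types_U)

lemma subT_trans: "subT S T \<Longrightarrow> subT T R \<Longrightarrow> subT S R"
  by (auto simp: subT_def intro: sub.trans)

text \<open>Both directions are proved together on account of the symmetry rule.\<close>

lemma ty_eq_tys:
  "ty_eq U V \<Longrightarrow> (\<forall>T\<in>tys V. \<exists>S\<in>tys U. subT S T) \<and> (\<forall>T\<in>tys U. \<exists>S\<in>tys V. subT S T)"
proof (induction rule: ty_eq.induct)
  case (refl U)
  then show ?case using tys_T_types subT_refl by blast
next
  case (trans U V W)
  then show ?case by (meson subT_trans)
next
  case (Arr U U' T T')
  then show ?case by (auto simp: subT_def intro: sub.refl ty_eq.sym)
next
  case (comm U V)
  then show ?case using tys_T_types[of "Inter U V"] subT_refl by auto
next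
  case (assoc U V W)
  then show ?case using tys_T_types[of "Inter U (Inter V W)"] subT_refl
    by (simp add: Un_assoc) blast
next
  case (idem U)
  then show ?case using tys_T_types[of U] subT_refl by auto
next
  case (Exp_Inter U V i)
  then show ?case using tys_T_types[of "Inter U V"] subT_refl by auto
next
  case (Omega_Inter U L)
  then show ?case using tys_T_types[of U] subT_refl by auto
qed auto

lemma sub_tys: "sub U V \<Longrightarrow> \<forall>T\<in>tys V. \<exists>S\<in>tys U. subT S T"
proof (induction rule: sub.induct)
  case (refl U V)
  then show ?case using ty_eq_tys by blast
next
  case (trans U V W)
  then show ?case by (meson subT_trans)
next
  case (Inter_left U1 U2)
  then show ?case using tys_T_types[of U1] subT_refl by auto
next
  case (Arr U2 U1 T1 T2)
  then show ?case by (auto simp: subT_def)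
qed auto

lemma sub_subT: "sub S T \<Longrightarrow> S \<in> T_types \<Longrightarrow> T \<in> T_types \<Longrightarrow> subT S T"
  using sub_tys[of S T] T_types_simps by auto

lemma sub_Inter_right:
  "U1 \<in> U_types \<Longrightarrow> U2 \<in> U_types \<Longrightarrow> tdegree U1 = tdegree U2 \<Longrightarrow> sub (Inter U1 U2) U2"
  by (rule sub.trans[OF sub.refl[OF ty_eq.comm]]) (auto intro: sub.Inter_left)

lemma sub_Omega: "U \<in> U_types \<Longrightarrow> tdegree U = L \<Longrightarrow> sub U (Omega L)"
  by (rule sub.trans[OF sub.refl[OF ty_eq.sym[OF ty_eq.Omega_Inter]] sub.Inter_left]) auto

lemma sub_Inter_greatest:
  assumes "sub U V1" "sub U V2" shows "sub U (Inter V1 V2)"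
proof -
  have "U \<in> U_types" "Inter V1 V2 \<in> U_types"
    using sub_wf[OF assms(1)] sub_wf[OF assms(2)] by auto
  then show ?thesis
    using assms by (intro sub.trans[OF sub.refl[OF ty_eq.sym[OF ty_eq.idem]] sub.Inter]) auto
qed

text \<open>The equations for \<open>Omega\<close> and for intersections allow the first expansion
  variable of the degree to be pulled to the root. Stripping it there prepares uses of the rule
  \<open>exp\<close>.\<close>

lemma Exp_canonical:
  "U \<in> U_types \<Longrightarrow> tdegree U = i # L \<Longrightarrow>
    \<exists>V\<in>U_types. tdegree V = L \<and> tys V = tys U \<and> ty_eq U (Exp i V)"
proof (induction U)
  case (Omega K)
  then show ?case by (intro bexI[of _ "Omega L"]) (auto intro: ty_eq.sym ty_eq.Exp_Omega)
next
  case (Inter U1 U2)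
  then obtain V1 V2 where V: "V1 \<in> U_types" "tdegree V1 = L" "tys V1 = tys U1" "ty_eq U1 (Exp i V1)"
    "V2 \<in> U_types" "tdegree V2 = L" "tys V2 = tys U2" "ty_eq U2 (Exp i V2)"
    by (metis U_types_simps(4) tdegree.simps(4))
  have "ty_eq (Inter U1 U2) (Inter (Exp i V1) (Exp i V2))"
    using V Inter.prems by (intro ty_eq.Inter) auto
  also have "ty_eq \<dots> (Exp i (Inter V1 V2))"
    using V by (intro ty_eq.sym[OF ty_eq.Exp_Inter]) auto
  finally (ty_eq.trans) show ?case using V by (intro bexI[of _ "Inter V1 V2"]) auto
next
  case (Exp j U)
  then show ?case by (intro bexI[of _ U]) (auto intro: ty_eq.refl)
qed auto

lemma sub_component: "U \<in> U_types \<Longrightarrow> tdegree U = [] \<Longrightarrow> S \<in> tys U \<Longrightarrow> sub U S"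
proof (induction U)
  case (Inter U1 U2)
  then show ?case by (auto intro: sub.trans[OF sub.Inter_left] sub.trans[OF sub_Inter_right])
qed auto

text \<open>In the case \<open>Exp\<close> the same variable is pulled to the root of
  \<open>U\<close> by \<open>Exp_canonical\<close> and then cancelled. Together with
  \<open>sub_tys\<close> this reduces subtyping to degrees and components.\<close>

lemma sub_of_tys:
  "V \<in> U_types \<Longrightarrow> U \<in> U_types \<Longrightarrow> tdegree U = tdegree V \<Longrightarrow>
    (\<And>T. T \<in> tys V \<Longrightarrow> \<exists>S\<in>tys U. sub S T) \<Longrightarrow> sub U V"
proof (induction V arbitrary: U)
  case (Atom a)
  then obtain S where "S \<in> tys U" "sub S (Atom a)" by auto
  with sub_component Atom show ?case by (metis sub.trans tdegree.simps(1))
next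
  case (Arr V T)
  then obtain S where "S \<in> tys U" "sub S (Arr V T)" by auto
  with sub_component Arr show ?case by (metis sub.trans tdegree.simps(2))
next
  case (Omega L)
  then show ?case by (simp add: sub_Omega)
next
  case (Inter V1 V2)
  then show ?case by (intro sub_Inter_greatest) auto
next
  case (Exp i V)
  then obtain U0 where U0: "U0 \<in> U_types" "tdegree U0 = tdegree V" "tys U0 = tys U"
    "ty_eq U (Exp i U0)"
    using Exp_canonical[of U i "tdegree V"] by auto
  then have "sub U0 V" using Exp by (intro Exp.IH) auto
  with U0 show ?case by (meson sub.Exp sub.refl sub.trans)
qed

text \<open>Turns the finite sets delivered by \<open>sem_continuous\<close> into types of whatever
  degree a binder demands.\<close>

lemma ex_type_of_tys:
  assumes "finite A" "A \<subseteq> T_types"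
  shows "\<exists>U\<in>U_types. tdegree U = L \<and> tys U = A"
  using assms
proof (induction rule: finite_induct)
  case empty
  then show ?case by (intro bexI[of _ "Omega L"]) auto
next
  case (insert T A)
  then obtain U where U: "U \<in> U_types" "tdegree U = L" "tys U = A" by auto
  have "foldr Exp L T \<in> U_types \<and> tdegree (foldr Exp L T) = L \<and> tys (foldr Exp L T) = {T}"
    using insert.prems by (induction L) (auto simp: T_types_simps T_types_U)
  with U show ?case by (intro bexI[of _ "Inter (foldr Exp L T) U"]) auto
qed

section \<open>A filter model\<close>

definition upset :: "ty set \<Rightarrow> ty set" where
  "upset A = {T \<in> T_types. \<exists>S\<in>A. sub S T}"

text \<open>An element of \<open>T_types\<close> is never an intersection, so a filter is just an
  upward closed set; the filter generated by a type \<open>U\<close> is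
  \<open>upset (tys U)\<close>.\<close>

definition filt :: "ty set \<Rightarrow> bool" where
  "filt F \<longleftrightarrow> F \<subseteq> T_types \<and> upset F \<subseteq> F"

lemma upset_filt [simp]: "filt (upset A)"
  unfolding filt_def upset_def using sub.trans by blast

lemma upset_mono: "A \<subseteq> B \<Longrightarrow> upset A \<subseteq> upset B"
  by (auto simp: upset_def)

lemma upset_least: "filt F \<Longrightarrow> A \<subseteq> F \<Longrightarrow> upset A \<subseteq> F"
  using upset_mono[of A F] by (auto simp: filt_def)

lemma filtD: "filt F \<Longrightarrow> S \<in> F \<Longrightarrow> sub S T \<Longrightarrow> T \<in> T_types \<Longrightarrow> T \<in> F"
  by (auto simp: filt_def upset_def)

lemma upset_ext: "A \<subseteq> T_types \<Longrightarrow> A \<subseteq> upset A"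
  unfolding upset_def using T_types_U sub_refl by blast

lemma upset_tys_sub: "sub U V \<Longrightarrow> upset (tys V) \<subseteq> upset (tys U)"
  using sub_tys[of U V] subT_sub sub.trans unfolding upset_def by blast

lemma sub_iff_upset:
  assumes "U \<in> U_types" "V \<in> U_types" "tdegree U = tdegree V" "tys V \<subseteq> upset (tys U)"
  shows "sub U V"
  using assms by (intro sub_of_tys) (auto simp: upset_def)

fun push :: "'a \<Rightarrow> (atom \<Rightarrow> 'a) \<Rightarrow> atom \<Rightarrow> 'a" where
  "push F \<rho> (Inl c) = \<rho> (Inl c)"
| "push F \<rho> (Inr 0) = F"
| "push F \<rho> (Inr (Suc n)) = \<rho> (Inr n)"

text \<open>If \<open>M\<close> has degree \<open>K\<close>, then \<open>T \<in> sem g \<rho> M\<close> corresponds to \<open>M\<close> having the type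
  \<open>T\<close> prefixed by the expansion variables in \<open>K\<close>.\<close>

primrec sem :: "(nat \<Rightarrow> index) \<Rightarrow> (atom \<Rightarrow> ty set) \<Rightarrow> trm \<Rightarrow> ty set" where
  "sem g \<rho> (FVar x L) = \<rho> (Inl (x, L))"
| "sem g \<rho> (BVar n) = \<rho> (Inr n)"
| "sem g \<rho> (App M N) = {T. \<exists>U. Arr U T \<in> sem g \<rho> M \<and> deg g N = deg g M @ tdegree U
      \<and> tys U \<subseteq> sem g \<rho> N}"
| "sem g \<rho> (Abs L M) = {Arr U T |U T. U \<in> U_types \<and> T \<in> T_types
      \<and> L = deg (case_nat L g) M @ tdegree U
      \<and> T \<in> sem (case_nat L g) (push (upset (tys U)) \<rho>) M}"

lemma sem_atm [simp]: "sem g \<rho> (atm v) = \<rho> v"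
  by (cases v) auto

lemma push_shift_atom [simp]: "push F \<rho> (shift_atom v) = \<rho> v"
  by (cases v) auto

lemma sem_cong:
  "(\<And>v. v \<in> fa M \<Longrightarrow> \<rho> v = \<rho>' v) \<Longrightarrow> (\<And>n. Inr n \<in> fa M \<Longrightarrow> g n = g' n)
    \<Longrightarrow> sem g \<rho> M = sem g' \<rho>' M"
proof (induction M arbitrary: g g' \<rho> \<rho>')
  case (App M N)
  have "sem g \<rho> M = sem g' \<rho>' M" "sem g \<rho> N = sem g' \<rho>' N"
    using App.prems by (auto intro!: App.IH)
  moreover have "deg g M = deg g' M" "deg g N = deg g' N"
    using App.prems by (auto intro!: deg_cong)
  ultimately show ?case by simp
next
  case (Abs L M)
  have *: "Inr n \<in> fa M \<Longrightarrow> case_nat L g n = case_nat L g' n" for n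
    using Abs.prems(2) by (cases n) auto
  have "push F \<rho> v = push F \<rho>' v" if "v \<in> fa M" for F v
    by (cases v rule: atom_cases) (use that Abs.prems(1) in auto)
  then have "sem (case_nat L g) (push F \<rho>) M = sem (case_nat L g') (push F \<rho>') M" for F
    using * by (intro Abs.IH)
  moreover have "deg (case_nat L g) M = deg (case_nat L g') M"
    using * by (intro deg_cong)
  ultimately show ?case by simp
qed auto

lemma sem_ren: "sem g \<rho> (ren f M) = sem (g \<circ> f) (\<rho> \<circ> map_sum id f) M"
proof (induction M arbitrary: g \<rho> f)
  case (App M N)
  then show ?case by (simp only: ren.simps sem.simps deg_ren)
next
  case (Abs L M)
  have g: "case_nat L g \<circ> case_nat 0 (Suc \<circ> f) = case_nat L (g \<circ> f)"
    by (auto simp: fun_eq_iff split: nat.splits)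
  have \<rho>: "push F \<rho> \<circ> map_sum id (case_nat 0 (Suc \<circ> f)) = push F (\<rho> \<circ> map_sum id f)" for F
  proof
    fix v show "(push F \<rho> \<circ> map_sum id (case_nat 0 (Suc \<circ> f))) v = push F (\<rho> \<circ> map_sum id f) v"
      by (cases "(F, \<rho>, v)" rule: push.cases) auto
  qed
  show ?case by (simp only: ren.simps sem.simps deg_ren Abs.IH g \<rho>)
qed auto

lemma sem_shift [simp]: "sem (case_nat L g) (push F \<rho>) (ren Suc M) = sem g \<rho> M"
proof -
  have "push F \<rho> (map_sum id Suc v) = \<rho> v" for v by (cases v) auto
  then show ?thesis unfolding sem_ren by (intro sem_cong) auto
qed

text \<open>The substitution lemma of the model. Substitutions have to respect degrees because
  \<open>sem\<close> compares the degrees of functions, arguments and bodies.\<close>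

lemma sem_psub:
  "(\<And>v. v \<in> fa M \<Longrightarrow> deg g' (s v) = deg g (atm v))
    \<Longrightarrow> sem g' \<rho> (psub s M) = sem g (\<lambda>v. sem g' \<rho> (s v)) M"
proof (induction M arbitrary: g g' \<rho> s)
  case (App M N)
  have "sem g' \<rho> (psub s M) = sem g (\<lambda>v. sem g' \<rho> (s v)) M"
    "sem g' \<rho> (psub s N) = sem g (\<lambda>v. sem g' \<rho> (s v)) N"
    using App.prems by (auto intro!: App.IH)
  moreover have "deg g' (psub s M) = deg g M" "deg g' (psub s N) = deg g N"
    using App.prems by (auto intro!: deg_psub)
  ultimately show ?case by simp
next
  case (Abs L M)
  have d: "deg (case_nat L g') (up_sub s v) = deg (case_nat L g) (atm v)" if "v \<in> fa M" for v
    using deg_up_sub[of L M g' s g] Abs.prems that by auto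
  have "sem (case_nat L g') (push F \<rho>) (up_sub s v) = push F (\<lambda>v. sem g' \<rho> (s v)) v" for F v
    by (cases v rule: atom_cases) (auto simp: up_sub_shift_atom)
  then have "sem (case_nat L g') (push F \<rho>) (psub (up_sub s) M)
      = sem (case_nat L g) (push F (\<lambda>v. sem g' \<rho> (s v))) M" for F
    using Abs.IH[OF d] by simp
  moreover have "deg (case_nat L g') (psub (up_sub s) M) = deg (case_nat L g) M"
    using d by (rule deg_psub)
  ultimately show ?case by simp
qed auto

lemma sem_inst:
  assumes "deg g N = L"
  shows "sem g \<rho> (psub (inst N) M) = sem (case_nat L g) (push (sem g \<rho> N) \<rho>) M"
proof -
  have "deg g (inst N v) = deg (case_nat L g) (atm v)" for v
    by (cases "(N, v)" rule: inst.cases) (auto simp: assms)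
  moreover have "sem g \<rho> (inst N v) = push (sem g \<rho> N) \<rho> v" for v
    by (cases "(N, v)" rule: inst.cases) auto
  ultimately show ?thesis by (simp add: sem_psub)
qed

lemma sem_bind:
  "sem (case_nat L g) (push F \<rho>) (psub (bind_sub (x, L)) M) = sem g (\<rho>(Inl (x, L) := F)) M"
proof -
  have "sem (case_nat L g) (push F \<rho>) (bind_sub (x, L) v) = (\<rho>(Inl (x, L) := F)) v" for v
    by (cases v) auto
  then show ?thesis
    by (subst sem_psub[where g = g]) (auto simp: deg_bind intro!: sem_cong)
qed

lemma sem_lam:
  assumes "M \<in> terms"
  shows "sem g \<rho> (lam x L M) = {Arr U T |U T. U \<in> U_types \<and> T \<in> T_types
    \<and> L = degree M @ tdegree U \<and> T \<in> sem g (\<rho>(Inl (x, L) := upset (tys U))) M}"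
proof -
  have "deg (case_nat L g) (psub (bind_sub (x, L)) M) = degree M"
    using deg_psub[of M "case_nat L g" "bind_sub (x, L)" g] assms
    by (simp add: deg_bind deg_lc terms_lc)
  then show ?thesis using assms by (simp add: lam_psub terms_lc sem_bind)
qed

section \<open>Monotonicity, upward closure and continuity\<close>

lemma sem_mono: "(\<And>v. \<rho> v \<subseteq> \<rho>' v) \<Longrightarrow> sem g \<rho> M \<subseteq> sem g \<rho>' M"
proof (induction M arbitrary: g \<rho> \<rho>')
  case (App M N)
  have "sem g \<rho> M \<subseteq> sem g \<rho>' M" "sem g \<rho> N \<subseteq> sem g \<rho>' N"
    by (intro App.IH App.prems)+
  then show ?case unfolding sem.simps by blast
next
  case (Abs L M)
  have "push F \<rho> v \<subseteq> push F \<rho>' v" for F v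
    by (cases v rule: atom_cases) (use Abs.prems in auto)
  then have "sem (case_nat L g) (push F \<rho>) M \<subseteq> sem (case_nat L g) (push F \<rho>') M" for F
    by (rule Abs.IH)
  then show ?case by auto
qed auto

lemma push_filt: "filt F \<Longrightarrow> (\<And>v. filt (\<rho> v)) \<Longrightarrow> filt (push F \<rho> v)"
  by (cases v rule: atom_cases) auto

lemma sem_filt: "(\<And>v. filt (\<rho> v)) \<Longrightarrow> filt (sem g \<rho> M)"
proof (induction M arbitrary: g \<rho>)
  case (App M N)
  have M: "filt (sem g \<rho> M)" using App by blast
  have 1: "T \<in> T_types" if "Arr U T \<in> sem g \<rho> M" for U T
    using that M by (auto simp: filt_def)
  have 2: "Arr U T' \<in> sem g \<rho> M" if "Arr U T \<in> sem g \<rho> M" "sub T T'" "T' \<in> T_types" for U T T'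
  proof (rule filtD[OF M that(1)])
    have "Arr U T \<in> T_types" using that M by (auto simp: filt_def)
    then show "sub (Arr U T) (Arr U T')" "Arr U T' \<in> T_types"
      using that by (auto intro: sub.Arr)
  qed
  show ?case unfolding filt_def
  proof (intro conjI subsetI)
    fix R assume "R \<in> upset (sem g \<rho> (App M N))"
    then obtain S where "R \<in> T_types" "S \<in> sem g \<rho> (App M N)" "sub S R"
      unfolding upset_def by blast
    with 2 show "R \<in> sem g \<rho> (App M N)" unfolding sem.simps by blast
  qed (use 1 in auto)
next
  case (Abs L M)
  show ?case unfolding filt_def
  proof (intro conjI subsetI)
    fix R assume "R \<in> upset (sem g \<rho> (Abs L M))"
    then obtain U T where R: "R \<in> T_types" "sub (Arr U T) R" and UT: "U \<in> U_types" "T \<in> T_types"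
      "L = deg (case_nat L g) M @ tdegree U" "T \<in> sem (case_nat L g) (push (upset (tys U)) \<rho>) M"
      by (auto simp: upset_def)
    \<comment> \<open>Inversion shows that \<open>R\<close> is an arrow too. Its domain is a subtype
      of \<open>U\<close>, so the filter pushed for the bound variable grows and
      \<open>sem_mono\<close> applies.\<close>
    then have "subT (Arr U T) R" by (auto intro: sub_subT)
    then obtain U' T' where R': "R = Arr U' T'" "sub U' U" "sub T T'" "T' \<in> T_types"
      by (auto simp: subT_def)
    have "push (upset (tys U)) \<rho> v \<subseteq> push (upset (tys U')) \<rho> v" for v
      by (cases v rule: atom_cases) (use upset_tys_sub[OF R'(2)] in auto)
    then have "T \<in> sem (case_nat L g) (push (upset (tys U')) \<rho>) M"
      using UT(4) sem_mono by blast
    moreover have "filt (sem (case_nat L g) (push (upset (tys U')) \<rho>) M)"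
      by (intro Abs.IH push_filt Abs.prems) simp
    ultimately have "T' \<in> sem (case_nat L g) (push (upset (tys U')) \<rho>) M"
      using R' filtD by blast
    then show "R \<in> sem g \<rho> (Abs L M)"
      using R' UT(3) sub_wf[OF R'(2)] by auto
  qed auto
qed auto

text \<open>Membership in a value inspects each filter at finitely many types only, because the
  domain of an arrow has finitely many components. This is what allows a beta redex to be given the
  types of its contractum.\<close>

lemma sem_continuous:
  "(\<And>v. filt (\<rho> v)) \<Longrightarrow> filt F \<Longrightarrow> T \<in> sem g (\<rho>(w := F)) M
    \<Longrightarrow> \<exists>A\<subseteq>F. finite A \<and> T \<in> sem g (\<rho>(w := upset A)) M"
proof (induction M arbitrary: g \<rho> T w)
  case (FVar x L)
  show ?case
  proof (cases "w = Inl (x, L)")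
    case True
    with FVar.prems have "T \<in> F" by simp
    moreover have "T \<in> T_types" using \<open>T \<in> F\<close> FVar.prems(2) by (auto simp: filt_def)
    ultimately show ?thesis
      using True by (intro exI[of _ "{T}"]) (simp add: upset_def T_types_U)
  next
    case False
    with FVar show ?thesis by (intro exI[of _ "{}"]) auto
  qed
next
  case (BVar n)
  show ?case
  proof (cases "w = Inr n")
    case True
    with BVar.prems have "T \<in> F" by simp
    moreover have "T \<in> T_types" using \<open>T \<in> F\<close> BVar.prems(2) by (auto simp: filt_def)
    ultimately show ?thesis
      using True by (intro exI[of _ "{T}"]) (simp add: upset_def T_types_U)
  next
    case False
    with BVar show ?thesis by (intro exI[of _ "{}"]) auto
  qed
next
  case (App M N)
  then obtain U where U: "Arr U T \<in> sem g (\<rho>(w := F)) M" "deg g N = deg g M @ tdegree U"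
    "tys U \<subseteq> sem g (\<rho>(w := F)) N" unfolding sem.simps by blast
  obtain A where A: "A \<subseteq> F" "finite A" "Arr U T \<in> sem g (\<rho>(w := upset A)) M"
    using App.IH(1)[OF App.prems(1,2) U(1)] by blast
  have "\<forall>S\<in>tys U. \<exists>B\<subseteq>F. finite B \<and> S \<in> sem g (\<rho>(w := upset B)) N"
  proof
    fix S assume "S \<in> tys U"
    then have "S \<in> sem g (\<rho>(w := F)) N" using U(3) by blast
    from App.IH(2)[OF App.prems(1,2) this]
    show "\<exists>B\<subseteq>F. finite B \<and> S \<in> sem g (\<rho>(w := upset B)) N" .
  qed
  then obtain B where
    B: "\<forall>S\<in>tys U. B S \<subseteq> F \<and> finite (B S) \<and> S \<in> sem g (\<rho>(w := upset (B S))) N"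
    by (rule bchoice[THEN exE])
  \<comment> \<open>One finite set that serves the function and every component demanded of the
    argument.\<close>
  let ?C = "A \<union> (\<Union>S\<in>tys U. B S)"
  have mono: "sem g (\<rho>(w := upset A')) P \<subseteq> sem g (\<rho>(w := upset ?C)) P" if "A' \<subseteq> ?C" for A' P
    by (rule sem_mono) (use upset_mono[OF that] in auto)
  have "Arr U T \<in> sem g (\<rho>(w := upset ?C)) M"
    using mono[of A] A by blast
  moreover have "tys U \<subseteq> sem g (\<rho>(w := upset ?C)) N"
  proof
    fix S assume S: "S \<in> tys U"
    then have "B S \<subseteq> ?C" by blast
    from mono[OF this, of N] bspec[OF B S] show "S \<in> sem g (\<rho>(w := upset ?C)) N" by blast
  qed
  ultimately have "T \<in> sem g (\<rho>(w := upset ?C)) (App M N)"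
    using U(2) unfolding sem.simps by blast
  moreover have "?C \<subseteq> F" "finite ?C" using A B by auto
  ultimately show ?case by blast
next
  case (Abs L M)
  then obtain U T' where T: "T = Arr U T'" "U \<in> U_types" "T' \<in> T_types"
    "L = deg (case_nat L g) M @ tdegree U"
    "T' \<in> sem (case_nat L g) (push (upset (tys U)) (\<rho>(w := F))) M"
    unfolding sem.simps by blast
  have p: "push G (\<rho>(w := F)) = (push G \<rho>)(shift_atom w := F)" for F G
  proof
    fix v
    have "shift_atom w \<noteq> Inr 0" by (cases w) auto
    moreover have "shift_atom v = shift_atom w \<longleftrightarrow> v = w" for v by (cases v; cases w) auto
    ultimately show "push G (\<rho>(w := F)) v = ((push G \<rho>)(shift_atom w := F)) v"
      by (cases v rule: atom_cases) auto
  qed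
  have "filt (push (upset (tys U)) \<rho> v)" for v
    by (intro push_filt upset_filt Abs.prems)
  then have "\<exists>A\<subseteq>F. finite A \<and> T' \<in> sem (case_nat L g) ((push (upset (tys U)) \<rho>)(shift_atom w := upset A)) M"
    using Abs.prems(2) T(5)[unfolded p] by (rule Abs.IH)
  then show ?case using T(1-4) unfolding p[symmetric] sem.simps by blast
qed

section \<open>The model under beta and eta\<close>

lemma sem_beta:
  assumes \<rho>: "\<And>v. filt (\<rho> v)" and L: "deg g N = L" "prefix (deg (case_nat L g) B) L"
  shows "sem g \<rho> (App (Abs L B) N) = sem g \<rho> (psub (inst N) B)"
proof -
  let ?g = "case_nat L g"
  have N: "filt (sem g \<rho> N)" using \<rho> by (rule sem_filt)
  have "T \<in> sem g \<rho> (App (Abs L B) N) \<longleftrightarrow> T \<in> sem ?g (push (sem g \<rho> N) \<rho>) B" for T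
  proof
    assume "T \<in> sem g \<rho> (App (Abs L B) N)"
    then obtain U where U: "tys U \<subseteq> sem g \<rho> N" "T \<in> sem ?g (push (upset (tys U)) \<rho>) B"
      by auto
    have "push (upset (tys U)) \<rho> v \<subseteq> push (sem g \<rho> N) \<rho> v" for v
      by (cases v rule: atom_cases) (use upset_least[OF N U(1)] in auto)
    then show "T \<in> sem ?g (push (sem g \<rho> N) \<rho>) B" using sem_mono U(2) by blast
  next
    assume T: "T \<in> sem ?g (push (sem g \<rho> N) \<rho>) B"
    \<comment> \<open>Presents the pushed filter as an update at index 0, the form that
      \<open>sem_continuous\<close> handles.\<close>
    have p: "push F \<rho> = (push {} \<rho>)(Inr 0 := F)" for F
    proof
      fix v show "push F \<rho> v = ((push {} \<rho>)(Inr 0 := F)) v"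
        by (cases "(F, \<rho>, v)" rule: push.cases) auto
    qed
    have e: "filt (push {} \<rho> v)" for v
      by (intro push_filt \<rho>) (simp add: filt_def upset_def)
    have "\<exists>A\<subseteq>sem g \<rho> N. finite A \<and> T \<in> sem ?g ((push {} \<rho>)(Inr 0 := upset A)) B"
      using e N T[unfolded p[of "sem g \<rho> N"]] by (rule sem_continuous)
    then obtain A where A: "A \<subseteq> sem g \<rho> N" "finite A" "T \<in> sem ?g (push (upset A) \<rho>) B"
      unfolding p[symmetric] by auto
    \<comment> \<open>The domain type must have the degree \<open>J\<close> by which the binder's
      index exceeds the degree of the body.\<close>
    obtain J where J: "L = deg ?g B @ J" using L(2) by (auto elim: prefixE)
    obtain U where U: "U \<in> U_types" "tdegree U = J" "tys U = A"
      using ex_type_of_tys[OF A(2), of J] A(1) N by (auto simp: filt_def)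
    have "filt (sem ?g (push (upset A) \<rho>) B)"
      by (intro sem_filt push_filt \<rho>) auto
    then have "T \<in> T_types" using A by (auto simp: filt_def)
    then have "Arr U T \<in> sem g \<rho> (Abs L B)"
      using U A J by auto
    then show "T \<in> sem g \<rho> (App (Abs L B) N)"
      using U A J L(1) by auto
  qed
  then show ?thesis unfolding sem_inst[OF L(1)] by blast
qed

text \<open>The domain \<open>U'\<close> at which \<open>M\<close> is used has its components in the
  filter of \<open>U\<close>, so \<open>U\<close> is a subtype of \<open>U'\<close> and
  contravariance applies. Only an inclusion can hold, as atoms in the value of \<open>M\<close>
  never belong to an abstraction.\<close>

lemma sem_eta:
  assumes "\<And>v. filt (\<rho> v)"
  shows "sem g \<rho> (Abs L (App (ren Suc M) (BVar 0))) \<subseteq> sem g \<rho> M"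
proof
  fix R assume "R \<in> sem g \<rho> (Abs L (App (ren Suc M) (BVar 0)))"
  then obtain U T U' where R: "R = Arr U T" "U \<in> U_types" "T \<in> T_types"
    "tdegree U = tdegree U'" "Arr U' T \<in> sem g \<rho> M" "tys U' \<subseteq> upset (tys U)"
    by auto
  have M: "filt (sem g \<rho> M)" using assms by (rule sem_filt)
  then have "U' \<in> U_types" using R by (auto simp: filt_def)
  then have "sub U U'" using R by (intro sub_iff_upset) auto
  then show "R \<in> sem g \<rho> M"
    using R by (auto intro!: filtD[OF M R(5)] sub.Arr simp: T_types_U)
qed

text \<open>Subject reduction in the model; \<open>ok\<close> provides the prefix premise of
  \<open>sem_beta\<close>.\<close>

lemma sem_par: "par g M M' \<Longrightarrow> ok g M \<Longrightarrow> (\<And>v. filt (\<rho> v)) \<Longrightarrow> sem g \<rho> M \<subseteq> sem g \<rho> M'"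
proof (induction arbitrary: \<rho> rule: par.induct)
  case (App g M M' N N')
  then have "sem g \<rho> M \<subseteq> sem g \<rho> M'" "sem g \<rho> N \<subseteq> sem g \<rho> N'" by auto
  then show ?case using par_deg[OF App.hyps(1)] par_deg[OF App.hyps(2)]
    unfolding sem.simps by (simp only:) blast
next
  case (Abs L g M M')
  then have "sem (case_nat L g) (push (upset A) \<rho>) M \<subseteq> sem (case_nat L g) (push (upset A) \<rho>) M'" for A
    by (intro Abs.IH push_filt) auto
  then show ?case using par_deg[OF Abs.hyps(1)] by auto
next
  case (beta L g M M' N N')
  have 1: "sem (case_nat L g) (push (sem g \<rho> N) \<rho>) M \<subseteq> sem (case_nat L g) (push (sem g \<rho> N) \<rho>) M'"
    using beta by (intro beta.IH push_filt sem_filt) auto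
  have "push (sem g \<rho> N) \<rho> v \<subseteq> push (sem g \<rho> N') \<rho> v" for v
    by (cases v rule: atom_cases) (use beta.IH(2)[of \<rho>] beta.prems in auto)
  then have 2: "sem (case_nat L g) (push (sem g \<rho> N) \<rho>) M' \<subseteq> sem (case_nat L g) (push (sem g \<rho> N') \<rho>) M'"
    by (rule sem_mono)
  have "sem g \<rho> (App (Abs L M) N) = sem (case_nat L g) (push (sem g \<rho> N) \<rho>) M"
    using sem_beta[of \<rho> g N L M] sem_inst[of g N L \<rho> M] beta by simp
  moreover have "sem g \<rho> (psub (inst N') M') = sem (case_nat L g) (push (sem g \<rho> N') \<rho>) M'"
    using par_deg[OF beta.hyps(2)] beta.hyps(3) by (intro sem_inst) auto
  ultimately show ?case using 1 2 by simp
next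
  case (eta g M M' L)
  then have "sem g \<rho> M \<subseteq> sem g \<rho> M'" by auto
  with sem_eta eta.prems show ?case by blast
qed auto

lemma sem_betaeta:
  assumes "betaeta\<^sup>*\<^sup>* M N" "M \<in> terms" "\<And>v. filt (\<rho> v)"
  shows "sem g0 \<rho> M \<subseteq> sem g0 \<rho> N"
  using assms(1)
proof (induction rule: rtranclp_induct)
  case (step N N')
  have "par g0 N N'" using step beta_par eta_par by (auto simp: betaeta_def)
  moreover have "ok g0 N"
    using betaeta_rtranclp_terms[OF step(1) assms(2)] by (simp add: terms_iff wf_trm_def)
  ultimately show ?case using sem_par[of g0 N N' \<rho>] assms(3) step by auto
qed auto

text \<open>Subject expansion, available for beta because \<open>sem_beta\<close> is an
  equality.\<close>

lemma sem_beta_expansion: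
  "beta M N \<Longrightarrow> (\<And>v. filt (\<rho> v)) \<Longrightarrow> sem g \<rho> N \<subseteq> sem g \<rho> M"
proof (induction arbitrary: \<rho> rule: beta.induct)
  case (redex M x L N)
  then have N: "N \<in> terms" "lam x L M \<in> terms" by (auto simp: App_terms_iff)
  have "prefix (degree M) L" using N(2) redex by (simp add: lam_terms_iff)
  then have "prefix (deg (case_nat L g) (psub (bind_sub (x, L)) M)) L"
    using deg_psub[of M "case_nat L g" "bind_sub (x, L)" g] redex
    by (simp add: deg_bind deg_lc terms_lc)
  then show ?case
    using redex N sem_beta[of \<rho> g N L "psub (bind_sub (x, L)) M"]
    by (simp add: subst_inst lam_psub terms_lc deg_lc)
next
  case (lam M M' x L)
  have "sem g (\<rho>(v := upset A)) M' \<subseteq> sem g (\<rho>(v := upset A)) M" for v A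
    using lam by (intro lam.IH) auto
  then show ?case using beta_terms[OF lam.hyps(1)] by (simp add: sem_lam) blast
next
  case (appL M M' N)
  then have "sem g \<rho> M' \<subseteq> sem g \<rho> M" "deg g M' = deg g M"
    using beta_terms[OF appL.hyps(1)] by (auto simp: deg_lc terms_lc)
  then show ?case by auto
next
  case (appR N N' M)
  then have "sem g \<rho> N' \<subseteq> sem g \<rho> N" "deg g N' = deg g N"
    using beta_terms[OF appR.hyps(1)] by (auto simp: deg_lc terms_lc)
  then show ?case by auto
qed

section \<open>Lifting\<close>

fun lift_atom :: "nat \<Rightarrow> atom \<Rightarrow> atom" where
  "lift_atom i (Inl (x, L)) = Inl (x, i # L)"
| "lift_atom i (Inr n) = Inr n"

lemma deg_lift: "deg ((#) i \<circ> g) (lift i M) = i # deg g M"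
proof (induction M arbitrary: g)
  case (Abs L M)
  have "case_nat (i # L) ((#) i \<circ> g) = (#) i \<circ> case_nat L g"
    by (auto simp: fun_eq_iff split: nat.splits)
  with Abs show ?case by (simp only: lift.simps deg.simps)
qed auto

lemma lc_at_lift [simp]: "lc_at k (lift i M) = lc_at k M"
  by (induction M arbitrary: k) auto

lemma fv_lift: "fv (lift i M) = apsnd ((#) i) ` fv M"
  by (induction M) auto

lemma degree_lift: "lc_at 0 M \<Longrightarrow> degree (lift i M) = i # degree M"
  using deg_lift[of i g0 M] deg_lc[of "lift i M" "(#) i \<circ> g0"] degree_deg[of M] by (simp only: lc_at_lift)

lemma lift_inject [simp]: "lift i M = lift i N \<longleftrightarrow> M = N"
proof (induction M arbitrary: N)
  case (FVar x L) then show ?case by (cases N) auto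
next
  case (BVar n) then show ?case by (cases N) auto
next
  case (App M1 M2) then show ?case by (cases N) auto
next
  case (Abs L M) then show ?case by (cases N) auto
qed

lemma joinable_lift [simp]: "joinable (lift i M) (lift i N) = joinable M N"
proof -
  have "(x, K) \<in> apsnd ((#) i) ` A \<longleftrightarrow> (\<exists>L. K = i # L \<and> (x, L) \<in> A)" for x K A
    by force
  note * = this
  show ?thesis unfolding joinable_def joinable_sets_def fv_lift * by auto
qed

lemma lift_terms: "M \<in> terms \<Longrightarrow> lift i M \<in> terms"
  by (induction rule: terms.induct)
    (auto simp: lift_lam degree_lift terms_lc intro!: terms.intros)

text \<open>Arguments have degrees above that of the function and binders have indexes above the
  degree of the body. Hence every index in \<open>M\<close> begins with \<open>i\<close>, which can
  be removed throughout.\<close>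

lemma unlift: "M \<in> terms \<Longrightarrow> degree M = i # K \<Longrightarrow> \<exists>M0\<in>terms. M = lift i M0 \<and> degree M0 = K"
proof (induction arbitrary: K rule: terms.induct)
  case (FVar x L)
  then show ?case
    by (intro bexI[of _ "FVar x K"]) (auto simp: degree_deg intro: terms.FVar)
next
  case (App M N)
  then obtain J where J: "degree N = i # K @ J" "degree M = i # K"
    by (auto simp: degree_deg elim!: prefixE)
  obtain M0 where M0: "M0 \<in> terms" "M = lift i M0" "degree M0 = K"
    using App.IH(1)[OF J(2)] by blast
  obtain N0 where N0: "N0 \<in> terms" "N = lift i N0" "degree N0 = K @ J"
    using App.IH(2)[OF J(1)] by blast
  have "App M0 N0 \<in> terms"
    using M0 N0 \<open>joinable M N\<close> by (simp add: App_terms_iff)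
  moreover have "degree (App M0 N0) = K"
    using M0(3) by (simp add: degree_deg)
  ultimately show ?case using M0(2) N0(2) by (intro bexI[of _ "App M0 N0"]) auto
next
  case (lam M L x)
  have d: "degree M = i # K" using lam.prems lam.hyps by (simp add: degree_lam)
  obtain M0 where M0: "M0 \<in> terms" "M = lift i M0" "degree M0 = K"
    using lam.IH[OF d] by blast
  obtain J where J: "L = i # K @ J" using lam.hyps(2) d by (auto elim: prefixE)
  have "lam x (K @ J) M0 \<in> terms" "degree (lam x (K @ J) M0) = K"
    using M0 by (auto simp: degree_lam intro!: terms.lam)
  then show ?case using M0(2) J by (intro bexI[of _ "lam x (K @ J) M0"]) (auto simp: lift_lam)
qed

text \<open>The degree equations in \<open>sem\<close> gain the same first entry on both sides, so
  lifting shows only in the variables looked up.\<close>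

lemma sem_lift_gen: "sem ((#) i \<circ> g) \<rho> (lift i M) = sem g (\<rho> \<circ> lift_atom i) M"
proof (induction M arbitrary: g \<rho>)
  case (App M N)
  then show ?case by (simp add: deg_lift del: o_apply)
next
  case (Abs L M)
  have g: "case_nat (i # L) ((#) i \<circ> g) = (#) i \<circ> case_nat L g"
    by (auto simp: fun_eq_iff split: nat.splits)
  have \<rho>: "push F \<rho> \<circ> lift_atom i = push F (\<rho> \<circ> lift_atom i)" for F
  proof
    fix v show "(push F \<rho> \<circ> lift_atom i) v = push F (\<rho> \<circ> lift_atom i) v"
      by (cases "(F, \<rho>, v)" rule: push.cases) auto
  qed
  show ?case by (simp only: lift.simps sem.simps g Abs.IH \<rho> deg_lift append_Cons list.inject simp_thms)
qed auto

lemma sem_lift: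
  assumes "lc_at 0 M" shows "sem g0 \<rho> (lift i M) = sem g0 (\<rho> \<circ> lift_atom i) M"
proof -
  have "sem g0 \<rho> (lift i M) = sem ((#) i \<circ> g0) \<rho> (lift i M)"
    using assms lc_at_lift[of 0 i M] by (intro sem_cong) (auto simp only: lc_at_fa)
  then show ?thesis by (simp only: sem_lift_gen)
qed

section \<open>From the filter model to typings\<close>

lemma is_env_iff: "is_env \<Gamma> \<longleftrightarrow> finite (dom \<Gamma>) \<and> (\<forall>v U. \<Gamma> v = Some U \<longrightarrow> U \<in> U_types)"
  by (auto simp: is_env_def ran_def)

lemma env_sub_pointwise:
  assumes "is_env \<Gamma>" "is_env \<Delta>" "dom \<Gamma> = dom \<Delta>"
    and sub: "\<And>v U V. \<Gamma> v = Some U \<Longrightarrow> \<Delta> v = Some V \<Longrightarrow> sub U V"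
  shows "env_sub \<Gamma> \<Delta>"
proof -
  \<comment> \<open>The environment already switched to \<open>\<Delta>\<close> on \<open>A\<close>
    and still equal to \<open>\<Gamma>\<close> elsewhere; \<open>env_sub.decl\<close> changes a
    single declaration, so \<open>A\<close> grows by one variable at a time.\<close>
  let ?\<Theta> = "\<lambda>A v. if v \<in> A then \<Delta> v else \<Gamma> v"
  have "env_sub \<Gamma> (?\<Theta> A)" if "finite A" "A \<subseteq> dom \<Gamma>" for A
    using that
  proof (induction rule: finite_induct)
    case empty
    then show ?case using assms(1) by (simp add: env_sub.refl)
  next
    case (insert v A)
    obtain y L where v: "v = (y, L)" by fastforce
    obtain U V where UV: "\<Gamma> v = Some U" "\<Delta> v = Some V"
      using insert.prems assms(3) by blast
    let ?\<Theta>' = "(?\<Theta> A)(v := None)"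
    have "is_env ?\<Theta>'"
    proof -
      have "dom ?\<Theta>' \<subseteq> dom \<Gamma>" using assms(3) by (auto split: if_splits)
      then show ?thesis
        using assms(1,2) unfolding is_env_iff by (auto dest: finite_subset split: if_splits)
    qed
    then have "env_sub (?\<Theta>'(v \<mapsto> U)) (?\<Theta>'(v \<mapsto> V))"
      unfolding v using sub UV v by (intro env_sub.decl) auto
    moreover have "?\<Theta>'(v \<mapsto> U) = ?\<Theta> A" "?\<Theta>'(v \<mapsto> V) = ?\<Theta> (insert v A)"
      using UV insert.hyps(2) by auto
    ultimately show ?case using insert by (metis (no_types, lifting) env_sub.trans insert_subset)
  qed
  moreover have "?\<Theta> (dom \<Gamma>) = \<Delta>"
  proof
    fix v show "?\<Theta> (dom \<Gamma>) v = \<Delta> v"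
      by (cases "v \<in> dom \<Gamma>") (use assms(3) domIff in \<open>metis\<close>)+
  qed
  ultimately show ?thesis using assms(1) by (metis is_env_def order_refl)
qed

lemma typing_weaken:
  assumes "typing M \<Gamma> U" "env_sub \<Delta> \<Gamma>" "sub U V" shows "typing M \<Delta> V"
  using assms by (meson typing.sub typing_sub.mono)

text \<open>The shape that every derivable typing of \<open>M\<close> imposes on its environment, by
  \<open>typing_wf\<close>.\<close>

definition env_for :: "env \<Rightarrow> trm \<Rightarrow> bool" where
  "env_for \<Gamma> M \<longleftrightarrow> dom \<Gamma> = fv M
    \<and> (\<forall>x L U. \<Gamma> (x, L) = Some U \<longrightarrow> U \<in> U_types \<and> tdegree U = L)"

lemma env_for_is_env: "env_for \<Gamma> M \<Longrightarrow> is_env \<Gamma>"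
  by (auto simp: env_for_def is_env_iff)

definition env_val :: "env \<Rightarrow> atom \<Rightarrow> ty set" where
  "env_val \<Gamma> v = (case v of
      Inl c \<Rightarrow> (case \<Gamma> c of None \<Rightarrow> {} | Some U \<Rightarrow> upset (tys U))
    | Inr n \<Rightarrow> {})"

lemma filt_empty [simp]: "filt {}"
  by (simp add: filt_def upset_def)

lemma env_val_filt: "filt (env_val \<Gamma> v)"
  by (auto simp: env_val_def split: sum.splits option.splits)

lemma sem_terms_cong:
  assumes "M \<in> terms" "\<And>c. c \<in> fv M \<Longrightarrow> \<rho> (Inl c) = \<rho>' (Inl c)"
  shows "sem g0 \<rho> M = sem g0 \<rho>' M"
proof (rule sem_cong)
  fix v assume "v \<in> fa M"
  then show "\<rho> v = \<rho>' v"
    using assms terms_lc[OF assms(1)] by (cases v) (auto simp: fv_fa lc_at_fa)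
qed auto

lemma env_for_restrict:
  assumes "env_for \<Gamma> M" "fv P \<subseteq> fv M" "P \<in> terms"
  shows "env_for (\<Gamma> |` fv P) P" "sem g0 (env_val (\<Gamma> |` fv P)) P = sem g0 (env_val \<Gamma>) P"
proof -
  have "dom (\<Gamma> |` fv P) = fv P"
    using assms unfolding env_for_def dom_restrict by blast
  then show "env_for (\<Gamma> |` fv P) P"
    using assms by (auto simp: env_for_def restrict_map_def split: if_splits)
  show "sem g0 (env_val (\<Gamma> |` fv P)) P = sem g0 (env_val \<Gamma>) P"
    using assms(3) by (rule sem_terms_cong) (auto simp: env_val_def)
qed

lemma env_sub_omega: "env_for \<Gamma> M \<Longrightarrow> env_sub \<Gamma> (env_omega M)"
proof (rule env_sub_pointwise)
  assume \<Gamma>: "env_for \<Gamma> M"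
  then show "is_env \<Gamma>" by (rule env_for_is_env)
  have dom: "dom (env_omega M) = fv M" by (auto simp: env_omega_def split: if_splits)
  then show "is_env (env_omega M)"
    unfolding is_env_iff by (auto simp: env_omega_def split: if_splits)
  show "dom \<Gamma> = dom (env_omega M)" using \<Gamma> dom by (simp add: env_for_def)
  show "sub U V" if "\<Gamma> v = Some U" "env_omega M v = Some V" for v U V
    using that \<Gamma> by (cases v) (auto simp: env_omega_def env_for_def split: if_splits intro: sub_Omega)
qed

text \<open>Rule \<open>arrE\<close> intersects the environments of function and argument. For two
  restrictions of one environment a shared variable receives \<open>Inter U U\<close>, equal to
  \<open>U\<close> by idempotence.\<close>

lemma env_sub_inter_restrict:
  assumes "env_for \<Gamma> (App P Q)"
  shows "is_env (env_inter (\<Gamma> |` fv P) (\<Gamma> |` fv Q))"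
    "env_sub \<Gamma> (env_inter (\<Gamma> |` fv P) (\<Gamma> |` fv Q))"
proof -
  let ?\<Delta> = "env_inter (\<Gamma> |` fv P) (\<Gamma> |` fv Q)"
  have dom: "dom \<Gamma> = fv P \<union> fv Q" using assms by (simp add: env_for_def)
  have \<Delta>: "?\<Delta> v = (if v \<in> fv P \<and> v \<in> fv Q then map_option (\<lambda>U. Inter U U) (\<Gamma> v) else \<Gamma> v)" for v
    using dom by (auto simp: env_inter_def restrict_map_def split: option.splits)
  have dom': "dom ?\<Delta> = dom \<Gamma>" by (auto simp: \<Delta> split: if_splits)
  show env: "is_env ?\<Delta>"
    using env_for_is_env[OF assms] unfolding is_env_iff dom' by (auto simp: \<Delta> split: if_splits)
  show "env_sub \<Gamma> ?\<Delta>"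
  proof (rule env_sub_pointwise)
    show "sub U V" if "\<Gamma> v = Some U" "?\<Delta> v = Some V" for v U V
    proof -
      have "U \<in> U_types" using that env_for_is_env[OF assms] by (cases v) (auto simp: is_env_iff)
      then show ?thesis using that by (auto simp: \<Delta> split: if_splits intro: sub_Inter_greatest)
    qed
  qed (use env env_for_is_env[OF assms] dom' in auto)
qed

text \<open>Prepares the rule \<open>exp\<close>: each free variable of a lifted term has an index
  beginning with \<open>i\<close>, so by \<open>Exp_canonical\<close> its type can be replaced by
  one with that expansion variable outermost.\<close>

lemma env_unlift:
  assumes "env_for \<Gamma> (lift i M)" "M \<in> terms"
  obtains \<Delta> where "env_for \<Delta> M" "env_sub \<Gamma> (env_exp i \<Delta>)"
    "sem g0 (env_val \<Delta>) M = sem g0 (env_val \<Gamma>) (lift i M)"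
proof -
  define low where "low L V = (SOME W. W \<in> U_types \<and> tdegree W = L \<and> tys W = tys V
    \<and> ty_eq V (Exp i W))" for L V
  have low: "low L V \<in> U_types \<and> tdegree (low L V) = L \<and> tys (low L V) = tys V
      \<and> ty_eq V (Exp i (low L V))" if "V \<in> U_types" "tdegree V = i # L" for L V
    unfolding low_def by (rule someI_ex) (use Exp_canonical[OF that] in blast)
  let ?\<Delta> = "\<lambda>(x, L). map_option (low L) (\<Gamma> (x, i # L))"
  have fv: "(x, i # L) \<in> fv (lift i M) \<longleftrightarrow> (x, L) \<in> fv M" for x L
    unfolding fv_lift by force
  have dom: "dom \<Gamma> = fv (lift i M)" using assms by (simp add: env_for_def)
  have \<Gamma>: "V \<in> U_types \<and> tdegree V = L" if "\<Gamma> (x, L) = Some V" for x L V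
    using that assms by (simp add: env_for_def)
  have "c \<in> dom ?\<Delta> \<longleftrightarrow> c \<in> fv M" for c
    using fv dom by (cases c) (auto simp: domIff)
  then have dom': "dom ?\<Delta> = fv M" by blast
  have 1: "env_for ?\<Delta> M"
    using dom' low \<Gamma> unfolding env_for_def by auto
  have v: "env_exp i ?\<Delta> v = (case v of (x, L) \<Rightarrow> map_option (\<lambda>V. Exp i (low (tl L) V)) (\<Gamma> v))" for v
  proof -
    obtain x L where v: "v = (x, L)" by fastforce
    show ?thesis
    proof (cases "\<exists>K. L = i # K")
      case True
      then show ?thesis by (auto simp: v env_exp_def option.map_comp o_def)
    next
      case False
      then have "(x, L) \<notin> fv (lift i M)" unfolding fv_lift by force
      then have "\<Gamma> (x, L) = None" using dom by blast
      then show ?thesis using False by (auto simp: v env_exp_def split: list.splits)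
    qed
  qed
  have lowv: "sub V (Exp i (low (tl L) V)) \<and> Exp i (low (tl L) V) \<in> U_types"
    if V: "\<Gamma> (x, L) = Some V" for x L V
  proof -
    have "(x, L) \<in> fv (lift i M)" using V dom by blast
    then obtain K where "L = i # K" unfolding fv_lift by auto
    then show ?thesis using low[of V K] \<Gamma>[OF V] by (auto intro: sub.refl)
  qed
  have 2: "env_sub \<Gamma> (env_exp i ?\<Delta>)"
  proof (rule env_sub_pointwise)
    show "is_env \<Gamma>" using assms(1) by (rule env_for_is_env)
    show d: "dom \<Gamma> = dom (env_exp i ?\<Delta>)"
      by (auto simp: v domIff)
    show "is_env (env_exp i ?\<Delta>)"
      using lowv d[symmetric] dom unfolding is_env_iff by (auto simp: v)
    show "sub U V" if "\<Gamma> c = Some U" "env_exp i ?\<Delta> c = Some V" for c U V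
      using that lowv by (cases c) (auto simp: v)
  qed
  have "sem g0 (env_val ?\<Delta>) M = sem g0 (env_val \<Gamma> \<circ> lift_atom i) M"
    using assms(2)
  proof (rule sem_terms_cong)
    fix c assume "c \<in> fv M"
    obtain x L where c: "c = (x, L)" by fastforce
    show "env_val ?\<Delta> (Inl c) = (env_val \<Gamma> \<circ> lift_atom i) (Inl c)"
      using low[of _ L] \<Gamma>[of x "i # L"] by (auto simp: c env_val_def split: option.splits)
  qed
  then have 3: "sem g0 (env_val ?\<Delta>) M = sem g0 (env_val \<Gamma>) (lift i M)"
    using sem_lift[OF terms_lc[OF assms(2)]] by simp
  from that[OF 1 2 3] show ?thesis .
qed

lemma size_lift [simp]: "size (lift i M) = size M"
  by (induction M) auto

text \<open>At the empty degree the clauses of \<open>sem\<close> are the premises of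
  \<open>ax\<close>, \<open>arrE\<close> and the abstraction rules; the environment only has to be
  cut down to the free variables of each subterm.\<close>

lemma typing_T_of_sem:
  assumes IH: "\<And>P \<Delta> V. size P < size M \<Longrightarrow> P \<in> terms \<Longrightarrow> env_for \<Delta> P \<Longrightarrow> V \<in> U_types
      \<Longrightarrow> tdegree V = degree P \<Longrightarrow> tys V \<subseteq> sem g0 (env_val \<Delta>) P \<Longrightarrow> typing P \<Delta> V"
    and M: "M \<in> terms" "env_for \<Gamma> M" "T \<in> T_types" "degree M = []" "T \<in> sem g0 (env_val \<Gamma>) M"
  shows "typing M \<Gamma> T"
proof (cases M)
  case (FVar x L)
  then have L: "L = []" using M by (simp add: degree_deg)
  obtain U where U: "\<Gamma> (x, L) = Some U" "T \<in> upset (tys U)" "dom \<Gamma> = {(x, L)}"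
    "U \<in> U_types" "tdegree U = L"
    using M FVar by (auto simp: env_val_def env_for_def split: option.splits)
  obtain S where S: "S \<in> tys U" "sub S T" using U(2) by (auto simp: upset_def)
  then have ST: "S \<in> T_types" using tys_T_types U by blast
  have "env_sub \<Gamma> [(x, []) \<mapsto> S]"
  proof (rule env_sub_pointwise)
    show "sub W V" if "\<Gamma> v = Some W" "[(x, []) \<mapsto> S] v = Some V" for v W V
      using that U S L sub_component by (auto split: if_splits)
  qed (use U L ST env_for_is_env[OF M(2)] in \<open>auto simp: is_env_iff T_types_U\<close>)
  then show ?thesis
    using typing_weaken[OF typing.ax[OF ST]] S(2) FVar L by blast
next
  case (BVar n)
  then show ?thesis using M terms_lc by fastforce
next
  case (App P Q)
  then have t: "P \<in> terms" "Q \<in> terms" "joinable P Q" "degree P = []"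
    using M by (auto simp: App_terms_iff) (simp add: degree_deg)
  obtain U where U: "Arr U T \<in> sem g0 (env_val \<Gamma>) P" "degree Q = tdegree U"
    "tys U \<subseteq> sem g0 (env_val \<Gamma>) Q"
    using M(5) App t(4) by (auto simp: degree_deg)
  have "Arr U T \<in> T_types"
    using sem_filt[of "env_val \<Gamma>" g0 P] env_val_filt U(1) by (auto simp: filt_def)
  then have UT: "Arr U T \<in> U_types" "U \<in> U_types" by auto
  have fv: "fv P \<subseteq> fv M" "fv Q \<subseteq> fv M" using App by auto
  note r = env_for_restrict[OF M(2) fv(1) t(1)] env_for_restrict[OF M(2) fv(2) t(2)]
  have "typing P (\<Gamma> |` fv P) (Arr U T)"
    using App t UT U r by (intro IH) auto
  moreover have "typing Q (\<Gamma> |` fv Q) U"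
    using App t UT U r by (intro IH) auto
  moreover have "env_joinable (\<Gamma> |` fv P) (\<Gamma> |` fv Q)"
    using t(3) by (auto simp: env_joinable_def joinable_def elim!: joinable_sets_mono)
  moreover note env_sub_inter_restrict[OF M(2)[unfolded App]]
  ultimately show ?thesis
    using typing_weaken[OF typing.arrE] M(1,3) App T_types_U sub_refl by metis
next
  case (Abs L B)
  obtain x P where P: "M = lam x L P" "P \<in> terms" "size P < size M" "\<And>K. (x, K) \<notin> fv B"
    using terms_AbsE[of L B "{}"] M(1) Abs by (metis finite.emptyI lessI trm.size(8) add.right_neutral add_Suc_right)
  have x: "(x, L) \<notin> dom \<Gamma>"
    using M(2) P(1) by (auto simp: env_for_def fv_lam)
  have dP: "degree P = []" using M(4) P by (simp add: degree_lam)
  obtain U T' where T: "T = Arr U T'" "U \<in> U_types" "T' \<in> T_types" "tdegree U = L"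
    "T' \<in> sem g0 ((env_val \<Gamma>)(Inl (x, L) := upset (tys U))) P"
    using M(5) P dP by (auto simp: sem_lam)
  have \<Gamma>: "is_env \<Gamma>" using M(2) by (rule env_for_is_env)
  show ?thesis
  proof (cases "(x, L) \<in> fv P")
    case True
    have "env_for (\<Gamma>((x, L) \<mapsto> U)) P"
      using M(2) True T P by (auto simp: env_for_def fv_lam split: if_splits)
    moreover have "sem g0 (env_val (\<Gamma>((x, L) \<mapsto> U))) P
        = sem g0 ((env_val \<Gamma>)(Inl (x, L) := upset (tys U))) P"
      using P(2) by (rule sem_terms_cong) (auto simp: env_val_def)
    ultimately have "typing P (\<Gamma>((x, L) \<mapsto> U)) T'"
      using P T dP by (intro IH) (auto simp: T_types_simps T_types_U)
    then show ?thesis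
      using x T P M(1) by (auto intro: typing.arrI)
  next
    case False
    then have "env_for \<Gamma> P" using M(2) P by (auto simp: env_for_def fv_lam)
    moreover have "sem g0 (env_val \<Gamma>) P = sem g0 ((env_val \<Gamma>)(Inl (x, L) := upset (tys U))) P"
      using P(2) by (rule sem_terms_cong) (use False in auto)
    ultimately have "typing P \<Gamma> T'"
      using P T dP by (intro IH) (auto simp: T_types_simps T_types_U)
    \<comment> \<open>The bound variable does not occur, so \<open>arrI'\<close> gives the largest
      domain of its degree; contravariance then yields the domain \<open>U\<close>.\<close>
    then have "typing M \<Gamma> (Arr (Omega L) T')"
      using x T P M(1) by (auto intro: typing.arrI')
    moreover have "sub (Arr (Omega L) T') T"
      using T by (auto intro!: sub.Arr sub_Omega sub_refl T_types_U)
    ultimately show ?thesis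
      using typing_weaken env_sub.refl[OF \<Gamma>] by blast
  qed
qed

text \<open>Inside the induction on size runs an induction on the type, over all terms of the given
  size: the case \<open>Exp\<close> passes from \<open>lift i M0\<close> to \<open>M0\<close>, which
  is no smaller.\<close>

theorem typing_of_sem:
  "M \<in> terms \<Longrightarrow> env_for \<Gamma> M \<Longrightarrow> U \<in> U_types \<Longrightarrow> tdegree U = degree M
    \<Longrightarrow> tys U \<subseteq> sem g0 (env_val \<Gamma>) M \<Longrightarrow> typing M \<Gamma> U"
proof (induction "size M" arbitrary: M \<Gamma> U rule: less_induct)
  case less
  have T: "typing M' \<Delta> T" if M': "size M' = size M" "M' \<in> terms" "env_for \<Delta> M'" "T \<in> T_types"
      "degree M' = []" "T \<in> sem g0 (env_val \<Delta>) M'" for M' \<Delta> T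
  proof (rule typing_T_of_sem[OF _ M'(2-6)])
    fix P \<Theta> V
    assume "size P < size M'" and P: "P \<in> terms" "env_for \<Theta> P" "V \<in> U_types"
      "tdegree V = degree P" "tys V \<subseteq> sem g0 (env_val \<Theta>) P"
    then have "size P < size M" using M'(1) by simp
    then show "typing P \<Theta> V" using P by (rule less.hyps)
  qed
  have "typing M' \<Delta> V" if "size M' = size M" "M' \<in> terms" "env_for \<Delta> M'" "V \<in> U_types"
      "tdegree V = degree M'" "tys V \<subseteq> sem g0 (env_val \<Delta>) M'" for M' \<Delta> V
    using that
  proof (induction V arbitrary: M' \<Delta>)
    case (Atom a)
    then show ?case by (intro T) auto
  next
    case (Arr V T)
    then show ?case by (intro T) auto
  next
    case (Omega L)
    then show ?case
      by (auto intro!: typing_weaken[OF typing.omega] env_sub_omega)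
  next
    case (Inter V1 V2)
    then show ?case by (intro typing.interI) auto
  next
    case (Exp i V)
    then obtain M0 where M0: "M0 \<in> terms" "M' = lift i M0" "degree M0 = tdegree V"
      using unlift[of M' i "tdegree V"] by auto
    obtain \<Theta> where \<Theta>: "env_for \<Theta> M0" "env_sub \<Delta> (env_exp i \<Theta>)"
      "sem g0 (env_val \<Theta>) M0 = sem g0 (env_val \<Delta>) M'"
      using env_unlift Exp.prems(3) M0 by metis
    have "typing M0 \<Theta> V"
      using Exp.prems M0 \<Theta> by (intro Exp.IH) auto
    then have "typing M' (env_exp i \<Theta>) (Exp i V)"
      unfolding M0(2) by (rule typing.exp)
    then show ?case
      using \<Theta>(2) Exp.prems typing_weaken sub_refl by blast
  qed
  with less.prems show ?case by blast
qed

section \<open>Soundness of the realisability semantics\<close>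

lemma env_sub_wf:
  "env_sub \<Gamma> \<Delta> \<Longrightarrow> dom \<Gamma> = dom \<Delta> \<and> (\<forall>v U. \<Gamma> v = Some U \<longrightarrow> (\<exists>V. \<Delta> v = Some V \<and> sub U V))"
proof (induction rule: env_sub.induct)
  case (refl \<Gamma>)
  then show ?case by (auto simp: is_env_iff)
next
  case (trans \<Gamma> \<Gamma>' \<Gamma>'')
  then show ?case by (metis sub.trans)
next
  case (decl \<Gamma> y L U1 U2)
  then show ?case by (auto simp: is_env_iff)
qed

lemma typing_sub_wf:
  "typing_sub \<Gamma> U \<Delta> V \<Longrightarrow> sub U V \<and> dom \<Delta> = dom \<Gamma>
    \<and> (\<forall>v W. \<Delta> v = Some W \<longrightarrow> (\<exists>W'. \<Gamma> v = Some W' \<and> sub W W'))"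
proof (induction rule: typing_sub.induct)
  case (refl \<Gamma> U)
  then show ?case by (auto simp: is_env_iff)
next
  case (trans \<Gamma> U \<Gamma>' U' \<Gamma>'' U'')
  then show ?case by (metis sub.trans)
next
  case (mono U1 U2 \<Gamma>2 \<Gamma>1)
  then show ?case using env_sub_wf by blast
qed

lemma dom_env_inter: "dom (env_inter \<Gamma> \<Delta>) = dom \<Gamma> \<union> dom \<Delta>"
  by (auto simp: env_inter_def split: option.splits)

lemma env_inter_Some:
  "env_inter \<Gamma> \<Delta> v = Some W \<Longrightarrow> (\<Gamma> v = Some W \<and> \<Delta> v = None) \<or> (\<Gamma> v = None \<and> \<Delta> v = Some W)
    \<or> (\<exists>U V. \<Gamma> v = Some U \<and> \<Delta> v = Some V \<and> W = Inter U V)"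
  by (auto simp: env_inter_def split: option.splits)

lemma env_exp_lift [simp]: "env_exp j \<Gamma> (x, j # L) = map_option (Exp j) (\<Gamma> (x, L))"
  by (simp add: env_exp_def)

lemma env_exp_Some:
  "env_exp j \<Gamma> (x, K) = Some W \<Longrightarrow> \<exists>L U. K = j # L \<and> \<Gamma> (x, L) = Some U \<and> W = Exp j U"
  by (auto simp: env_exp_def split: list.splits if_splits)

lemma typing_wf:
  "typing M \<Gamma> U \<Longrightarrow> M \<in> terms \<and> U \<in> U_types \<and> tdegree U = degree M \<and> env_for \<Gamma> M"
proof (induction rule: typing.induct)
  case (ax T x)
  then show ?case
    by (auto simp: env_for_def T_types_simps T_types_U degree_deg terms.FVar split: if_splits)
next
  case (omega M)
  then show ?case by (auto simp: env_for_def env_omega_def split: if_splits)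
next
  case (arrI M \<Gamma> x L U T)
  then have \<Gamma>: "insert (x, L) (dom \<Gamma>) = fv M"
    "\<And>y K V. (\<Gamma>((x, L) \<mapsto> U)) (y, K) = Some V \<Longrightarrow> V \<in> U_types \<and> tdegree V = K"
    unfolding env_for_def by (simp_all del: fun_upd_apply)
  have U: "U \<in> U_types" using \<Gamma>(2)[of x L U] by simp
  have "V \<in> U_types \<and> tdegree V = K" if "\<Gamma> (y, K) = Some V" for y K V
  proof -
    have "(y, K) \<noteq> (x, L)" using that arrI.hyps(2) by auto
    then have "(\<Gamma>((x, L) \<mapsto> U)) (y, K) = Some V" using that by auto
    then show ?thesis by (rule \<Gamma>(2))
  qed
  moreover have "dom \<Gamma> = fv (lam x L M)"
    using \<Gamma>(1) arrI.hyps(2) by (auto simp: fv_lam)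
  ultimately show ?case
    using arrI U by (auto simp: env_for_def degree_lam T_types_simps)
next
  case (arrI' M \<Gamma> T x L)
  then show ?case by (auto simp: env_for_def fv_lam degree_lam T_types_simps)
next
  case (arrE M1 \<Gamma>1 U T M2 \<Gamma>2)
  then have "env_for (env_inter \<Gamma>1 \<Gamma>2) (App M1 M2)"
    by (auto simp: env_for_def dom_env_inter Inter_in_U_types dest!: env_inter_Some)
  with arrE show ?case by (auto simp: T_types_simps T_types_U) (auto simp: degree_deg)
next
  case (exp M \<Gamma> U j)
  have "dom (env_exp j \<Gamma>) = fv (lift j M)"
  proof (intro set_eqI)
    fix v :: ivar
    obtain x K where v: "v = (x, K)" by fastforce
    have "(x, K) \<in> fv (lift j M) \<longleftrightarrow> (\<exists>L. K = j # L \<and> (x, L) \<in> fv M)"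
      unfolding fv_lift by force
    moreover have "(x, K) \<in> dom (env_exp j \<Gamma>) \<longleftrightarrow> (\<exists>L. K = j # L \<and> (x, L) \<in> dom \<Gamma>)"
      using env_exp_Some[of j \<Gamma> x K] by auto
    ultimately show "v \<in> dom (env_exp j \<Gamma>) \<longleftrightarrow> v \<in> fv (lift j M)"
      using exp unfolding v env_for_def by simp
  qed
  with exp show ?case
    by (auto simp: env_for_def lift_terms degree_lift terms_lc dest!: env_exp_Some)
next
  case (sub M \<Gamma> U \<Gamma>' U')
  then have s: "sub U U'" "dom \<Gamma>' = dom \<Gamma>"
    "\<And>v W. \<Gamma>' v = Some W \<Longrightarrow> \<exists>W'. \<Gamma> v = Some W' \<and> sub W W'"
    using typing_sub_wf by blast+
  have "V \<in> U_types \<and> tdegree V = K" if "\<Gamma>' (y, K) = Some V" for y K V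
    using s(3)[OF that] sub.IH sub_wf unfolding env_for_def by metis
  then show ?case using sub.IH sub_wf[OF s(1)] s(2) by (auto simp: env_for_def)
qed (auto simp: Inter_in_U_types)

subsection \<open>Head reduction\<close>

lemma apps_snoc: "apps M (Ns @ [N]) = App (apps M Ns) N"
  by (simp add: apps_def)

lemma head_beta: "head M N \<Longrightarrow> beta M N"
proof (induction rule: head.induct)
  case (redex M x L N Ns)
  from redex(2) show ?case
  proof (induction Ns rule: rev_induct)
    case Nil
    then show ?case using redex by (auto simp: apps_def intro: beta.redex)
  next
    case (snoc P Ns)
    then have "beta (apps (App (lam x L M) N) Ns) (apps (subst M x L N) Ns)"
      by (simp add: apps_snoc App_terms_iff)
    moreover from this have "App (apps (subst M x L N) Ns) P \<in> terms"
      using snoc.prems beta_terms by (auto simp: apps_snoc App_terms_iff intro: joinable_mono)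
    ultimately show ?case using snoc.prems by (auto simp: apps_snoc intro: beta.appL)
  qed
qed

lemma head_App: "head M N \<Longrightarrow> App M P \<in> terms \<Longrightarrow> head (App M P) (App N P)"
proof (induction rule: head.induct)
  case (redex M x L N Ns)
  then show ?case using head.redex[of M x L N "Ns @ [P]"] by (simp add: apps_snoc)
qed

lemma head_redexI:
  assumes "App (Abs L B) N \<in> terms" "degree N = L"
  shows "head (App (Abs L B) N) (psub (inst N) B)"
proof -
  obtain x M where M: "Abs L B = lam x L M" "M \<in> terms" "joinable M N"
    "psub (inst N) B = subst M x L N"
    using named_redexE[OF assms(1)] .
  show ?thesis using head.redex[of M x L N "[]"] M assms by (simp add: apps_def)
qed

lemma neutral_lift:
  "lift i M = apps (FVar x (i # L)) Ns \<Longrightarrow> \<exists>Ns'. M = apps (FVar x L) Ns'"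
proof (induction Ns arbitrary: M rule: rev_induct)
  case Nil
  then show ?case by (cases M) (auto simp: apps_def intro: exI[of _ "[]"])
next
  case (snoc N Ns)
  then obtain P Q where M: "M = App P Q" "lift i P = apps (FVar x (i # L)) Ns"
    by (cases M) (auto simp: apps_snoc)
  then obtain Ns' where "P = apps (FVar x L) Ns'" using snoc.IH by blast
  then show ?case using M by (metis apps_snoc)
qed

lemma degree_apps: "degree (apps M Ns) = degree M"
  by (induction Ns rule: rev_induct) (auto simp: apps_snoc degree_deg, auto simp: apps_def)

subsection \<open>Interpretation of types\<close>

text \<open>The two bounds need each other at arrows: a fresh variable from \<open>V1\<close>
  inhabits the domain, and applying \<open>M\<close> to it shows that \<open>M\<close> has degree
  []; conversely a neutral term stays neutral when applied to an element of the domain.\<close>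

lemma interp_bounds:
  assumes I: "interpretation_of r V1 I" and V1: "infinite V1"
  shows "U \<in> U_types \<Longrightarrow>
    interp I U \<subseteq> terms_of (tdegree U) \<and> (\<forall>x\<in>V1. neutral x (tdegree U) \<subseteq> interp I U)"
proof (induction U)
  case (Atom a)
  then show ?case using I by (auto simp: interpretation_of_def)
next
  case (Arr U T)
  then have U: "interp I U \<subseteq> terms_of (tdegree U)" "\<And>x. x \<in> V1 \<Longrightarrow> neutral x (tdegree U) \<subseteq> interp I U"
    and T: "interp I T \<subseteq> terms_of []" "\<And>x. x \<in> V1 \<Longrightarrow> neutral x [] \<subseteq> interp I T"
    by (auto simp: T_types_simps T_types_U)
  have "interp I (Arr U T) \<subseteq> terms_of []"
  proof
    fix M assume M: "M \<in> interp I (Arr U T)"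
    obtain x where x: "x \<in> V1" "\<And>L. (x, L) \<notin> fv M"
      using fresh_name[OF _ V1, of "fv M"] by auto
    let ?N = "FVar x (tdegree U)"
    have "?N \<in> neutral x (tdegree U)"
      by (auto simp: neutral_def apps_def terms.FVar intro: exI[of _ "[]"])
    then have "?N \<in> interp I U" using U(2) x(1) by blast
    moreover have "joinable M ?N" using x(2) by (auto simp: joinable_def joinable_sets_def)
    ultimately have "App M ?N \<in> terms_of []"
      using M T(1) by (auto simp: fun_space_def)
    then show "M \<in> terms_of []"
      by (auto simp: terms_of_def App_terms_iff) (simp add: degree_deg)
  qed
  moreover have "neutral x [] \<subseteq> interp I (Arr U T)" if x: "x \<in> V1" for x
  proof
    fix M assume "M \<in> neutral x []"
    then obtain Ns where M: "M \<in> terms" "M = apps (FVar x []) Ns" by (auto simp: neutral_def)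
    have d: "degree M = []" using M(2) by (simp add: degree_apps) (simp add: degree_deg)
    have "App M N \<in> interp I T" if "N \<in> interp I U" "joinable M N" for N
    proof -
      have "N \<in> terms" using that U(1) by (auto simp: terms_of_def)
      then have "App M N \<in> terms"
        using M(1) d that(2) by (simp add: App_terms_iff)
      moreover have "App M N = apps (FVar x []) (Ns @ [N])"
        using M(2) by (simp add: apps_snoc)
      ultimately have "App M N \<in> neutral x []" unfolding neutral_def by blast
      then show ?thesis using T(2)[OF x] by blast
    qed
    then show "M \<in> interp I (Arr U T)" using M(1) by (simp add: fun_space_def)
  qed
  ultimately show ?case by simp
next
  case (Omega L)
  have "degree M = L" if "M \<in> neutral x L" for x M
    using that by (auto simp: neutral_def degree_apps) (simp add: degree_deg)
  then show ?case by (auto simp: terms_of_def) (auto simp: neutral_def)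
next
  case (Inter U V)
  then show ?case by auto
next
  case (Exp i U)
  have "interp I (Exp i U) \<subseteq> terms_of (i # tdegree U)"
    using Exp by (auto simp: terms_of_def degree_lift terms_lc lift_terms)
  moreover have "neutral x (i # tdegree U) \<subseteq> interp I (Exp i U)" if "x \<in> V1" for x
  proof
    fix M assume "M \<in> neutral x (i # tdegree U)"
    then obtain Ns where M: "M \<in> terms" "M = apps (FVar x (i # tdegree U)) Ns"
      by (auto simp: neutral_def)
    have "degree M = i # tdegree U" using M(2) by (simp add: degree_apps) (simp add: degree_deg)
    then obtain M0 where M0: "M0 \<in> terms" "M = lift i M0" using unlift M(1) by blast
    have "\<exists>Ns'. M0 = apps (FVar x (tdegree U)) Ns'"
      by (rule neutral_lift[of i _ _ _ Ns]) (simp only: M0(2)[symmetric] M(2))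
    then have "M0 \<in> neutral x (tdegree U)"
      using M0 by (simp add: neutral_def)
    then show "M \<in> interp I (Exp i U)" using Exp that M0(2) by auto
  qed
  ultimately show ?case by simp
qed

lemma lift_terms_of: "lift i ` terms_of K = terms_of (i # K)"
  using unlift by (force simp: terms_of_def lift_terms degree_lift terms_lc)

context
  fixes r V1 I
  assumes I: "interpretation_of r V1 I" and V1: "infinite V1"
begin

lemma interp_terms_of: "U \<in> U_types \<Longrightarrow> interp I U \<subseteq> terms_of (tdegree U)"
  using interp_bounds[OF I V1] by blast

lemma interp_ty_eq: "ty_eq U V \<Longrightarrow> interp I U = interp I V"
proof (induction rule: ty_eq.induct)
  case (Exp_Inter U V i)
  have "inj (lift i)" by (rule injI) simp
  then show ?case by (simp add: image_Int)
next
  case (Omega_Inter U L)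
  then show ?case using interp_terms_of by auto
next
  case (Exp_Omega i K)
  then show ?case by (simp add: lift_terms_of)
qed auto

lemma interp_sub: "sub U V \<Longrightarrow> interp I U \<subseteq> interp I V"
proof (induction rule: sub.induct)
  case (refl U V)
  then show ?case using interp_ty_eq by simp
next
  case (Arr U2 U1 T1 T2)
  then show ?case by (auto simp: fun_space_def)
qed auto

text \<open>At arrows a head step of \<open>M\<close> is again a head step of
  \<open>App M P\<close>. The abstraction rules use codomains in \<open>T_types\<close>
  only.\<close>

lemma interp_head_expansion:
  assumes r: "\<And>M N. head M N \<Longrightarrow> r\<^sup>*\<^sup>* M N"
  shows "T \<in> T_types \<Longrightarrow> head M N \<Longrightarrow> N \<in> interp I T \<Longrightarrow> M \<in> interp I T"
proof (induction T arbitrary: M N)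
  case (Atom a)
  then show ?case
    using I r beta_terms[OF head_beta] unfolding interpretation_of_def saturated_def
    by (metis interp.simps(1))
next
  case (Arr U T)
  have MN: "M \<in> terms" "fv N \<subseteq> fv M" "degree N = degree M"
    using beta_terms[OF head_beta[OF Arr.prems(2)]] by auto
  have "App M P \<in> interp I T" if P: "P \<in> interp I U" "joinable M P" for P
  proof -
    have "joinable N P" using P(2) MN(2) by (auto intro: joinable_mono)
    then have N: "App N P \<in> interp I T" using Arr.prems(3) P(1) by (simp add: fun_space_def)
    then have "App N P \<in> terms"
      using interp_terms_of[of T] Arr.prems(1) T_types_U by (auto simp: terms_of_def)
    then have "App M P \<in> terms" using MN P(2) by (simp add: App_terms_iff)
    then show ?thesis
      using Arr.IH(2)[OF _ head_App[OF Arr.prems(2)] N] Arr.prems(1) by simp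
  qed
  then show ?case using MN by (simp add: fun_space_def)
qed auto

end

text \<open>The conditions under which simultaneous substitution for the variables in
  \<open>A\<close> is defined.\<close>

definition admissible :: "ivar set \<Rightarrow> (atom \<Rightarrow> trm) \<Rightarrow> bool" where
  "admissible A s \<longleftrightarrow> (\<forall>x L. (x, L) \<in> A \<longrightarrow> s (Inl (x, L)) \<in> terms_of L)
    \<and> (\<forall>c\<in>A. \<forall>d\<in>A. joinable (s (Inl c)) (s (Inl d)))"

lemma fa_terms: "M \<in> terms \<Longrightarrow> v \<in> fa M \<Longrightarrow> \<exists>x L. v = Inl (x, L) \<and> (x, L) \<in> fv M"
  using terms_lc[of M] by (cases v) (auto simp: lc_at_fa fv_fa)

lemma admissible_psub:
  assumes M: "M \<in> terms" and s: "admissible (fv M) s"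
  shows "psub s M \<in> terms" "degree (psub s M) = degree M" "fv (psub s M) = (\<Union>c\<in>fv M. fv (s (Inl c)))"
proof -
  have s': "s v \<in> terms \<and> deg g0 (s v) = deg g0 (atm v)" if "v \<in> fa M" for v
    using fa_terms[OF M that] s by (auto simp: admissible_def terms_of_def degree_deg)
  have fa: "fa (psub s M) = (\<Union>c\<in>fv M. fa (s (Inl c)))"
    unfolding fa_psub using fa_terms[OF M] by (auto simp: fv_fa) blast
  then show fv: "fv (psub s M) = (\<Union>c\<in>fv M. fv (s (Inl c)))"
    by (auto simp: fv_fa)
  show "degree (psub s M) = degree M"
    unfolding degree_deg using s' by (intro deg_psub) auto
  have "lc_at 0 (s (Inl c))" if "c \<in> fv M" for c
    using s'[of "Inl c"] that terms_lc by (auto simp: fv_fa)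
  then have "lc_at 0 (psub s M)"
    by (auto simp: lc_at_fa fa)
  moreover have "ok g0 (psub s M)"
    using s' M by (intro ok_psub) (auto simp: terms_iff wf_trm_def)
  moreover have "self_joinable (fv (psub s M))"
    using s unfolding fv admissible_def self_joinable_def joinable_def joinable_sets_def by blast
  ultimately show "psub s M \<in> terms" by (simp add: terms_iff wf_trm_def)
qed

lemma lift_ren: "lift j (ren f M) = ren f (lift j M)"
  by (induction M arbitrary: f) auto

lemma psub_lift:
  "(\<And>v. v \<in> fa M \<Longrightarrow> s (lift_atom j v) = lift j (t v)) \<Longrightarrow> psub s (lift j M) = lift j (psub t M)"
proof (induction M arbitrary: s t)
  case (FVar x L)
  then show ?case using FVar[of "Inl (x, L)"] by simp
next
  case (BVar n)
  then show ?case using BVar[of "Inr n"] by simp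
next
  case (App M N)
  have "psub s (lift j M) = lift j (psub t M)" "psub s (lift j N) = lift j (psub t N)"
    by (intro App.IH; use App.prems in auto)+
  then show ?case by simp
next
  case (Abs L M)
  have "up_sub s (lift_atom j v) = lift j (up_sub t v)" if "v \<in> fa M" for v
  proof (cases v rule: atom_cases)
    case (2 w)
    have "lift_atom j (shift_atom w) = shift_atom (lift_atom j w)" by (cases w) auto
    then show ?thesis using 2 that Abs.prems[of w] by (simp add: up_sub_shift_atom lift_ren)
  qed auto
  then have "psub (up_sub s) (lift j M) = lift j (psub (up_sub t) M)" by (rule Abs.IH)
  then show ?case by simp
qed

lemma psub_lam_inst:
  assumes "M \<in> terms"
  shows "psub (inst Q) (psub (up_sub s) (psub (bind_sub (x, L)) M)) = psub (s(Inl (x, L) := Q)) M"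
  unfolding psub_psub
proof (rule psub_cong)
  fix v assume "v \<in> fa M"
  then obtain y K where "v = Inl (y, K)" using fa_terms[OF assms] by blast
  then show "(psub (inst Q) \<circ> (psub (up_sub s) \<circ> bind_sub (x, L))) v = (s(Inl (x, L) := Q)) v"
    by auto
qed

text \<open>The common core of \<open>arrI\<close> and \<open>arrI'\<close>. Applied to
  \<open>Q\<close>, the substituted abstraction takes one head step to the body under the
  substitution extended by \<open>Q\<close>, and interpretations are closed under head
  expansion.\<close>

lemma psub_lam_fun_space:
  assumes I: "interpretation_of r V1 I" "infinite V1" "\<And>M N. head M N \<Longrightarrow> r\<^sup>*\<^sup>* M N"
    and M: "M \<in> terms" "lam x L M \<in> terms" "degree M = []"
    and UT: "U \<in> U_types" "tdegree U = L" "T \<in> T_types"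
    and s: "admissible (fv (lam x L M)) s"
    and step: "\<And>Q. Q \<in> interp I U \<Longrightarrow> admissible (fv M) (s(Inl (x, L) := Q))
      \<Longrightarrow> psub (s(Inl (x, L) := Q)) M \<in> interp I T"
  shows "psub s (lam x L M) \<in> fun_space (interp I U) (interp I T)"
proof -
  let ?P = "psub s (lam x L M)"
  let ?B = "psub (up_sub s) (psub (bind_sub (x, L)) M)"
  have P: "?P \<in> terms" "degree ?P = []" and fvP: "fv ?P = (\<Union>c\<in>fv (lam x L M). fv (s (Inl c)))"
    using admissible_psub[OF M(2) s] M by (auto simp: degree_lam)
  have PB: "?P = Abs L ?B" using M(1) by (simp add: lam_psub terms_lc)
  have "App ?P Q \<in> interp I T" if Q: "Q \<in> interp I U" "joinable ?P Q" for Q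
  proof -
    have Qt: "Q \<in> terms" "degree Q = L"
      using Q(1) interp_terms_of[OF I(1,2) UT(1)] UT(2) by (auto simp: terms_of_def)
    then have App: "App (Abs L ?B) Q \<in> terms"
      using P Q(2) by (simp add: PB App_terms_iff)
    \<comment> \<open>The free names of these substituted terms are free in \<open>?P\<close>, which
      is joinable with \<open>Q\<close>.\<close>
    have j: "joinable (s (Inl c)) Q" if "c \<in> fv (lam x L M)" for c
      using Q(2) by (rule joinable_mono) (use fvP that in auto)
    have QQ: "joinable Q Q"
      using Qt(1) by (simp add: terms_iff wf_trm_def joinable_def self_joinable_def)
    have "admissible (fv M) (s(Inl (x, L) := Q))"
      using s j QQ Qt joinable_sym[OF j] unfolding admissible_def fv_lam
      by (auto simp: terms_of_def)
    then have "psub (inst Q) ?B \<in> interp I T"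
      using step[OF Q(1)] by (simp only: psub_lam_inst[OF M(1)])
    then show ?thesis unfolding PB
      using interp_head_expansion[OF I(1,2) I(3) UT(3) head_redexI[OF App Qt(2)]] by blast
  qed
  then show ?thesis using P by (simp add: fun_space_def)
qed

text \<open>The relation \<open>r\<close> is a parameter so that one proof serves both head and
  beta-eta interpretations.\<close>

theorem typing_sound:
  assumes I: "interpretation_of r V1 I" "infinite V1" "\<And>M N. head M N \<Longrightarrow> r\<^sup>*\<^sup>* M N"
  shows "typing M \<Gamma> U \<Longrightarrow> admissible (fv M) s \<Longrightarrow> (\<And>c V. \<Gamma> c = Some V \<Longrightarrow> s (Inl c) \<in> interp I V)
    \<Longrightarrow> psub s M \<in> interp I U"
proof (induction arbitrary: s rule: typing.induct)
  case (ax T x)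
  then show ?case by simp
next
  case (omega M)
  then show ?case using admissible_psub[of M s] by (simp add: terms_of_def)
next
  case (arrI M \<Gamma> x L U T)
  note wf = typing_wf[OF arrI.hyps(1)]
  then have U: "U \<in> U_types" "tdegree U = L"
    by (auto simp: env_for_def split: if_splits)
  have d: "degree M = []" using wf arrI.hyps(3) by (simp add: T_types_simps)
  have "psub s (lam x L M) \<in> fun_space (interp I U) (interp I T)"
  proof (rule psub_lam_fun_space[OF I _ arrI.hyps(4) d U arrI.hyps(3) arrI.prems(1)])
    fix Q assume Q: "Q \<in> interp I U" "admissible (fv M) (s(Inl (x, L) := Q))"
    show "psub (s(Inl (x, L) := Q)) M \<in> interp I T"
      using Q(2)
    proof (rule arrI.IH)
      fix c V assume c: "(\<Gamma>((x, L) \<mapsto> U)) c = Some V"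
      show "(s(Inl (x, L) := Q)) (Inl c) \<in> interp I V"
        using c Q(1) arrI.prems(2)[of c V] by (cases "c = (x, L)") auto
    qed
  qed (use wf in auto)
  then show ?case by simp
next
  case (arrI' M \<Gamma> T x L)
  note wf = typing_wf[OF arrI'.hyps(1)]
  have d: "degree M = []" using wf arrI'.hyps(3) by (simp add: T_types_simps)
  have "psub s (lam x L M) \<in> fun_space (interp I (Omega L)) (interp I T)"
  proof (rule psub_lam_fun_space[OF I _ arrI'.hyps(4) d _ _ arrI'.hyps(3) arrI'.prems(1)])
    fix Q assume Q: "Q \<in> interp I (Omega L)" "admissible (fv M) (s(Inl (x, L) := Q))"
    show "psub (s(Inl (x, L) := Q)) M \<in> interp I T"
      using Q(2)
    proof (rule arrI'.IH)
      fix c V assume c: "\<Gamma> c = Some V"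
      then have "c \<noteq> (x, L)" using arrI'.hyps(2) by auto
      then show "(s(Inl (x, L) := Q)) (Inl c) \<in> interp I V"
        using c arrI'.prems(2) by simp
    qed
  qed (use wf in auto)
  then show ?case by simp
next
  case (arrE M1 \<Gamma>1 U T M2 \<Gamma>2)
  have "psub s M1 \<in> interp I (Arr U T)"
  proof (rule arrE.IH(1))
    show "admissible (fv M1) s" using arrE.prems(1) by (auto simp: admissible_def)
    fix c V assume c: "\<Gamma>1 c = Some V"
    then obtain W where W: "env_inter \<Gamma>1 \<Gamma>2 c = Some W" "W = V \<or> (\<exists>V'. W = Inter V V')"
      by (cases "\<Gamma>2 c") (auto simp: env_inter_def)
    then show "s (Inl c) \<in> interp I V" using arrE.prems(2)[OF W(1)] by auto
  qed
  moreover have "psub s M2 \<in> interp I U"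
  proof (rule arrE.IH(2))
    show "admissible (fv M2) s" using arrE.prems(1) by (auto simp: admissible_def)
    fix c V assume c: "\<Gamma>2 c = Some V"
    then obtain W where W: "env_inter \<Gamma>1 \<Gamma>2 c = Some W" "W = V \<or> (\<exists>V'. W = Inter V' V)"
      by (cases "\<Gamma>1 c") (auto simp: env_inter_def)
    then show "s (Inl c) \<in> interp I V" using arrE.prems(2)[OF W(1)] by auto
  qed
  moreover have "App (psub s M1) (psub s M2) \<in> terms"
    using admissible_psub(1)[OF arrE.hyps(4) arrE.prems(1)] by simp
  ultimately show ?case by (auto simp: fun_space_def App_terms_iff)
next
  case (interI M \<Gamma> U1 U2)
  then show ?case by simp
next
  case (exp M \<Gamma> U j)
  note wf = typing_wf[OF exp.hyps]
  have fv: "(x, j # L) \<in> fv (lift j M) \<longleftrightarrow> (x, L) \<in> fv M" for x L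
    unfolding fv_lift by force
  \<comment> \<open>A variable of \<open>lift j M\<close> is declared with a type expanded by
    \<open>j\<close>, so the term substituted for it is a lift. The terms below these lifts form the
    substitution \<open>t0\<close> to which the induction hypothesis is applied.\<close>
  have "\<exists>N. s (Inl (x, j # L)) = lift j N \<and> (\<forall>V. \<Gamma> (x, L) = Some V \<longrightarrow> N \<in> interp I V)
      \<and> N \<in> terms_of L" if xL: "(x, L) \<in> fv M" for x L
  proof -
    have "(x, L) \<in> dom \<Gamma>" using wf xL by (simp add: env_for_def)
    then obtain V where V: "\<Gamma> (x, L) = Some V" by blast
    then have "s (Inl (x, j # L)) \<in> interp I (Exp j V)" by (intro exp.prems(2)) simp
    then obtain N where N: "s (Inl (x, j # L)) = lift j N" "N \<in> interp I V" by auto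
    have "V \<in> U_types" "tdegree V = L" using wf V by (auto simp: env_for_def)
    then have "N \<in> terms_of L" using N interp_terms_of[OF I(1,2)] by blast
    with N V show ?thesis by auto
  qed
  then have "\<forall>c\<in>fv M. \<exists>N. s (Inl (fst c, j # snd c)) = lift j N
      \<and> (\<forall>V. \<Gamma> c = Some V \<longrightarrow> N \<in> interp I V) \<and> N \<in> terms_of (snd c)"
    by auto
  then obtain t0 where t0: "\<forall>c\<in>fv M. s (Inl (fst c, j # snd c)) = lift j (t0 c)
      \<and> (\<forall>V. \<Gamma> c = Some V \<longrightarrow> t0 c \<in> interp I V) \<and> t0 c \<in> terms_of (snd c)"
    by (rule bchoice[THEN exE])
  have t: "s (Inl (x, j # L)) = lift j (t0 (x, L))
      \<and> (\<forall>V. \<Gamma> (x, L) = Some V \<longrightarrow> t0 (x, L) \<in> interp I V) \<and> t0 (x, L) \<in> terms_of L"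
    if "(x, L) \<in> fv M" for x L
    using bspec[OF t0 that] by simp
  let ?t = "case_sum t0 BVar"
  have "admissible (fv M) ?t"
    unfolding admissible_def
  proof (intro conjI ballI allI impI)
    show "?t (Inl (x, L)) \<in> terms_of L" if "(x, L) \<in> fv M" for x L
      using t[OF that] by simp
    fix c d assume cd: "c \<in> fv M" "d \<in> fv M"
    obtain x L y K where c: "c = (x, L)" and d: "d = (y, K)" by fastforce
    have "joinable (s (Inl (x, j # L))) (s (Inl (y, j # K)))"
      using exp.prems(1) cd fv unfolding admissible_def c d by blast
    then show "joinable (?t (Inl c)) (?t (Inl d))"
      using t cd by (simp add: c d)
  qed
  moreover have "?t (Inl c) \<in> interp I V" if "\<Gamma> c = Some V" for c V
  proof -
    have "c \<in> fv M" using that wf by (auto simp: env_for_def)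
    then show ?thesis using t that by (cases c) auto
  qed
  ultimately have "psub ?t M \<in> interp I U" by (rule exp.IH)
  moreover have "psub s (lift j M) = lift j (psub ?t M)"
  proof (rule psub_lift)
    fix v assume "v \<in> fa M"
    then obtain x L where "v = Inl (x, L)" "(x, L) \<in> fv M" using fa_terms wf by blast
    then show "s (lift_atom j v) = lift j (?t v)" using t by simp
  qed
  ultimately show ?case by simp
next
  case (sub M \<Gamma> U \<Gamma>' U')
  then have s: "sub U U'" "dom \<Gamma>' = dom \<Gamma>"
    "\<And>v W. \<Gamma>' v = Some W \<Longrightarrow> \<exists>W'. \<Gamma> v = Some W' \<and> sub W W'"
    using typing_sub_wf by blast+
  have "psub s M \<in> interp I U"
  proof (rule sub.IH[OF sub.prems(1)])
    fix c V assume V: "\<Gamma> c = Some V"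
    then obtain W where W: "\<Gamma>' c = Some W" using s(2) by blast
    then have "sub W V" using s(3)[OF W] V by auto
    then show "s (Inl c) \<in> interp I V"
      using sub.prems(2)[OF W] interp_sub[OF I(1,2)] by blast
  qed
  then show ?case using interp_sub[OF I(1,2) s(1)] by blast
qed

corollary closed_typing_sound:
  assumes "interpretation_of r V1 I" "infinite V1" "\<And>M N. head M N \<Longrightarrow> r\<^sup>*\<^sup>* M N"
    and "typing M Map.empty U"
  shows "M \<in> interp I U"
proof -
  have "fv M = {}" using typing_wf[OF assms(4)] by (simp add: env_for_def)
  then have "psub atm M \<in> interp I U"
    by (intro typing_sound[OF assms]) (auto simp: admissible_def)
  then show ?thesis by simp
qed

section \<open>Lifting and reduction\<close>

lemma subst_lift: "lift i (subst M x L N) = subst (lift i M) x (i # L) (lift i N)"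
  by (induction M) auto

lemma lift_terms_iff_var: "(x, i # L) \<in> fv (lift i M) \<longleftrightarrow> (x, L) \<in> fv M"
  unfolding fv_lift by force

lemma beta_lift: "beta M N \<Longrightarrow> beta (lift i M) (lift i N)"
proof (induction rule: beta.induct)
  case (redex M x L N)
  then have "N \<in> terms" by (simp add: App_terms_iff)
  then show ?case
    using redex lift_terms[OF redex(1), of i] lift_terms[OF redex(2), of i]
    by (auto simp: lift_lam subst_lift degree_lift terms_lc intro!: beta.redex)
next
  case (lam M M' x L)
  then show ?case
    using lift_terms[OF lam.hyps(2), of i] lift_terms[OF lam.hyps(3), of i]
    by (auto simp: lift_lam intro!: beta.lam)
next
  case (appL M M' N)
  then show ?case
    using lift_terms[OF appL.hyps(2), of i] lift_terms[OF appL.hyps(3), of i]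
    by (auto intro!: beta.appL)
next
  case (appR N N' M)
  then show ?case
    using lift_terms[OF appR.hyps(2), of i] lift_terms[OF appR.hyps(3), of i]
    by (auto intro!: beta.appR)
qed

lemma eta_lift: "eta M N \<Longrightarrow> eta (lift i M) (lift i N)"
proof (induction rule: eta.induct)
  case (redex M x L)
  then show ?case
    using lift_terms[OF redex(1), of i]
    by (auto simp: lift_lam lift_terms_iff_var intro!: eta.redex)
next
  case (lam M M' x L)
  then show ?case
    using lift_terms[OF lam.hyps(2), of i] lift_terms[OF lam.hyps(3), of i]
    by (auto simp: lift_lam intro!: eta.lam)
next
  case (appL M M' N)
  then show ?case
    using lift_terms[OF appL.hyps(2), of i] lift_terms[OF appL.hyps(3), of i]
    by (auto intro!: eta.appL)
next
  case (appR N N' M)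
  then show ?case
    using lift_terms[OF appR.hyps(2), of i] lift_terms[OF appR.hyps(3), of i]
    by (auto intro!: eta.appR)
qed

lemma betaeta_lift: "betaeta\<^sup>*\<^sup>* M N \<Longrightarrow> betaeta\<^sup>*\<^sup>* (lift i M) (lift i N)"
proof (induction rule: rtranclp_induct)
  case (step N N')
  then have "betaeta (lift i N) (lift i N')"
    using beta_lift eta_lift by (auto simp: betaeta_def)
  with step show ?case by simp
qed simp

text \<open>A left inverse of every \<open>lift i\<close>. As it is total on raw terms, it can be
  pushed through parallel reduction without knowing that the terms involved are lifts.\<close>

primrec lower :: "trm \<Rightarrow> trm" where
  "lower (FVar x L) = FVar x (tl L)"
| "lower (BVar n) = BVar n"
| "lower (App M N) = App (lower M) (lower N)"
| "lower (Abs L M) = Abs (tl L) (lower M)"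

lemma lower_lift [simp]: "lower (lift i M) = M"
  by (induction M) auto

lemma lower_ren: "lower (ren f M) = ren f (lower M)"
  by (induction M arbitrary: f) auto

fun lower_atom :: "atom \<Rightarrow> atom" where
  "lower_atom (Inl (x, L)) = Inl (x, tl L)"
| "lower_atom (Inr n) = Inr n"

lemma lower_psub:
  "(\<And>v. lower (s v) = t (lower_atom v)) \<Longrightarrow> lower (psub s M) = psub t (lower M)"
proof (induction M arbitrary: s t)
  case (FVar x L)
  then show ?case using FVar[of "Inl (x, L)"] by simp
next
  case (BVar n)
  then show ?case using BVar[of "Inr n"] by simp
next
  case (App M N)
  have "lower (psub s M) = psub t (lower M)" "lower (psub s N) = psub t (lower N)"
    by (intro App.IH App.prems)+
  then show ?case by simp
next
  case (Abs L M)
  have "lower (up_sub s v) = up_sub t (lower_atom v)" for v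
  proof (cases v rule: atom_cases)
    case (2 w)
    have "lower_atom (shift_atom w) = shift_atom (lower_atom w)" by (cases w) auto
    then show ?thesis using 2 Abs.prems[of w] by (simp add: up_sub_shift_atom lower_ren)
  qed auto
  then have "lower (psub (up_sub s) M) = psub (up_sub t) (lower M)" by (rule Abs.IH)
  then show ?case by simp
qed

lemma lower_inst: "lower (psub (inst N) M) = psub (inst (lower N)) (lower M)"
proof (rule lower_psub)
  fix v show "lower (inst N v) = inst (lower N) (lower_atom v)"
    by (cases "(N, v)" rule: inst.cases) auto
qed

lemma deg_lower: "deg (tl \<circ> g) (lower M) = tl (deg g M)"
proof (induction M arbitrary: g)
  case (Abs L M)
  have "case_nat (tl L) (tl \<circ> g) = tl \<circ> case_nat L g"
    by (auto simp: fun_eq_iff split: nat.splits)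
  with Abs show ?case by (simp only: lower.simps deg.simps)
qed auto

text \<open>Equal degrees have equal tails, so the degree premise of the beta rule survives.\<close>

lemma par_lower: "par g M N \<Longrightarrow> par (tl \<circ> g) (lower M) (lower N)"
proof (induction rule: par.induct)
  case (Abs L g M M')
  have "tl \<circ> case_nat L g = case_nat (tl L) (tl \<circ> g)"
    by (auto simp: fun_eq_iff split: nat.splits)
  with Abs show ?case by (simp only: lower.simps par.Abs)
next
  case (beta L g M M' N N')
  have "tl \<circ> case_nat L g = case_nat (tl L) (tl \<circ> g)"
    by (auto simp: fun_eq_iff split: nat.splits)
  moreover have "deg (tl \<circ> g) (lower N) = tl L"
    using beta by (simp only: deg_lower)
  ultimately show ?case
    using beta.IH by (simp only: lower.simps lower_inst par.beta)
next
  case (eta g M M' L)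
  then show ?case by (simp only: lower.simps lower_ren par.eta)
qed (simp_all add: par.intros)

lemma betaeta_unlift:
  assumes "betaeta\<^sup>*\<^sup>* (lift i M) N" "M \<in> terms"
  shows "\<exists>N0. N = lift i N0 \<and> betaeta\<^sup>*\<^sup>* M N0"
  using assms(1)
proof (induction rule: rtranclp_induct)
  case base
  then show ?case by auto
next
  case (step N N')
  then obtain N0 where N0: "N = lift i N0" "betaeta\<^sup>*\<^sup>* M N0" by blast
  then have N0t: "N0 \<in> terms" using betaeta_rtranclp_terms assms(2) by blast
  have N': "N' \<in> terms" "degree N' = i # degree N0"
    using betaeta_terms[OF step(2)] N0t by (auto simp: N0 degree_lift terms_lc)
  obtain N0' where N0': "N' = lift i N0'" using unlift[OF N'] by blast
  \<comment> \<open>The entry 0 is arbitrary; it is there for \<open>tl\<close> to remove, which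
    gives back \<open>g0\<close>.\<close>
  have "par (\<lambda>n. 0 # g0 n) N N'"
    using step(2) beta_par eta_par by (auto simp: betaeta_def)
  from par_lower[OF this] have "par g0 N0 N0'"
    by (simp add: N0 N0' o_def)
  then have "betaeta\<^sup>*\<^sup>* N0 N0'" using par_betaeta N0t by blast
  with N0 N0' show ?case by auto
qed

text \<open>Carries soundness from a typed reduct back to the term. All of \<open>U_types\<close> is
  covered; the case \<open>Exp\<close> rests on \<open>betaeta_unlift\<close>, by which a reduct of
  a lift is the lift of a reduct.\<close>

lemma interp_betaeta_expansion:
  assumes I: "interpretation_of betaeta V1 I" "infinite V1"
  shows "U \<in> U_types \<Longrightarrow> M \<in> terms \<Longrightarrow> betaeta\<^sup>*\<^sup>* M N \<Longrightarrow> N \<in> interp I U \<Longrightarrow> M \<in> interp I U"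
proof (induction U arbitrary: M N)
  case (Atom a)
  then show ?case using I unfolding interpretation_of_def saturated_def by (metis interp.simps(1))
next
  case (Arr U T)
  note MN = betaeta_rtranclp_terms[OF Arr.prems(3,2)]
  have "App M P \<in> interp I T" if P: "P \<in> interp I U" "joinable M P" for P
  proof -
    have "joinable N P" using P(2) MN by (auto intro: joinable_mono)
    then have N: "App N P \<in> interp I T" using Arr.prems(4) P(1) by (simp add: fun_space_def)
    then have "App N P \<in> terms"
      using interp_terms_of[OF I, of T] Arr.prems(1) T_types_U by (auto simp: terms_of_def)
    then have M: "App M P \<in> terms" using MN Arr.prems(2) P(2) by (simp add: App_terms_iff)
    have "betaeta\<^sup>*\<^sup>* (App M P) (App N P)"
      using Arr.prems(3) M by (intro betaeta_App) auto
    then show ?thesis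
      using Arr.IH(2)[OF _ M _ N] Arr.prems(1) T_types_U by auto
  qed
  then show ?case using Arr.prems(2) by (simp add: fun_space_def)
next
  case (Omega L)
  then show ?case using betaeta_rtranclp_terms[of M N] by (simp add: terms_of_def)
next
  case (Inter U V)
  then show ?case by auto
next
  case (Exp i U)
  then obtain N0 where N0: "N = lift i N0" "N0 \<in> interp I U" by auto
  then have "N0 \<in> terms" using interp_terms_of[OF I, of U] Exp.prems(1) by (auto simp: terms_of_def)
  then have "degree M = i # degree N0"
    using betaeta_rtranclp_terms[OF Exp.prems(3,2)] by (simp add: N0 degree_lift terms_lc)
  then obtain M0 where M0: "M0 \<in> terms" "M = lift i M0" using unlift Exp.prems(2) by blast
  then have "betaeta\<^sup>*\<^sup>* M0 N0"
    using betaeta_unlift[of i M0 N] Exp.prems(3) N0 by auto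
  then have "M0 \<in> interp I U" using Exp.IH[of M0 N0] Exp.prems(1) M0 N0 by auto
  then show ?case using M0 by simp
qed

section \<open>Completeness\<close>

instance ty :: countable
  by countable_datatype

lemma ex_type_assignment:
  assumes "infinite (V :: var set)"
  shows "\<exists>f :: var \<Rightarrow> ty. \<forall>U. infinite {x \<in> V. f x = U}"
proof -
  let ?e = "enumerate V"
  have inj: "inj ?e" using strict_mono_enumerate[OF assms] by (rule strict_mono_imp_inj_on)
  \<comment> \<open>The position of a name in \<open>V\<close> is decoded as a pair: the first half
    codes the type, the second leaves infinitely many names for each type.\<close>
  define f :: "var \<Rightarrow> ty" where "f x = from_nat (fst (prod_decode (inv ?e x)))" for x
  have "infinite {x \<in> V. f x = U}" for U
  proof -
    let ?k = "\<lambda>k. ?e (prod_encode (to_nat U, k))"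
    have "inj ?k"
      by (rule injI) (auto dest!: injD[OF inj])
    then have "infinite (range ?k)" by (simp add: range_inj_infinite)
    moreover have "range ?k \<subseteq> {x \<in> V. f x = U}"
      using enumerate_in_set[OF assms] by (auto simp: f_def inv_f_f[OF inj])
    ultimately show ?thesis by (rule infinite_super[rotated])
  qed
  then show ?thesis by blast
qed

text \<open>Variables of the first kind receive the largest filter, so that all neutral terms
  headed by them have every type; a variable of the second kind behaves as if declared with the
  type chosen for its name, lifted to its index.\<close>

definition canon :: "var set \<Rightarrow> (var \<Rightarrow> ty) \<Rightarrow> atom \<Rightarrow> ty set" where
  "canon V1 f v = (case v of
      Inl (x, L) \<Rightarrow> (if x \<in> V1 then T_types else upset (tys (f x)))
    | Inr n \<Rightarrow> {})"

context
  fixes V1 V2 :: "var set" and f :: "var \<Rightarrow> ty"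
  assumes V: "V1 \<inter> V2 = {}" and f: "\<And>U. infinite {x \<in> V2. f x = U}"
begin

abbreviation val :: "trm \<Rightarrow> ty set" where "val M \<equiv> sem g0 (canon V1 f) M"

lemma canon_filt: "filt (canon V1 f v)"
proof -
  have "filt T_types" by (auto simp: filt_def upset_def)
  then show ?thesis by (auto simp: canon_def split: sum.splits)
qed

lemma val_T_types: "val M \<subseteq> T_types"
  using sem_filt[of "canon V1 f" g0 M] canon_filt by (simp add: filt_def)

lemma val_betaeta: "betaeta\<^sup>*\<^sup>* M N \<Longrightarrow> M \<in> terms \<Longrightarrow> val M \<subseteq> val N"
  by (rule sem_betaeta[of M N "canon V1 f"]) (simp_all add: canon_filt)

lemma val_beta_expansion: "beta M N \<Longrightarrow> val N \<subseteq> val M"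
  by (rule sem_beta_expansion[of M N "canon V1 f"]) (simp_all add: canon_filt)

text \<open>The canonical valuation looks at names only, so changing the indexes of variables does
  not affect it.\<close>

lemma val_lift: "M \<in> terms \<Longrightarrow> val (lift i M) = val M"
proof -
  assume "M \<in> terms"
  moreover have "canon V1 f \<circ> lift_atom i = canon V1 f"
  proof
    fix v show "(canon V1 f \<circ> lift_atom i) v = canon V1 f v"
      by (cases "(i, v)" rule: lift_atom.cases) (auto simp: canon_def)
  qed
  ultimately show ?thesis by (simp add: sem_lift terms_lc)
qed

lemma val_neutral: "apps (FVar x L) Ns \<in> terms \<Longrightarrow> x \<in> V1 \<Longrightarrow> val (apps (FVar x L) Ns) = T_types"
proof (induction Ns rule: rev_induct)
  case Nil
  then show ?case by (simp add: apps_def canon_def)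
next
  case (snoc N Ns)
  let ?M = "apps (FVar x L) Ns"
  have t: "?M \<in> terms" "prefix (degree ?M) (degree N)"
    using snoc.prems by (auto simp: apps_snoc App_terms_iff)
  then obtain J where J: "degree N = degree ?M @ J" by (auto elim: prefixE)
  \<comment> \<open>The value of the head is all of \<open>T_types\<close> and thus contains
    \<open>Arr (Omega J) T\<close>, whose domain asks nothing of \<open>N\<close> but its
    degree.\<close>
  have "T \<in> val (App ?M N)" if "T \<in> T_types" for T
    using snoc t J that by (auto simp: degree_deg intro!: exI[of _ "Omega J"])
  then show ?case using val_T_types[of "App ?M N"] unfolding apps_snoc by blast
qed

lemma closed_typing_of_val:
  assumes "M \<in> terms" "closed M" "U \<in> U_types" "tdegree U = degree M" "tys U \<subseteq> val M"
  shows "typing M Map.empty U"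
proof -
  have "val M = sem g0 (env_val Map.empty) M"
    using assms(1) by (rule sem_terms_cong) (use assms(2) in \<open>simp add: closed_def\<close>)
  then show ?thesis using assms by (intro typing_of_sem) (auto simp: env_for_def closed_def)
qed

lemma fresh_typed_variable:
  obtains x where "x \<in> V2" "f x = U" "\<And>L. (x, L) \<notin> fv M"
  using fresh_name[OF _ f[of U], of "fv M"] by auto

lemma canon_V2: "x \<in> V2 \<Longrightarrow> canon V1 f (Inl (x, L)) = upset (tys (f x))"
  using V by (auto simp: canon_def)

lemma val_FVar: "x \<in> V2 \<Longrightarrow> U \<in> U_types \<Longrightarrow> f x = U \<Longrightarrow> tys U \<subseteq> val (FVar x L)"
  using upset_ext[OF tys_T_types] by (simp add: canon_V2)

section \<open>The canonical interpretations\<close>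

definition I_beta :: "nat \<Rightarrow> trm set" where
  "I_beta a = {M \<in> terms_of []. Atom a \<in> val M}"

definition I_betaeta :: "nat \<Rightarrow> trm set" where
  "I_betaeta a = {M \<in> terms_of []. \<exists>N. betaeta\<^sup>*\<^sup>* M N \<and> Atom a \<in> val N}"

lemma neutral_val: "x \<in> V1 \<Longrightarrow> M \<in> neutral x [] \<Longrightarrow> M \<in> terms_of [] \<and> val M = T_types"
  using val_neutral
  by (auto simp: neutral_def terms_of_def degree_apps) (auto simp: degree_deg)

lemma I_beta: "interpretation_of beta V1 I_beta"
  unfolding interpretation_of_def saturated_def
proof (intro allI conjI ballI impI subsetI)
  show "M \<in> terms_of []" if "M \<in> I_beta a" for a M
    using that by (simp add: I_beta_def)
  show "M \<in> I_beta a" if "x \<in> V1" "M \<in> neutral x []" for a x M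
    using neutral_val[OF that] by (simp add: I_beta_def)
  fix a M N assume "M \<in> terms" "N \<in> I_beta a" "beta\<^sup>*\<^sup>* M N"
  from this(3,1,2) show "M \<in> I_beta a"
  proof (induction rule: converse_rtranclp_induct)
    case (step M M')
    then show ?case
      using beta_terms[OF step(1)] val_beta_expansion[OF step(1)]
      by (auto simp: I_beta_def terms_of_def)
  qed
qed

lemma I_betaeta: "interpretation_of betaeta V1 I_betaeta"
  unfolding interpretation_of_def saturated_def
proof (intro allI conjI ballI impI subsetI)
  show "M \<in> terms_of []" if "M \<in> I_betaeta a" for a M
    using that by (simp add: I_betaeta_def)
  show "M \<in> I_betaeta a" if "x \<in> V1" "M \<in> neutral x []" for a x M
    using neutral_val[OF that] by (auto simp: I_betaeta_def)
  fix a M N assume "M \<in> terms" "N \<in> I_betaeta a" "betaeta\<^sup>*\<^sup>* M N"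
  then show "M \<in> I_betaeta a"
    using betaeta_rtranclp_terms[of M N] unfolding I_betaeta_def terms_of_def
    by (auto intro: rtranclp_trans)
qed

text \<open>The application uses some arrow with domain \<open>U'\<close>, and the components of
  \<open>U'\<close> lie in the filter of \<open>U\<close>. Hence \<open>U\<close> is a subtype of
  \<open>U'\<close>, and the value of \<open>M\<close>, being upward closed, contains the arrow with
  domain \<open>U\<close>.\<close>

lemma val_App_FVar:
  assumes "x \<in> V2" "f x = U" "U \<in> U_types" "T \<in> val (App M (FVar x (tdegree U)))" "degree M = []"
  shows "Arr U T \<in> val M"
proof -
  obtain U' where U': "Arr U' T \<in> val M" "tdegree U' = tdegree U" "tys U' \<subseteq> upset (tys U)"
    using assms by (auto simp: canon_V2 degree_deg)
  have "Arr U' T \<in> T_types" using U'(1) val_T_types by blast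
  moreover from this have "sub U U'" using U' assms(3) by (intro sub_iff_upset) auto
  ultimately show ?thesis
    using assms(3) by (intro filtD[OF sem_filt[OF canon_filt] U'(1)])
      (auto intro!: sub.Arr sub_refl simp: T_types_U)
qed

lemma val_App:
  assumes "Arr U T \<in> val M" "tys U \<subseteq> val N" "degree M = []" "degree N = tdegree U"
  shows "T \<in> val (App M N)"
  using assms by (auto simp: degree_deg)

lemma FVar_terms_of: "FVar x L \<in> terms_of L"
  by (simp add: terms_of_def terms.FVar) (simp add: degree_deg)

lemma joinable_FVar: "(\<And>L. (x, L) \<notin> fv M) \<Longrightarrow> joinable M (FVar x K)"
  by (auto simp: joinable_def joinable_sets_def)

lemma App_terms_of_Nil: "App M N \<in> terms_of [] \<Longrightarrow> M \<in> terms_of []"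
  by (auto simp: terms_of_def App_terms_iff) (simp add: degree_deg)

lemma App_terms_ofI:
  "M \<in> terms_of [] \<Longrightarrow> N \<in> terms_of L \<Longrightarrow> joinable M N \<Longrightarrow> App M N \<in> terms_of []"
  by (auto simp: terms_of_def App_terms_iff) (simp add: degree_deg)

lemma interp_I_beta:
  "U \<in> U_types \<Longrightarrow> interp I_beta U = {M \<in> terms_of (tdegree U). tys U \<subseteq> val M}"
proof (induction U)
  case (Atom a)
  then show ?case by (simp add: I_beta_def)
next
  case (Arr U T)
  then have U: "interp I_beta U = {M \<in> terms_of (tdegree U). tys U \<subseteq> val M}"
    and T: "interp I_beta T = {M \<in> terms_of []. T \<in> val M}"
    by (auto simp: T_types_simps T_types_U)
  show ?case
  proof (intro set_eqI iffI)
    fix M assume M: "M \<in> interp I_beta (Arr U T)"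
    obtain x where x: "x \<in> V2" "f x = U" "\<And>L. (x, L) \<notin> fv M"
      using fresh_typed_variable by blast
    have "FVar x (tdegree U) \<in> interp I_beta U"
      using val_FVar[OF x(1) _ x(2)] Arr.prems by (simp add: U FVar_terms_of)
    then have MN: "App M (FVar x (tdegree U)) \<in> interp I_beta T"
      using M joinable_FVar[OF x(3)] by (simp add: fun_space_def)
    then have "M \<in> terms_of []" unfolding T using App_terms_of_Nil by blast
    then show "M \<in> {M \<in> terms_of (tdegree (Arr U T)). tys (Arr U T) \<subseteq> val M}"
      using val_App_FVar[OF x(1,2)] MN Arr.prems by (simp add: T terms_of_def)
  next
    fix M assume "M \<in> {M \<in> terms_of (tdegree (Arr U T)). tys (Arr U T) \<subseteq> val M}"
    then have M: "M \<in> terms_of []" "Arr U T \<in> val M" by auto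
    have "App M N \<in> interp I_beta T" if N: "N \<in> interp I_beta U" "joinable M N" for N
      using N M val_App[OF M(2)] App_terms_ofI[OF M(1)] unfolding U T by (auto simp: terms_of_def)
    then show "M \<in> interp I_beta (Arr U T)" using M by (simp add: fun_space_def terms_of_def)
  qed
next
  case (Exp i U)
  show ?case
  proof (intro set_eqI iffI)
    fix M assume "M \<in> interp I_beta (Exp i U)"
    then show "M \<in> {M \<in> terms_of (tdegree (Exp i U)). tys (Exp i U) \<subseteq> val M}"
      using Exp by (auto simp: terms_of_def lift_terms degree_lift terms_lc val_lift)
  next
    fix M assume "M \<in> {M \<in> terms_of (tdegree (Exp i U)). tys (Exp i U) \<subseteq> val M}"
    then have M: "M \<in> terms" "degree M = i # tdegree U" "tys U \<subseteq> val M" by (auto simp: terms_of_def)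
    obtain M0 where "M0 \<in> terms" "M = lift i M0" "degree M0 = tdegree U"
      using unlift[OF M(1,2)] by blast
    then show "M \<in> interp I_beta (Exp i U)"
      using M(3) Exp by (auto simp: terms_of_def val_lift)
  qed
qed auto

lemma interp_I_betaeta:
  "U \<in> U_types \<Longrightarrow> interp I_betaeta U =
    {M \<in> terms_of (tdegree U). \<exists>N. betaeta\<^sup>*\<^sup>* M N \<and> tys U \<subseteq> val N}"
proof (induction U)
  case (Atom a)
  then show ?case by (simp add: I_betaeta_def)
next
  case (Arr U T)
  then have U: "interp I_betaeta U = {M \<in> terms_of (tdegree U). \<exists>N. betaeta\<^sup>*\<^sup>* M N \<and> tys U \<subseteq> val N}"
    and T: "interp I_betaeta T = {M \<in> terms_of []. \<exists>N. betaeta\<^sup>*\<^sup>* M N \<and> T \<in> val N}"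
    by (auto simp: T_types_simps T_types_U)
  show ?case
  proof (intro set_eqI iffI)
    fix M assume M: "M \<in> interp I_betaeta (Arr U T)"
    obtain x where x: "x \<in> V2" "f x = U" "\<And>L. (x, L) \<notin> fv M"
      using fresh_typed_variable by blast
    let ?x = "FVar x (tdegree U)"
    have "?x \<in> interp I_betaeta U"
      using val_FVar[OF x(1) _ x(2), of "tdegree U"] Arr.prems FVar_terms_of[of x "tdegree U"]
      unfolding U by (auto simp del: sem.simps)
    then have MN: "App M ?x \<in> interp I_betaeta T"
      using M joinable_FVar[OF x(3)] by (simp add: fun_space_def)
    then obtain N where N: "App M ?x \<in> terms_of []" "betaeta\<^sup>*\<^sup>* (App M ?x) N" "T \<in> val N"
      unfolding T by blast
    have Mt: "M \<in> terms_of []" using N(1) App_terms_of_Nil by blast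
    have Nt: "N \<in> terms" "degree N = []"
      using N betaeta_rtranclp_terms[OF N(2)] by (auto simp: terms_of_def)
    let ?l = "lam x (tdegree U) (App M ?x)"
    have l: "?l \<in> terms" using N(1) by (auto simp: terms_of_def intro: terms.lam)
    have "betaeta\<^sup>*\<^sup>* ?l M"
    proof (rule r_into_rtranclp)
      show "betaeta ?l M"
        using N(1) x(3) by (auto simp: betaeta_def terms_of_def intro: eta.redex)
    qed
    moreover have "betaeta\<^sup>*\<^sup>* ?l (lam x (tdegree U) N)"
      using N l by (intro betaeta_lam) (auto simp: terms_of_def)
    ultimately obtain P where P: "betaeta\<^sup>*\<^sup>* M P" "betaeta\<^sup>*\<^sup>* (lam x (tdegree U) N) P"
      using betaeta_confluent l by metis
    \<comment> \<open>The canonical valuation already assigns the filter of \<open>U\<close> to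
      \<open>x\<close>, so the body of the abstraction is evaluated in that same valuation.\<close>
    have "(canon V1 f)(Inl (x, tdegree U) := upset (tys U)) = canon V1 f"
      using x(1,2) by (intro fun_upd_idem) (simp add: canon_V2)
    then have "Arr U T \<in> val (lam x (tdegree U) N)"
      using N(3) Nt Arr.prems by (simp add: sem_lam)
    moreover have "lam x (tdegree U) N \<in> terms"
      using Nt by (auto intro: terms.lam)
    ultimately have "Arr U T \<in> val P"
      using val_betaeta[OF P(2)] by blast
    then show "M \<in> {M \<in> terms_of (tdegree (Arr U T)). \<exists>N. betaeta\<^sup>*\<^sup>* M N \<and> tys (Arr U T) \<subseteq> val N}"
      using P Mt by auto
  next
    fix M assume "M \<in> {M \<in> terms_of (tdegree (Arr U T)). \<exists>N. betaeta\<^sup>*\<^sup>* M N \<and> tys (Arr U T) \<subseteq> val N}"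
    then obtain N where M: "M \<in> terms_of []" "betaeta\<^sup>*\<^sup>* M N" "Arr U T \<in> val N" by auto
    have N: "degree N = []" using M betaeta_rtranclp_terms[OF M(2)] by (simp add: terms_of_def)
    have "App M P \<in> interp I_betaeta T" if P: "P \<in> interp I_betaeta U" "joinable M P" for P
    proof -
      obtain Q where Q: "P \<in> terms_of (tdegree U)" "betaeta\<^sup>*\<^sup>* P Q" "tys U \<subseteq> val Q"
        using P(1) unfolding U by blast
      have dQ: "degree Q = tdegree U"
        using Q betaeta_rtranclp_terms[OF Q(2)] by (simp add: terms_of_def)
      have MP: "App M P \<in> terms_of []" using App_terms_ofI M(1) Q(1) P(2) by blast
      then have "betaeta\<^sup>*\<^sup>* (App M P) (App N Q)"
        using M(2) Q(2) by (intro betaeta_App) (auto simp: terms_of_def)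
      with MP val_App[OF M(3) Q(3) N dQ] show ?thesis unfolding T by blast
    qed
    then show "M \<in> interp I_betaeta (Arr U T)" using M by (simp add: fun_space_def terms_of_def)
  qed
next
  case (Inter U W)
  show ?case
  proof (intro set_eqI iffI)
    fix M assume "M \<in> interp I_betaeta (Inter U W)"
    then obtain N1 N2 where M: "M \<in> terms_of (tdegree U)" "betaeta\<^sup>*\<^sup>* M N1" "tys U \<subseteq> val N1"
      "betaeta\<^sup>*\<^sup>* M N2" "tys W \<subseteq> val N2"
      using Inter by auto
    then have Mt: "M \<in> terms" by (simp add: terms_of_def)
    obtain P where P: "betaeta\<^sup>*\<^sup>* N1 P" "betaeta\<^sup>*\<^sup>* N2 P"
      using betaeta_confluent[OF M(2,4) Mt] .
    have "N1 \<in> terms" "N2 \<in> terms"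
      using betaeta_rtranclp_terms M(2,4) Mt by blast+
    then have "val N1 \<subseteq> val P" "val N2 \<subseteq> val P"
      using val_betaeta[OF P(1)] val_betaeta[OF P(2)] by blast+
    then have "tys (Inter U W) \<subseteq> val P" using M by auto
    moreover have "betaeta\<^sup>*\<^sup>* M P" using M(2) P(1) by simp
    ultimately show "M \<in> {M \<in> terms_of (tdegree (Inter U W)). \<exists>N. betaeta\<^sup>*\<^sup>* M N \<and> tys (Inter U W) \<subseteq> val N}"
      using M(1) by auto
  next
    fix M assume "M \<in> {M \<in> terms_of (tdegree (Inter U W)). \<exists>N. betaeta\<^sup>*\<^sup>* M N \<and> tys (Inter U W) \<subseteq> val N}"
    then show "M \<in> interp I_betaeta (Inter U W)" using Inter by auto
  qed
next
  case (Exp i U)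
  show ?case
  proof (intro set_eqI iffI)
    fix M assume "M \<in> interp I_betaeta (Exp i U)"
    then obtain M0 N0 where M0: "M = lift i M0" "M0 \<in> terms_of (tdegree U)" "betaeta\<^sup>*\<^sup>* M0 N0"
      "tys U \<subseteq> val N0"
      using Exp by auto
    then have "N0 \<in> terms" using betaeta_rtranclp_terms by (auto simp: terms_of_def)
    then have "tys U \<subseteq> val (lift i N0)" using M0(4) by (simp add: val_lift)
    moreover have "betaeta\<^sup>*\<^sup>* M (lift i N0)" using M0 betaeta_lift by blast
    moreover have "M \<in> terms_of (i # tdegree U)" using M0 lift_terms_of by blast
    ultimately show "M \<in> {M \<in> terms_of (tdegree (Exp i U)). \<exists>N. betaeta\<^sup>*\<^sup>* M N \<and> tys (Exp i U) \<subseteq> val N}"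
      by auto
  next
    fix M assume "M \<in> {M \<in> terms_of (tdegree (Exp i U)). \<exists>N. betaeta\<^sup>*\<^sup>* M N \<and> tys (Exp i U) \<subseteq> val N}"
    then obtain N where M: "M \<in> terms" "degree M = i # tdegree U" "betaeta\<^sup>*\<^sup>* M N" "tys U \<subseteq> val N"
      by (auto simp: terms_of_def)
    obtain M0 where M0: "M0 \<in> terms" "M = lift i M0" "degree M0 = tdegree U"
      using unlift[OF M(1,2)] by blast
    then obtain N0 where N0: "N = lift i N0" "betaeta\<^sup>*\<^sup>* M0 N0"
      using betaeta_unlift M(3) by blast
    then have "N0 \<in> terms" using betaeta_rtranclp_terms M0(1) by blast
    then have "tys U \<subseteq> val N0" using M(4) N0(1) by (simp add: val_lift)
    then have "M0 \<in> interp I_betaeta U" using Exp M0 N0 by (auto simp: terms_of_def)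
    then show "M \<in> interp I_betaeta (Exp i U)" using M0(2) by simp
  qed
qed auto

end

theorem theorem6:
  fixes V1 V2 :: "var set" and U :: ty and L :: index
  assumes "V1 \<union> V2 = UNIV" and "V1 \<inter> V2 = {}" and "infinite V1" and "infinite V2"
    and "U \<in> U_types" and "tdegree U = L"
  shows "realisers betaeta V1 U =
           {M \<in> terms_of L. closed M \<and> (\<exists>N. betaeta\<^sup>*\<^sup>* M N \<and> typing N Map.empty U)}
       \<and> (realisers beta V1 U = realisers head V1 U
           \<and> realisers head V1 U = {M \<in> terms_of L. typing M Map.empty U})
       \<and> (\<forall>M N. M \<in> realisers betaeta V1 U \<longrightarrow> betaeta\<^sup>*\<^sup>* M N \<longrightarrow> N \<in> realisers betaeta V1 U)"
proof -
  obtain f :: "var \<Rightarrow> ty" where f: "\<And>W. infinite {x \<in> V2. f x = W}"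
    using ex_type_assignment[OF assms(4)] by blast
  note canonical = assms(2) f
  let ?val = "sem g0 (canon V1 f)"

  \<comment> \<open>Part (2) closes a cycle of inclusions: typed terms, head realisers, beta
    realisers, typed terms.\<close>
  have typed: "{M \<in> terms_of L. typing M Map.empty U} \<subseteq> realisers head V1 U"
  proof
    fix M assume "M \<in> {M \<in> terms_of L. typing M Map.empty U}"
    then have M: "M \<in> terms" "typing M Map.empty U" by (auto simp: terms_of_def)
    moreover have "closed M" using typing_wf[OF M(2)] by (simp add: env_for_def closed_def)
    moreover have "M \<in> interp I U" if "interpretation_of head V1 I" for I
      using closed_typing_sound[OF that assms(3) _ M(2)] by blast
    ultimately show "M \<in> realisers head V1 U" by (simp add: realisers_def)
  qed
  have head_rtrancl: "beta\<^sup>*\<^sup>* M N" if "head\<^sup>*\<^sup>* M N" for M N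
    using that by (induction rule: rtranclp_induct) (auto dest: head_beta intro: rtranclp.intros)
  have head_betaeta: "betaeta\<^sup>*\<^sup>* M N" if "head M N" for M N
    using head_beta[OF that] by (auto simp: betaeta_def)
  \<comment> \<open>Head reduction is contained in beta reduction, so every beta interpretation is a
    head interpretation and head realisers have more interpretations to satisfy.\<close>
  have head_in_beta: "realisers head V1 U \<subseteq> realisers beta V1 U"
  proof -
    have "interpretation_of head V1 I" if "interpretation_of beta V1 I" for I
      using that head_rtrancl unfolding interpretation_of_def saturated_def by blast
    then show ?thesis by (auto simp: realisers_def)
  qed
  have beta: "realisers beta V1 U \<subseteq> {M \<in> terms_of L. typing M Map.empty U}"
  proof
    fix M assume "M \<in> realisers beta V1 U"
    then have M: "M \<in> terms" "closed M" "M \<in> interp (I_beta V1 f) U"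
      using I_beta[OF canonical] by (auto simp: realisers_def)
    then have "M \<in> terms_of L" "tys U \<subseteq> ?val M"
      using interp_I_beta[OF canonical assms(5)] assms(6) by auto
    then show "M \<in> {M \<in> terms_of L. typing M Map.empty U}"
      using closed_typing_of_val[OF canonical M(1,2) assms(5)] assms(6) by (auto simp: terms_of_def)
  qed

  have betaeta_val: "M \<in> terms_of L \<and> closed M \<and> (\<exists>N. betaeta\<^sup>*\<^sup>* M N \<and> tys U \<subseteq> ?val N)"
    if "M \<in> realisers betaeta V1 U" for M
  proof -
    have M: "M \<in> terms" "closed M" "M \<in> interp (I_betaeta V1 f) U"
      using that I_betaeta[OF canonical] by (auto simp: realisers_def)
    then show ?thesis using interp_I_betaeta[OF canonical assms(5)] assms(6) by auto
  qed
  have val_typing: "typing N Map.empty U"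
    if "M \<in> terms_of L" "closed M" "betaeta\<^sup>*\<^sup>* M N" "tys U \<subseteq> ?val N" for M N
  proof -
    have "N \<in> terms" "closed N" "degree N = L"
      using that betaeta_rtranclp_terms[OF that(3)] by (auto simp: terms_of_def closed_def)
    then show ?thesis using closed_typing_of_val[OF canonical] that(4) assms(5,6) by simp
  qed
  have expansion: "M \<in> realisers betaeta V1 U"
    if "M \<in> terms" "closed M" "betaeta\<^sup>*\<^sup>* M N" "typing N Map.empty U" for M N
  proof -
    have "M \<in> interp I U" if I: "interpretation_of betaeta V1 I" for I
    proof -
      have "N \<in> interp I U"
        using closed_typing_sound[OF I assms(3) head_betaeta \<open>typing N Map.empty U\<close>] by blast
      then show ?thesis
        using interp_betaeta_expansion[OF I assms(3,5)] \<open>M \<in> terms\<close> \<open>betaeta\<^sup>*\<^sup>* M N\<close> by blast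
    qed
    then show ?thesis using that by (simp add: realisers_def)
  qed
  have 1: "realisers betaeta V1 U =
      {M \<in> terms_of L. closed M \<and> (\<exists>N. betaeta\<^sup>*\<^sup>* M N \<and> typing N Map.empty U)}"
    using betaeta_val val_typing expansion by (fastforce simp: terms_of_def)
  have 3: "N \<in> realisers betaeta V1 U" if M: "M \<in> realisers betaeta V1 U" "betaeta\<^sup>*\<^sup>* M N" for M N
  proof -
    obtain N0 where N0: "M \<in> terms_of L" "closed M" "betaeta\<^sup>*\<^sup>* M N0" "tys U \<subseteq> ?val N0"
      using betaeta_val[OF M(1)] by blast
    then have Mt: "M \<in> terms" by (simp add: terms_of_def)
    obtain P where P: "betaeta\<^sup>*\<^sup>* N0 P" "betaeta\<^sup>*\<^sup>* N P"
      using betaeta_confluent[OF N0(3) M(2) Mt] .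
    have "N0 \<in> terms" using betaeta_rtranclp_terms[OF N0(3) Mt] by blast
    then have "tys U \<subseteq> ?val P"
      using N0(4) val_betaeta[OF canonical P(1)] by blast
    moreover have "betaeta\<^sup>*\<^sup>* M P" using N0(3) P(1) by simp
    ultimately have "typing P Map.empty U" using val_typing N0(1,2) by blast
    moreover have "N \<in> terms" "closed N"
      using betaeta_rtranclp_terms[OF M(2) Mt] N0(2) by (auto simp: closed_def)
    ultimately show ?thesis using expansion P(2) by blast
  qed
  show ?thesis using 1 3 typed head_in_beta beta by blast
qed

end
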